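(* For every $\beta>0$, the $\beta$-Tracy-Widom distribution is not infinitely divisible. In particular (taking $\beta=1,2,4$), the classical Tracy-Widom distributions $F_1,F_2,F_4$ are not infinitely divisible.
   Context: For $\beta>0$ and $N\ge1$, let $H_N^\beta$ be the $N\times N$ symmetric tridiagonal random matrix $\frac{1}{\sqrt\beta}T$, where $T$ has independent diagonal entries distributed $N(0,2)$ and independent off-diagonal entries $T_{k,k+1}=T_{k+1,k}\sim\chi_{(N-k)\beta}$ for $k=1,\dots,N-1$; here $\chi_t$ has density $2^{1-t/2}x^{t-1}e^{-x^2/2}/\Gamma(t/2)$ on $x>0$. Let $\lambda_{\max}$ be the largest eigenvalue of $H_N^\beta$. The $\beta$-Tracy-Widom random variable $TW_\beta$ is the distributional limit of $N^{1/6}(\lambda_{\max}-2\sqrt N)$ as $N\to\infty$. It is known that for every $\beta>0$, as $x\to\infty$: $P(TW_\beta\le -x)=\exp\{-\tfrac{1}{24}\beta x^3[1+o(1)]\}$ and $P(TW_\beta>x)=\exp\{-\tfrac23\beta x^{3/2}[1+o(1)]\}$. For $\beta=1,2,4$ the law of $TW_\beta$ is the classical Tracy-Widom distribution $F_\beta(x)=\lim_{N\to\infty}P[N^{1/6}(\lambda_{\max}-2\sqrt N)\le x]$ for the largest eigenvalue of the GOE/GUE/GSE. A random variable $X$ is infinitely divisible if for each $n\ge1$ there are i.i.d. $X_1,\dots,X_n$ with $X_1+\cdots+X_n$ equal in distribution to $X$. *)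

theory Defs
  imports "HOL-Probability.Probability"
begin

definition gauss2 :: "real measure" where
  "gauss2 = density lborel (normal_density 0 (sqrt 2))"

definition chi_density :: "real \<Rightarrow> real \<Rightarrow> real" where
  "chi_density t x = (if x > 0 then 2 powr (1 - t/2) * x powr (t - 1) * exp (- x\<^sup>2 / 2) / Gamma (t/2) else 0)"

definition chi_measure :: "real \<Rightarrow> real measure" where
  "chi_measure t = density lborel (\<lambda>x. ennreal (chi_density t x))"

text \<open>Joint law of the entries: diagonal entries g k (k = 1..N), independent N(0,2);
  off-diagonal entries c k (k = 1..N-1), independent chi_{(N-k) beta}; all independent.\<close>
definition entries_law :: "real \<Rightarrow> nat \<Rightarrow> ((nat \<Rightarrow> real) \<times> (nat \<Rightarrow> real)) measure" where
  "entries_law \<beta> N =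
     (PiM {1..N} (\<lambda>k. gauss2)) \<Otimes>\<^sub>M (PiM {1..N-1} (\<lambda>k. chi_measure (real (N - k) * \<beta>)))"

text \<open>The matrix H_N^beta = T / sqrt beta, indices 1..N.\<close>
definition beta_matrix :: "real \<Rightarrow> (nat \<Rightarrow> real) \<Rightarrow> (nat \<Rightarrow> real) \<Rightarrow> nat \<Rightarrow> nat \<Rightarrow> real" where
  "beta_matrix \<beta> g c i j = (1 / sqrt \<beta>) *
     (if i = j then g i else if j = i + 1 then c i else if i = j + 1 then c j else 0)"

definition eigenvalues :: "nat \<Rightarrow> (nat \<Rightarrow> nat \<Rightarrow> real) \<Rightarrow> real set" where
  "eigenvalues N A = {l. \<exists>v :: nat \<Rightarrow> real. (\<exists>i\<in>{1..N}. v i \<noteq> 0) \<and>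
       (\<forall>i\<in>{1..N}. (\<Sum>j=1..N. A i j * v j) = l * v i)}"

definition lambda_max :: "nat \<Rightarrow> (nat \<Rightarrow> nat \<Rightarrow> real) \<Rightarrow> real" where
  "lambda_max N A = Max (eigenvalues N A)"

definition TW_approx_law :: "real \<Rightarrow> nat \<Rightarrow> real measure" where
  "TW_approx_law \<beta> N = distr (entries_law \<beta> N) borel
     (\<lambda>(g, c). real N powr (1/6) * (lambda_max N (beta_matrix \<beta> g c) - 2 * sqrt (real N)))"

definition iid_sum_law :: "real measure \<Rightarrow> nat \<Rightarrow> real measure" where
  "iid_sum_law \<nu> n = distr (PiM {..<n} (\<lambda>_. \<nu>)) borel (\<lambda>x. \<Sum>i<n. x i)"

definition infinitely_divisible :: "real measure \<Rightarrow> bool" where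
  "infinitely_divisible \<mu> \<longleftrightarrow>
     (\<forall>n::nat. n \<ge> 1 \<longrightarrow> (\<exists>\<nu>. real_distribution \<nu> \<and> iid_sum_law \<nu> n = \<mu>))"

end

theory Submission
  imports Defs "HOL-Complex_Analysis.Complex_Analysis" "HOL-Real_Asymp.Real_Asymp"
begin

text \<open>
  Infinite divisibility forces the moment generating function of a law with exponential moments of
  order \<open>exp (C (1 + |s|)\<^sup>3)\<close> to be an exponential of a quadratic: \<open>n\<close>-th roots of all orders
  leave no room for complex zeros, the logarithm is a polynomial of degree at most three by
  Borel--Caratheodory and Liouville, and the ridge property \<open>|\<phi> (s + i t)| \<le> \<phi> s\<close> bounds the
  cubic coefficient from above. For the Tracy--Widom law the moment generating function does have such an
  upper bound, but it grows like \<open>exp (c s\<^sup>3)\<close>.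

  The bounds on the moment generating function come from the tridiagonal model. A tent-shaped
  trial vector of width \<open>a N powr (1/3)\<close> has a Rayleigh quotient whose exponential moments are products of
  explicit Gaussian and chi moments; \<open>a = 1\<close> controls the left tail and \<open>a\<close> of order
  \<open>1 / s\<close> gives the cubic lower bound. The right tail follows from the pivots of
  \<open>\<lambda> - H\<close>, a Markov chain that must drop far below its equilibrium if \<open>\<lambda>\<close> is exceeded by
  an eigenvalue; a stopped exponential supermartingale bounds the probability of that event.
\<close>

section \<open>Infinitely divisible laws with exponential moments\<close>

text \<open>The upper bound and the lower bound for the Tracy-Widom law are both of cubic order, so
  growth alone gives no contradiction. What excludes a cubic logarithm is the ridge property on the
  whole real axis: it makes \<open>3 * s * Re (a 3) + Re (a 2)\<close> nonnegative for every real
  \<open>s\<close>, and negative \<open>s\<close> then forbid a positive cubic coefficient. Hence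
  the moment generating function has to be controlled on both half-axes, although the contradiction
  itself appears as \<open>s\<close> tends to plus infinity.

  Constants are nowhere sharp, only exponents matter. A right tail of order exp (- c x^(3/2)) is
  dual to growth exp (C s^3); on the left any bound of at most cubic order is enough, and the tent
  gives a quadratic one.

  The limit law is accessible only through weak convergence, which by itself controls neither
  moments nor tails. All estimates are therefore uniform in large \<open>N\<close>. Upper bounds
  pass to the limit by truncation and Fatou; the lower bound could be lost with mass escaping to
  infinity, and is protected by a second exponential moment of the trial statistic.\<close>

definition exp_moments :: "real measure \<Rightarrow> bool" where
  "exp_moments \<mu> \<longleftrightarrow> (\<forall>s::real. integrable \<mu> (\<lambda>x. exp (s * x)))"

text \<open>For a real distribution with \<open>exp_moments\<close> this is the entire function
  whose restriction to the imaginary axis is the characteristic function.\<close>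

definition cmgf :: "real measure \<Rightarrow> complex \<Rightarrow> complex" where
  "cmgf \<mu> z = (\<integral>x. exp (z * of_real x) \<partial>\<mu>)"

lemma integrable_cexp:
  assumes "real_distribution \<mu>" "exp_moments \<mu>"
  shows "integrable \<mu> (\<lambda>x. exp (z * complex_of_real x))"
proof -
  interpret real_distribution \<mu> by fact
  have "integrable \<mu> (\<lambda>x. exp (Re z * x))"
    using assms(2) by (auto simp: exp_moments_def)
  then show ?thesis
    by (rule Bochner_Integration.integrable_bound) auto
qed

lemma norm_cmgf_le:
  assumes "real_distribution \<mu>" "exp_moments \<mu>"
  shows "norm (cmgf \<mu> z) \<le> (\<integral>x. exp (Re z * x) \<partial>\<mu>)"
proof -
  have "norm (cmgf \<mu> z) \<le> (\<integral>x. norm (exp (z * complex_of_real x)) \<partial>\<mu>)"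
    unfolding cmgf_def by (rule integral_norm_bound)
  then show ?thesis by simp
qed

lemma cmgf_of_real: "cmgf \<mu> (of_real s) = of_real (\<integral>x. exp (s * x) \<partial>\<mu>)"
  unfolding cmgf_def by (subst integral_complex_of_real[symmetric]) (simp add: exp_of_real[symmetric])

text \<open>The exponential series is integrated term by term, with exp (r |x|) \<le> exp (r x) +
  exp (- r x) as integrable majorant. The result is a power series that converges
  everywhere.\<close>

lemma cmgf_holomorphic:
  assumes "real_distribution \<mu>" "exp_moments \<mu>"
  shows "cmgf \<mu> holomorphic_on UNIV"
proof -
  interpret real_distribution \<mu> by fact
  define a where "a n = (\<integral>x. (complex_of_real x ^ n / fact n) \<partial>\<mu>)" for n
  have int_abs: "integrable \<mu> (\<lambda>x. exp (r * \<bar>x\<bar>))" if "r \<ge> 0" for r :: real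
  proof -
    have "integrable \<mu> (\<lambda>x. exp (r * x) + exp ((-r) * x))"
      using assms(2) unfolding exp_moments_def by (intro Bochner_Integration.integrable_add) blast+
    then show ?thesis
    proof (rule Bochner_Integration.integrable_bound)
      have "exp (r * \<bar>x\<bar>) \<le> exp (r * x) + exp ((-r) * x)" for x by (auto simp: abs_if)
      then show "AE x in \<mu>. norm (exp (r * \<bar>x\<bar>)) \<le> norm (exp (r * x) + exp ((-r) * x))"
        by (auto intro!: AE_I2 order_trans[OF _ abs_ge_self])
    qed simp
  qed
  have sums_pow: "(\<lambda>n. a n * z ^ n) sums cmgf \<mu> z" for z
  proof -
    define r where "r = norm z"
    have r0: "r \<ge> 0" by (simp add: r_def)
    let ?f = "\<lambda>n x. (z * complex_of_real x) ^ n /\<^sub>R fact n"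
    have nf: "norm (?f n x) = (r * \<bar>x\<bar>) ^ n /\<^sub>R fact n" for n x
      by (simp add: r_def norm_power norm_mult)
    have sm: "(\<lambda>n. (r * \<bar>x\<bar>) ^ n /\<^sub>R fact n) sums exp (r * \<bar>x\<bar>)" for x
      by (rule exp_converges)
    have pos: "0 \<le> (r * \<bar>x\<bar>) ^ n /\<^sub>R fact n" for x n using r0 by simp
    have intr: "integrable \<mu> (\<lambda>x. (r * \<bar>x\<bar>) ^ n /\<^sub>R fact n)" for n
    proof (rule Bochner_Integration.integrable_bound[OF int_abs[OF r0]])
      show "AE x in \<mu>. norm ((r * \<bar>x\<bar>) ^ n /\<^sub>R fact n) \<le> norm (exp (r * \<bar>x\<bar>))"
      proof (rule AE_I2)
        fix x
        have "(\<Sum>k\<in>{n}. (r * \<bar>x\<bar>) ^ k /\<^sub>R fact k) \<le> exp (r * \<bar>x\<bar>)"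
          unfolding sums_unique[OF sm] by (rule sum_le_suminf) (use sm pos in \<open>auto simp: sums_iff\<close>)
        then show "norm ((r * \<bar>x\<bar>) ^ n /\<^sub>R fact n) \<le> norm (exp (r * \<bar>x\<bar>))"
          using pos by (simp del: real_scaleR_def)
      qed
    qed simp
    have intf: "integrable \<mu> (?f n)" for n
    proof (rule Bochner_Integration.integrable_bound[OF intr[of n]])
      show "AE x in \<mu>. norm (?f n x) \<le> norm ((r * \<bar>x\<bar>) ^ n /\<^sub>R fact n)"
        unfolding nf by (intro AE_I2) (metis abs_ge_self real_norm_def)
    qed simp
    have summ: "summable (\<lambda>n. \<integral>x. norm (?f n x) \<partial>\<mu>)"
    proof (rule summableI_nonneg_bounded)
      fix m
      show "0 \<le> (\<integral>x. norm (?f m x) \<partial>\<mu>)" by simp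
      have "(\<Sum>n<m. \<integral>x. norm (?f n x) \<partial>\<mu>) = (\<integral>x. (\<Sum>n<m. norm (?f n x)) \<partial>\<mu>)"
        by (intro Bochner_Integration.integral_sum[symmetric] integrable_norm intf)
      also have "\<dots> \<le> (\<integral>x. exp (r * \<bar>x\<bar>) \<partial>\<mu>)"
      proof (rule integral_mono)
        show "integrable \<mu> (\<lambda>x. \<Sum>n<m. norm (?f n x))"
          by (intro Bochner_Integration.integrable_sum integrable_norm intf)
        show "integrable \<mu> (\<lambda>x. exp (r * \<bar>x\<bar>))" by (rule int_abs[OF r0])
        fix x
        show "(\<Sum>n<m. norm (?f n x)) \<le> exp (r * \<bar>x\<bar>)"
          unfolding nf sums_unique[OF sm[of x]] by (rule sum_le_suminf) (use sm pos in \<open>auto simp: sums_iff\<close>)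
      qed
      finally show "(\<Sum>n<m. \<integral>x. norm (?f n x) \<partial>\<mu>) \<le> (\<integral>x. exp (r * \<bar>x\<bar>) \<partial>\<mu>)" .
    qed
    have "(\<lambda>n. \<integral>x. ?f n x \<partial>\<mu>) sums (\<integral>x. (\<Sum>n. ?f n x) \<partial>\<mu>)"
    proof (rule sums_integral[OF intf _ summ])
      show "AE x in \<mu>. summable (\<lambda>n. norm (?f n x))"
        unfolding nf using sm by (auto simp: sums_iff)
    qed
    moreover have "(\<Sum>n. ?f n x) = exp (z * complex_of_real x)" for x
      using exp_converges[of "z * complex_of_real x"] by (simp add: sums_iff)
    moreover have "(\<integral>x. ?f n x \<partial>\<mu>) = a n * z ^ n" for n
    proof -
      have "(\<lambda>x. ?f n x) = (\<lambda>x. (complex_of_real x ^ n / fact n) * z ^ n)"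
        by (auto simp: power_mult_distrib scaleR_conv_of_real divide_simps)
      then show ?thesis unfolding a_def by simp
    qed
    ultimately show ?thesis unfolding cmgf_def by simp
  qed
  have "cmgf \<mu> holomorphic_on ball 0 r" for r
    by (rule power_series_holomorphic[of 0 r a]) (use sums_pow in auto)
  then have "cmgf \<mu> field_differentiable at z" for z
    using holomorphic_on_imp_differentiable_at[of "cmgf \<mu>" "ball 0 (norm z + 1)" z] by auto
  then show ?thesis
    by (simp add: holomorphic_on_def)
qed

text \<open>Finiteness for the factor law comes first, from the product formula for nonnegative
  integrals: an infinite factor would make its \<open>n\<close>-th power infinite. Only then does
  Fubini apply to the complex integrand.\<close>

lemma iid_sum_law_cmgf:
  assumes \<nu>: "real_distribution \<nu>" and \<mu>: "iid_sum_law \<nu> n = \<mu>" and m: "exp_moments \<mu>" and n: "n \<ge> 1"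
  shows "exp_moments \<nu>" "cmgf \<mu> z = cmgf \<nu> z ^ n"
proof -
  interpret N: real_distribution \<nu> by fact
  interpret P: product_prob_space "\<lambda>_::nat. \<nu>" "{..<n}" ..
  have ms: "(\<lambda>x. \<Sum>i<n. x i) \<in> borel_measurable (PiM {..<n} (\<lambda>_. \<nu>))"
  proof (rule borel_measurable_sum)
    fix i assume "i \<in> {..<n}"
    then have "(\<lambda>x. x i) \<in> measurable (PiM {..<n} (\<lambda>_. \<nu>)) \<nu>"
      by (rule measurable_component_singleton)
    then show "(\<lambda>x. x i) \<in> borel_measurable (PiM {..<n} (\<lambda>_. \<nu>))"
      by (simp cong: measurable_cong_sets)
  qed
  have im: "integral\<^sup>N \<mu> (\<lambda>x. ennreal (exp (s * x))) = (integral\<^sup>N \<nu> (\<lambda>x. ennreal (exp (s * x)))) ^ n" for s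
  proof -
    have "integral\<^sup>N \<mu> (\<lambda>x. ennreal (exp (s * x))) = (\<integral>\<^sup>+ x. ennreal (exp (s * (\<Sum>i<n. x i))) \<partial>PiM {..<n} (\<lambda>_. \<nu>))"
      unfolding \<mu>[symmetric] iid_sum_law_def by (rule nn_integral_distr[OF ms]) simp
    also have "\<dots> = (\<integral>\<^sup>+ x. (\<Prod>i<n. ennreal (exp (s * x i))) \<partial>PiM {..<n} (\<lambda>_. \<nu>))"
      by (simp add: sum_distrib_left exp_sum prod_ennreal)
    also have "\<dots> = (\<Prod>i<n. integral\<^sup>N \<nu> (\<lambda>x. ennreal (exp (s * x))))"
      by (rule P.product_nn_integral_prod) auto
    finally show ?thesis by simp
  qed
  have M: "sets \<mu> = sets borel" using \<mu> by (auto simp: iid_sum_law_def)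
  show expn: "exp_moments \<nu>"
    unfolding exp_moments_def
  proof
    fix s :: real
    have "integrable \<mu> (\<lambda>x. exp (s * x))" using m by (simp add: exp_moments_def)
    then have "integral\<^sup>N \<mu> (\<lambda>x. ennreal (exp (s * x))) < \<infinity>"
      by (simp add: integrable_iff_bounded)
    then have "(integral\<^sup>N \<nu> (\<lambda>x. ennreal (exp (s * x)))) < \<infinity>"
      using im[of s] n by (auto simp: power_less_top_ennreal)
    then show "integrable \<nu> (\<lambda>x. exp (s * x))"
      by (simp add: integrable_iff_bounded)
  qed
  have "cmgf \<mu> z = (\<integral>x. exp (z * of_real (\<Sum>i<n. x i)) \<partial>PiM {..<n} (\<lambda>_. \<nu>))"
    unfolding cmgf_def \<mu>[symmetric] iid_sum_law_def by (rule integral_distr[OF ms]) simp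
  also have "\<dots> = (\<integral>x. (\<Prod>i<n. exp (z * of_real (x i))) \<partial>PiM {..<n} (\<lambda>_. \<nu>))"
    by (simp add: sum_distrib_left exp_sum)
  also have "\<dots> = (\<Prod>i<n. cmgf \<nu> z)"
    unfolding cmgf_def by (rule P.product_integral_prod) (use integrable_cexp[OF \<nu> expn] in auto)
  finally show "cmgf \<mu> z = cmgf \<nu> z ^ n" by simp
qed

text \<open>If a function has an entire root of order \<open>Suc k\<close>, that root vanishes
  wherever the function does, so every zero has order at least \<open>Suc k\<close>. Taking
  \<open>k\<close> to be the order of the supposed zero is contradictory.\<close>

lemma infinitely_divisible_cmgf_nonzero:
  assumes \<mu>: "real_distribution \<mu>" and m: "exp_moments \<mu>" and i: "infinitely_divisible \<mu>"
  shows "cmgf \<mu> z \<noteq> 0"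
proof
  assume z0: "cmgf \<mu> z = 0"
  interpret real_distribution \<mu> by fact
  have one: "cmgf \<mu> 0 = 1" by (simp add: cmgf_def prob_space[simplified])
  have hol: "cmgf \<mu> holomorphic_on UNIV" by (rule cmgf_holomorphic[OF \<mu> m])
  have "\<not> (\<forall>w\<in>UNIV. cmgf \<mu> w = cmgf \<mu> z)" using z0 one by (metis UNIV_I zero_neq_one)
  then have nc: "\<not> cmgf \<mu> constant_on UNIV" by (metis UNIV_I constant_on_def)
  obtain g r k where k: "0 < k" "0 < r" and g: "g holomorphic_on ball z r"
    and eq: "\<And>w. w \<in> ball z r \<Longrightarrow> cmgf \<mu> w = (w - z) ^ k * g w"
    and gnz: "\<And>w. w \<in> ball z r \<Longrightarrow> g w \<noteq> 0"
    by (rule holomorphic_factor_zero_nonconstant[OF hol open_UNIV connected_UNIV UNIV_I z0 nc]) (rule that)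
  obtain \<nu> where \<nu>: "real_distribution \<nu>" "iid_sum_law \<nu> (Suc k) = \<mu>"
    using i[unfolded infinitely_divisible_def] by (metis le_add1 plus_1_eq_Suc)
  note P = iid_sum_law_cmgf[OF \<nu> m]
  have expn: "exp_moments \<nu>" using P(1) by simp
  have pw: "cmgf \<mu> w = cmgf \<nu> w ^ Suc k" for w using P(2) by simp
  have hn: "cmgf \<nu> holomorphic_on UNIV" by (rule cmgf_holomorphic[OF \<nu>(1) expn])
  have nz: "cmgf \<nu> z = 0" using pw[of z] z0 by auto
  obtain D where "(cmgf \<nu> has_field_derivative D) (at z)"
    using hn unfolding holomorphic_on_def field_differentiable_def by blast
  then have q: "((\<lambda>w. (cmgf \<nu> w - cmgf \<nu> z) / (w - z)) \<longlongrightarrow> D) (at z)"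
    by (simp add: has_field_derivative_iff)
  \<comment> \<open>Of the \<open>Suc k\<close> factors, \<open>k\<close> absorb the division by
    \<open>(w - z) ^ k\<close> and become difference quotients; the spare one tends to
    \<open>cmgf \<nu> z = 0\<close>, which forces \<open>g z = 0\<close>.\<close>
  have "((\<lambda>w. ((cmgf \<nu> w - cmgf \<nu> z) / (w - z)) ^ k * cmgf \<nu> w) \<longlongrightarrow> D ^ k * cmgf \<nu> z) (at z)"
    by (intro tendsto_intros q) (use holomorphic_on_imp_continuous_on[OF hn] in \<open>simp add: continuous_on_eq_continuous_at isCont_def\<close>)
  moreover have "eventually (\<lambda>w. ((cmgf \<nu> w - cmgf \<nu> z) / (w - z)) ^ k * cmgf \<nu> w = g w) (at z)"
    unfolding eventually_at
  proof (intro exI[of _ r] conjI ballI impI)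
    fix w assume w: "w \<noteq> z \<and> dist w z < r"
    then have "cmgf \<nu> w ^ Suc k = (w - z) ^ k * g w"
      using eq[of w] pw[of w] by (simp add: dist_commute)
    then show "((cmgf \<nu> w - cmgf \<nu> z) / (w - z)) ^ k * cmgf \<nu> w = g w"
      using w nz by (simp add: power_divide field_simps)
  qed (use k in auto)
  ultimately have "(g \<longlongrightarrow> D ^ k * cmgf \<nu> z) (at z)"
    using tendsto_cong by fast
  moreover have "(g \<longlongrightarrow> g z) (at z)"
  proof -
    have "continuous_on (ball z r) g" by (rule holomorphic_on_imp_continuous_on[OF g])
    then have "isCont g z" using k by (simp add: continuous_on_eq_continuous_at)
    then show ?thesis by (simp add: isCont_def)
  qed
  ultimately have "g z = D ^ k * cmgf \<nu> z"
    by (metis LIM_unique)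
  then show False using nz gnz[of z] k by simp
qed

text \<open>The Moebius map u / (2 M - u) sends the half-plane Re u < M into the unit disc and fixes
  0. The Schwarz lemma at radius 1/2 gives |f| \<le> |2 M - f| / 2, which can be solved for
  |f|.\<close>

lemma Borel_Caratheodory_half:
  fixes f :: "complex \<Rightarrow> complex"
  assumes hol: "f holomorphic_on UNIV" and f0: "f 0 = 0" and R: "R > 0" and M: "M > 0"
    and bd: "\<And>z. norm z \<le> R \<Longrightarrow> Re (f z) < M" and z: "norm z \<le> R / 2"
  shows "norm (f z) \<le> 2 * M"
proof -
  define g where "g w = f (of_real R * w) / (of_real (2 * M) - f (of_real R * w))" for w
  have inR: "norm (of_real R * w) \<le> R" if "norm w < 1" for w :: complex
    using that R by (simp add: norm_mult)
  have lt: "norm (f w) < norm (of_real (2 * M) - f w)" if "norm w \<le> R" for w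
  proof -
    have "(norm (f w))\<^sup>2 < (norm (of_real (2 * M) - f w))\<^sup>2"
      using bd[OF that] M unfolding cmod_power2 by (simp add: power2_eq_square algebra_simps)
    then show ?thesis by (rule power2_less_imp_less) simp
  qed
  have nz: "of_real (2 * M) - f w \<noteq> 0" if "norm w \<le> R" for w
    using lt[OF that] by auto
  have hg: "g holomorphic_on ball 0 1"
    unfolding g_def
    by (intro holomorphic_intros holomorphic_on_compose_gen[OF _ hol, unfolded o_def])
       (use nz inR in auto)
  have "norm (g w) < 1" if "norm w < 1" for w
    using lt[OF inR[OF that]] nz[OF inR[OF that]]
    by (simp add: g_def norm_divide divide_less_eq)
  moreover have "g 0 = 0" by (simp add: g_def f0)
  moreover define w where "w = z / of_real R"
  have w: "norm w \<le> 1/2" using z R by (simp add: w_def norm_divide field_simps)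
  ultimately have "norm (g w) \<le> norm w"
    using Schwarz_Lemma(1)[OF hg] by auto
  then have "norm (g w) \<le> 1/2" using w by simp
  moreover have Rw: "of_real R * w = z" using R by (simp add: w_def)
  have zR: "norm z \<le> R" using z R by simp
  ultimately have "norm (f z) \<le> 1/2 * norm (of_real (2 * M) - f z)"
    using nz[OF zR] by (simp add: g_def Rw norm_divide divide_le_eq)
  also have "\<dots> \<le> 1/2 * (2 * M + norm (f z))"
    using norm_triangle_ineq4[of "of_real (2 * M)" "f z"] M by simp
  finally show ?thesis by simp
qed

lemma infinitely_divisible_mgf_quadratic:
  assumes \<mu>: "real_distribution \<mu>" and m: "exp_moments \<mu>" and i: "infinitely_divisible \<mu>"
    and C: "\<And>s. (\<integral>x. exp (s * x) \<partial>\<mu>) \<le> exp (C * (1 + \<bar>s\<bar>) ^ 3)"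
  shows "\<exists>A. \<forall>s\<ge>0. (\<integral>x. exp (s * x) \<partial>\<mu>) \<le> exp (A * (1 + s\<^sup>2))"
proof -
  interpret real_distribution \<mu> by fact
  have hol: "cmgf \<mu> holomorphic_on UNIV" by (rule cmgf_holomorphic[OF \<mu> m])
  have one: "cmgf \<mu> 0 = 1" by (simp add: cmgf_def prob_space[simplified])
  obtain \<psi>0 where h0: "\<psi>0 holomorphic_on UNIV" and e0: "\<And>z. cmgf \<mu> z = exp (\<psi>0 z)"
    using contractible_imp_holomorphic_log[OF hol _ infinitely_divisible_cmgf_nonzero[OF \<mu> m i]]
    by (metis UNIV_I contractible_UNIV)
  \<comment> \<open>Subtracting the value at 0, where the transform equals 1, normalises the
    logarithm as Borel-Caratheodory requires.\<close>
  define \<psi> where "\<psi> z = \<psi>0 z - \<psi>0 0" for z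
  have h: "\<psi> holomorphic_on UNIV" unfolding \<psi>_def by (intro holomorphic_intros h0)
  have e: "cmgf \<mu> z = exp (\<psi> z)" for z
    using e0[of z] e0[of 0] one by (simp add: \<psi>_def exp_diff)
  have [simp]: "\<psi> 0 = 0" by (simp add: \<psi>_def)
  have ab: "exp (Re (\<psi> z)) \<le> (\<integral>x. exp (Re z * x) \<partial>\<mu>)" for z
    using norm_cmgf_le[OF \<mu> m, of z] by (simp add: e)
  have re: "exp (Re (\<psi> (of_real s))) = (\<integral>x. exp (s * x) \<partial>\<mu>)" for s
  proof -
    have "norm (cmgf \<mu> (of_real s)) = \<bar>\<integral>x. exp (s * x) \<partial>\<mu>\<bar>" by (simp add: cmgf_of_real)
    also have "\<dots> = (\<integral>x. exp (s * x) \<partial>\<mu>)" by simp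
    finally show ?thesis by (simp add: e)
  qed
  have ridge: "Re (\<psi> z) \<le> Re (\<psi> (of_real (Re z)))" for z
    using ab[of z] re[of "Re z"] by (metis exp_le_cancel_iff)
  have growth: "Re (\<psi> z) < (\<bar>C\<bar> + 1) * (1 + norm z) ^ 3" for z
  proof -
    have "Re (\<psi> z) \<le> C * (1 + \<bar>Re z\<bar>) ^ 3"
      using ab[of z] C[of "Re z"] by (metis exp_le_cancel_iff order_trans)
    also have "\<dots> \<le> \<bar>C\<bar> * (1 + norm z) ^ 3"
      by (intro mult_mono power_mono) (auto simp: abs_Re_le_cmod)
    also have "\<dots> < (\<bar>C\<bar> + 1) * (1 + norm z) ^ 3"
      by (intro mult_strict_right_mono zero_less_power) (auto intro: add_pos_nonneg)
    finally show ?thesis .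
  qed
  have bd: "norm (\<psi> z) \<le> (54 * (\<bar>C\<bar> + 1)) * norm z ^ 3" if z: "1 \<le> norm z" for z
  proof -
    \<comment> \<open>The disc of radius 2 |z| is used. For |z| \<ge> 1 one has 1 + 2 |z| \<le> 3
      |z|, so the factor becomes 2 * 27 = 54.\<close>
    have "norm (\<psi> z) \<le> 2 * ((\<bar>C\<bar> + 1) * (1 + 2 * norm z) ^ 3)"
    proof (rule Borel_Caratheodory_half[OF h, of "2 * norm z"])
      fix w :: complex assume w: "norm w \<le> 2 * norm z"
      have "Re (\<psi> w) < (\<bar>C\<bar> + 1) * (1 + norm w) ^ 3" by (rule growth)
      also have "\<dots> \<le> (\<bar>C\<bar> + 1) * (1 + 2 * norm z) ^ 3"
        by (intro mult_left_mono power_mono) (use w in auto)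
      finally show "Re (\<psi> w) < (\<bar>C\<bar> + 1) * (1 + 2 * norm z) ^ 3" .
    next
      show "0 < (\<bar>C\<bar> + 1) * (1 + 2 * norm z) ^ 3"
        by (intro mult_pos_pos zero_less_power) (auto intro: add_pos_nonneg)
    qed (use z in auto)
    also have "\<dots> \<le> 2 * ((\<bar>C\<bar> + 1) * (3 * norm z) ^ 3)"
      by (intro mult_left_mono power_mono) (use z in auto)
    finally show ?thesis by (simp add: power_mult_distrib algebra_simps)
  qed
  define a where "a k = (deriv ^^ k) \<psi> 0 / fact k" for k
  have poly: "\<psi> z = (\<Sum>k\<le>3. a k * z ^ k)" for z
    unfolding a_def by (rule Liouville_polynomial[OF h bd])
  have a0: "a 0 = 0" using poly[of 0] by (simp add: numeral_3_eq_3)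
  have p: "\<psi> z = a 1 * z + a 2 * z ^ 2 + a 3 * z ^ 3" for z
    using poly[of z] a0 by (simp add: numeral_3_eq_3 numeral_2_eq_2)
  \<comment> \<open>The ridge inequality is added at the two conjugate points s + i and s - i. The
    imaginary parts of the coefficients cancel, and (s + i)^3 + (s - i)^3 = 2 s^3 - 6 s leaves a
    term linear in \<open>s\<close>.\<close>
  have key: "3 * s * Re (a 3) + Re (a 2) \<ge> 0" for s
  proof -
    have "Re (\<psi> (Complex s 1)) + Re (\<psi> (Complex s (-1))) \<le> 2 * Re (\<psi> (of_real s))"
      using ridge[of "Complex s 1"] ridge[of "Complex s (-1)"] by simp
    then show ?thesis
      unfolding p by (simp add: power2_eq_square power3_eq_cube algebra_simps)
  qed
  \<comment> \<open>A positive coefficient is refuted by a sufficiently negative \<open>s\<close>.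
    For \<open>s \<ge> 0\<close> the nonpositive cubic term can then be dropped.\<close>
  have a3: "Re (a 3) \<le> 0"
  proof (rule ccontr)
    assume "\<not> Re (a 3) \<le> 0"
    then have pos: "Re (a 3) > 0" by simp
    have "3 * (- (\<bar>Re (a 2)\<bar> + 1) / (3 * Re (a 3))) * Re (a 3) = - (\<bar>Re (a 2)\<bar> + 1)"
      using pos by simp
    then have "3 * (- (\<bar>Re (a 2)\<bar> + 1) / (3 * Re (a 3))) * Re (a 3) + Re (a 2) < 0"
      by linarith
    then show False using key[of "- (\<bar>Re (a 2)\<bar> + 1) / (3 * Re (a 3))"] by linarith
  qed
  define A where "A = \<bar>Re (a 1)\<bar> + \<bar>Re (a 2)\<bar>"
  show ?thesis
  proof (intro exI[of _ A] allI impI)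
    fix s :: real assume s: "s \<ge> 0"
    have "Re (\<psi> (of_real s)) = Re (a 1) * s + Re (a 2) * s\<^sup>2 + Re (a 3) * s ^ 3"
      unfolding p by (simp flip: of_real_power)
    also have "\<dots> \<le> \<bar>Re (a 1)\<bar> * (1 + s\<^sup>2) + \<bar>Re (a 2)\<bar> * (1 + s\<^sup>2) + 0"
    proof (intro add_mono)
      have "s \<le> 1 + s\<^sup>2" using zero_le_power2[of "s - 1"] s by (simp add: power2_eq_square algebra_simps)
      then show "Re (a 1) * s \<le> \<bar>Re (a 1)\<bar> * (1 + s\<^sup>2)" using s by (intro mult_mono) auto
      show "Re (a 2) * s\<^sup>2 \<le> \<bar>Re (a 2)\<bar> * (1 + s\<^sup>2)" by (intro mult_mono) auto
      show "Re (a 3) * s ^ 3 \<le> 0" using a3 s by (simp add: mult_nonpos_nonneg)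
    qed
    finally show "(\<integral>x. exp (s * x) \<partial>\<mu>) \<le> exp (A * (1 + s\<^sup>2))"
      unfolding re[symmetric] by (simp add: A_def algebra_simps)
  qed
qed

section \<open>Largest eigenvalue and pivots\<close>

definition quad_form :: "nat \<Rightarrow> (nat \<Rightarrow> nat \<Rightarrow> real) \<Rightarrow> (nat \<Rightarrow> real) \<Rightarrow> real" where
  "quad_form N A v = (\<Sum>i=1..N. \<Sum>j=1..N. A i j * v i * v j)"

definition sqnorm :: "nat \<Rightarrow> (nat \<Rightarrow> real) \<Rightarrow> real" where
  "sqnorm N v = (\<Sum>i=1..N. (v i)\<^sup>2)"

lemma sqnorm_nonneg [simp]: "0 \<le> sqnorm N v"
  by (simp add: sqnorm_def sum_nonneg)

lemma sqnorm_pos: "i \<in> {1..N} \<Longrightarrow> v i \<noteq> 0 \<Longrightarrow> 0 < sqnorm N v"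
  unfolding sqnorm_def by (rule sum_pos2[of _ i]) auto

lemma quad_form_scale: "quad_form N A (\<lambda>i. c * v i) = c\<^sup>2 * quad_form N A v"
  by (simp add: quad_form_def sum_distrib_left power2_eq_square mult_ac)

lemma sqnorm_scale: "sqnorm N (\<lambda>i. c * v i) = c\<^sup>2 * sqnorm N v"
  by (simp add: sqnorm_def sum_distrib_left power_mult_distrib)

lemma quad_form_eigenvector:
  assumes "\<And>i. i \<in> {1..N} \<Longrightarrow> (\<Sum>j=1..N. A i j * v j) = l * v i"
  shows "quad_form N A v = l * sqnorm N v"
proof -
  have "quad_form N A v = (\<Sum>i=1..N. v i * (\<Sum>j=1..N. A i j * v j))"
    by (simp add: quad_form_def sum_distrib_left mult_ac)
  also have "\<dots> = (\<Sum>i=1..N. v i * (l * v i))" using assms by (intro sum.cong) auto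
  finally show ?thesis by (simp add: sqnorm_def sum_distrib_left power2_eq_square mult_ac)
qed

lemma quad_form_max_attained:
  assumes N: "N \<ge> 1"
  shows "\<exists>v. sqnorm N v = 1 \<and> (\<forall>w. quad_form N A w \<le> quad_form N A v * sqnorm N w)"
proof -
  \<comment> \<open>Vectors are functions on all naturals. Pinning the coordinates outside
    \<open>{1..N}\<close> to 0 turns the cube into a product of compact sets, so Tychonoff's theorem
    makes the unit sphere inside it compact.\<close>
  define K where "K = (\<Pi>\<^sub>E i\<in>(UNIV::nat set). if i \<in> {1..N} then {-1..1::real} else {0})"
  define S where "S = K \<inter> {v. sqnorm N v = 1}"
  have "compactin (product_topology (\<lambda>_. euclidean) UNIV) K"
    unfolding K_def compactin_PiE by (auto simp: compactin_euclidean_iff)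
  then have cK: "compact K" by (simp add: euclidean_product_topology compactin_euclidean_iff)
  have cn: "continuous_on UNIV (sqnorm N)"
    unfolding sqnorm_def by (intro continuous_intros continuous_on_product_coordinates)
  have cq: "continuous_on UNIV (quad_form N A)"
    unfolding quad_form_def by (intro continuous_intros continuous_on_product_coordinates)
  have "closed {v. sqnorm N v = 1}"
    by (intro closed_Collect_eq cn continuous_intros)
  then have cS: "compact S" unfolding S_def by (rule compact_Int_closed[OF cK])
  have "(\<lambda>i. if i = 1 then 1 else 0) \<in> S"
  proof -
    have "sqnorm N (\<lambda>i. if i = 1 then 1 else 0) = (\<Sum>i=1..N. if i = 1 then 1 else 0)"
      unfolding sqnorm_def by (rule sum.cong) auto
    then show ?thesis using N by (auto simp: S_def K_def)
  qed
  then obtain v where v: "v \<in> S" and mx: "\<And>w. w \<in> S \<Longrightarrow> quad_form N A w \<le> quad_form N A v"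
    using continuous_attains_sup[OF cS _ continuous_on_subset[OF cq]] by blast
  have "quad_form N A w \<le> quad_form N A v * sqnorm N w" for w
  proof (cases "\<exists>i\<in>{1..N}. w i \<noteq> 0")
    case False
    then show ?thesis by (simp add: quad_form_def sqnorm_def)
  next
    case True
    then have pos: "sqnorm N w > 0" using sqnorm_pos by blast
    define c where "c = 1 / sqrt (sqnorm N w)"
    define u where "u i = (if i \<in> {1..N} then c * w i else 0)" for i
    have c2: "c\<^sup>2 = 1 / sqnorm N w" using pos by (simp add: c_def power_divide)
    have "sqnorm N u = sqnorm N (\<lambda>i. c * w i)" by (simp add: sqnorm_def u_def)
    then have su: "sqnorm N u = 1" using pos by (simp add: sqnorm_scale c2)
    have "\<bar>u i\<bar> \<le> 1" if "i \<in> {1..N}" for i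
    proof -
      have "(u i)\<^sup>2 \<le> sqnorm N u" unfolding sqnorm_def
        by (rule member_le_sum) (use that in auto)
      then show ?thesis using su by (simp add: abs_square_le_1)
    qed
    then have "u \<in> S" using su by (auto simp: S_def K_def u_def abs_le_iff)
    then have "quad_form N A u \<le> quad_form N A v" by (rule mx)
    moreover have "quad_form N A u = quad_form N A (\<lambda>i. c * w i)"
      by (simp add: quad_form_def u_def)
    ultimately show ?thesis using pos by (simp add: quad_form_scale c2 field_simps)
  qed
  then show ?thesis using v by (auto simp: S_def)
qed

text \<open>First-order optimality: moving the maximiser by \<open>t\<close> along a unit vector
  must not raise the form above \<open>l\<close> times the squared norm, so the part linear in
  \<open>t\<close> vanishes, which is one coordinate of the eigenvalue equation.\<close>

lemma rayleigh_max_eigenvalue: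
  assumes N: "N \<ge> 1" and sym: "\<And>i j. A i j = A j i"
  shows "\<exists>l\<in>eigenvalues N A. \<forall>w. quad_form N A w \<le> l * sqnorm N w"
proof -
  obtain v where v: "sqnorm N v = 1" and mx: "\<And>w. quad_form N A w \<le> quad_form N A v * sqnorm N w"
    using quad_form_max_attained[OF N] by blast
  define l where "l = quad_form N A v"
  have "(\<Sum>j=1..N. A k j * v j) = l * v k" if k: "k \<in> {1..N}" for k
  proof -
    define a where "a = (\<Sum>j=1..N. A k j * v j)"
    have dir: "2 * t * (a - l * v k) + t\<^sup>2 * (A k k - l) \<le> 0" for t
    proof -
      define e where "e i = (if i = k then 1 else 0::real)" for i
      have ek: "(\<Sum>i=1..N. f i * e i) = f k" for f :: "nat \<Rightarrow> real"
      proof -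
        have "(\<Sum>i=1..N. f i * e i) = (\<Sum>i=1..N. if i = k then f i else 0)"
          by (rule sum.cong) (auto simp: e_def)
        then show ?thesis using k by simp
      qed
      have "quad_form N A (\<lambda>i. v i + t * e i) = (\<Sum>i=1..N. \<Sum>j=1..N. A i j * v i * v j)
          + t * (\<Sum>i=1..N. (\<Sum>j=1..N. A i j * v j) * e i) + t * (\<Sum>i=1..N. v i * (\<Sum>j=1..N. A i j * e j))
          + t\<^sup>2 * (\<Sum>i=1..N. (\<Sum>j=1..N. A i j * e j) * e i)"
      proof -
        have "A i j * (v i + t * e i) * (v j + t * e j) = A i j * v i * v j + t * (A i j * v j * e i)
            + t * (v i * (A i j * e j)) + t\<^sup>2 * (A i j * e j * e i)" for i j
          by (simp add: algebra_simps power2_eq_square)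
        then show ?thesis unfolding quad_form_def
          by (simp only: sum.distrib sum_distrib_left sum_distrib_right)
      qed
      also have "\<dots> = l + t * a + t * a + t\<^sup>2 * A k k"
      proof -
        have "(\<Sum>i=1..N. v i * A i k) = a"
          unfolding a_def by (intro sum.cong refl) (metis mult.commute sym)
        then show ?thesis unfolding ek by (simp only: l_def quad_form_def a_def)
      qed
      finally have 1: "quad_form N A (\<lambda>i. v i + t * e i) = l + 2 * t * a + t\<^sup>2 * A k k" by simp
      have "sqnorm N (\<lambda>i. v i + t * e i) = (\<Sum>i=1..N. (v i)\<^sup>2) + 2 * t * (\<Sum>i=1..N. v i * e i) + t\<^sup>2 * (\<Sum>i=1..N. e i * e i)"
        unfolding sqnorm_def
        by (simp add: algebra_simps sum.distrib sum_distrib_left power2_eq_square)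
      also have "\<dots> = 1 + 2 * t * v k + t\<^sup>2"
        unfolding ek using v by (simp add: sqnorm_def e_def)
      finally show ?thesis using mx[of "\<lambda>i. v i + t * e i"] unfolding 1 l_def[symmetric]
        by (simp add: algebra_simps)
    qed
    define b where "b = a - l * v k"
    \<comment> \<open>The constant dominates the second-order coefficient. With
      \<open>t = b / c\<close> the linear part contributes \<open>2 * b\<^sup>2 / c\<close> and the
      quadratic part costs at most \<open>b\<^sup>2 / c\<close>, so
      \<open>b\<^sup>2 / c \<le> 0\<close>.\<close>
    define c where "c = \<bar>A k k - l\<bar> + 1"
    have c: "c > 0" by (simp add: c_def)
    have "2 * (b / c) * b + (b / c)\<^sup>2 * (A k k - l) \<le> 0" using dir[of "b / c"] by (simp add: b_def)
    moreover have "(b / c)\<^sup>2 * (A k k - l) \<ge> - ((b / c)\<^sup>2 * c)"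
    proof -
      have "(b / c)\<^sup>2 * (-c) \<le> (b / c)\<^sup>2 * (A k k - l)"
        by (intro mult_left_mono) (auto simp: c_def)
      then show ?thesis by simp
    qed
    moreover have "(b / c)\<^sup>2 * c = b\<^sup>2 / c" "2 * (b / c) * b = 2 * (b\<^sup>2 / c)"
      using c by (simp_all add: power2_eq_square)
    ultimately have "b\<^sup>2 / c \<le> 0" by linarith
    then have "b = 0" using c by (simp add: divide_le_0_iff power2_less_eq_zero_iff)
    then show ?thesis by (simp add: a_def b_def)
  qed
  moreover have "\<exists>i\<in>{1..N}. v i \<noteq> 0"
    using v by (force simp: sqnorm_def intro: ccontr)
  ultimately have "l \<in> eigenvalues N A" by (auto simp: eigenvalues_def)
  then show ?thesis using mx unfolding l_def by blast
qed

text \<open>Summing Bessel's inequality over the unit vectors shows that an orthonormal system, here one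
  of eigenvectors, has at most \<open>N\<close> elements.\<close>
lemma finite_eigenvalues:
  assumes sym: "\<And>i j. A i j = A j i"
  shows "finite (eigenvalues N A)"
proof -
  have "card F \<le> N" if F: "F \<subseteq> eigenvalues N A" "finite F" for F
  proof -
    have "\<exists>v. sqnorm N v = 1 \<and> (\<forall>i\<in>{1..N}. (\<Sum>j=1..N. A i j * v j) = l * v i)" if lF: "l \<in> F" for l
    proof -
      have "l \<in> eigenvalues N A" using lF F by blast
      then obtain v where v: "\<exists>i\<in>{1..N}. v i \<noteq> 0" "\<forall>i\<in>{1..N}. (\<Sum>j=1..N. A i j * v j) = l * v i"
        unfolding eigenvalues_def by blast
      then have pos: "sqnorm N v > 0" using sqnorm_pos by blast
      define c where "c = 1 / sqrt (sqnorm N v)"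
      have "c\<^sup>2 = 1 / sqnorm N v" using pos by (simp add: c_def power_divide)
      then have "sqnorm N (\<lambda>i. c * v i) = 1" using pos by (simp add: sqnorm_scale)
      moreover have "(\<Sum>j=1..N. A i j * (c * v j)) = l * (c * v i)" if "i \<in> {1..N}" for i
      proof -
        have "(\<Sum>j=1..N. A i j * (c * v j)) = c * (\<Sum>j=1..N. A i j * v j)"
          by (simp add: sum_distrib_left mult_ac)
        then show ?thesis using v(2) that by simp
      qed
      ultimately show ?thesis by blast
    qed
    then obtain u where u1: "\<And>l. l \<in> F \<Longrightarrow> sqnorm N (u l) = 1"
      and ue: "\<And>l i. l \<in> F \<Longrightarrow> i \<in> {1..N} \<Longrightarrow> (\<Sum>j=1..N. A i j * u l j) = l * u l i"
      by metis
    have orth: "(\<Sum>i=1..N. u l i * u m i) = 0" if "l \<in> F" "m \<in> F" "l \<noteq> m" for l m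
    proof -
      have "l * (\<Sum>i=1..N. u l i * u m i) = (\<Sum>i=1..N. l * u l i * u m i)"
        by (simp add: sum_distrib_left mult.assoc)
      also have "\<dots> = (\<Sum>i=1..N. (\<Sum>j=1..N. A i j * u l j) * u m i)"
        by (intro sum.cong refl) (simp only: ue[OF that(1)])
      also have "\<dots> = (\<Sum>i=1..N. \<Sum>j=1..N. A i j * u l j * u m i)"
        by (simp add: sum_distrib_right)
      also have "\<dots> = (\<Sum>j=1..N. \<Sum>i=1..N. A i j * u l j * u m i)" by (rule sum.swap)
      also have "\<dots> = (\<Sum>j=1..N. u l j * (\<Sum>i=1..N. A j i * u m i))"
        unfolding sum_distrib_left by (intro sum.cong refl) (metis mult.commute mult.left_commute sym)
      also have "\<dots> = (\<Sum>j=1..N. u l j * (m * u m j))"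
        by (intro sum.cong refl) (simp only: ue[OF that(2)])
      also have "\<dots> = m * (\<Sum>i=1..N. u l i * u m i)"
        by (simp add: sum_distrib_left mult_ac)
      finally show ?thesis using that by simp
    qed
    have bessel: "(\<Sum>l\<in>F. (u l k)\<^sup>2) \<le> 1" if k: "k \<in> {1..N}" for k
    proof -
      define e where "e i = (if i = k then 1 else 0::real)" for i
      have ek: "(\<Sum>i=1..N. e i * f i) = f k" for f :: "nat \<Rightarrow> real"
      proof -
        have "(\<Sum>i=1..N. e i * f i) = (\<Sum>i=1..N. if i = k then f i else 0)"
          by (rule sum.cong) (auto simp: e_def)
        then show ?thesis using k by simp
      qed
      \<comment> \<open>This is the orthogonal projection of the unit vector \<open>e\<close> onto
        the span of the eigenvectors; its squared norm equals its inner product with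
        \<open>e\<close>, which is \<open>p k\<close>.\<close>
      define p where "p i = (\<Sum>l\<in>F. u l k * u l i)" for i
      have pp: "(\<Sum>i=1..N. p i * p i) = p k"
      proof -
        have "(\<Sum>i=1..N. p i * p i) = (\<Sum>i=1..N. \<Sum>l\<in>F. \<Sum>m\<in>F. u l k * u m k * (u l i * u m i))"
          unfolding p_def sum_product by (intro sum.cong refl) (simp only: mult_ac)
        also have "\<dots> = (\<Sum>l\<in>F. \<Sum>i=1..N. \<Sum>m\<in>F. u l k * u m k * (u l i * u m i))" by (rule sum.swap)
        also have "\<dots> = (\<Sum>l\<in>F. \<Sum>m\<in>F. u l k * u m k * (\<Sum>i=1..N. u l i * u m i))"
          by (intro sum.cong refl, subst sum.swap) (simp add: sum_distrib_left)
        also have "\<dots> = (\<Sum>l\<in>F. \<Sum>m\<in>F. if m = l then u l k * u l k else 0)"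
        proof (intro sum.cong refl)
          fix l m assume "l \<in> F" "m \<in> F"
          then show "u l k * u m k * (\<Sum>i=1..N. u l i * u m i) = (if m = l then u l k * u l k else 0)"
            using orth[of l m] u1[of l] by (auto simp: sqnorm_def power2_eq_square)
        qed
        also have "\<dots> = p k" using F by (simp add: p_def)
        finally show ?thesis .
      qed
      have "0 \<le> (\<Sum>i=1..N. (e i - p i)\<^sup>2)" by (simp add: sum_nonneg)
      also have "\<dots> = (\<Sum>i=1..N. e i * e i) - 2 * (\<Sum>i=1..N. e i * p i) + (\<Sum>i=1..N. p i * p i)"
        by (simp add: algebra_simps sum.distrib sum_distrib_left power2_eq_square sum_subtractf)
      also have "\<dots> = 1 - p k" unfolding ek pp by (simp add: e_def)
      finally show ?thesis by (simp add: p_def power2_eq_square)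
    qed
    have "real (card F) = (\<Sum>l\<in>F. sqnorm N (u l))" using u1 by simp
    also have "\<dots> = (\<Sum>k=1..N. \<Sum>l\<in>F. (u l k)\<^sup>2)" unfolding sqnorm_def by (rule sum.swap)
    also have "\<dots> \<le> (\<Sum>k=1..N. 1)" by (rule sum_mono) (rule bessel)
    finally show ?thesis by simp
  qed
  then show ?thesis using finite_if_finite_subsets_card_bdd by blast
qed

text \<open>\<open>Max\<close> has its intended meaning only on a finite nonempty set. Finiteness is
  Bessel's inequality; nonemptiness is the attained maximum of the Rayleigh quotient.\<close>

lemma lambda_max_eigenvalue:
  assumes "N \<ge> 1" "\<And>i j. A i j = A j i"
  shows "lambda_max N A \<in> eigenvalues N A"
  unfolding lambda_max_def
  by (rule Max_in[OF finite_eigenvalues[of A N, OF assms(2)]]) (use rayleigh_max_eigenvalue[of N A, OF assms] in blast)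

lemma quad_form_le_lambda_max:
  assumes "N \<ge> 1" "\<And>i j. A i j = A j i"
  shows "quad_form N A w \<le> lambda_max N A * sqnorm N w"
proof -
  obtain l where l: "l \<in> eigenvalues N A" "quad_form N A w \<le> l * sqnorm N w"
    using rayleigh_max_eigenvalue[of N A, OF assms] by blast
  have "l \<le> lambda_max N A" unfolding lambda_max_def
    by (rule Max_ge[OF finite_eigenvalues[of A N, OF assms(2)] l(1)])
  then show ?thesis using l(2) by (meson mult_right_mono order_trans sqnorm_nonneg)
qed

lemma lambda_max_le_iff:
  assumes "N \<ge> 1" "\<And>i j. A i j = A j i"
  shows "lambda_max N A \<le> a \<longleftrightarrow> (\<forall>v. quad_form N A v \<le> a * sqnorm N v)"
proof
  assume "lambda_max N A \<le> a"
  then show "\<forall>v. quad_form N A v \<le> a * sqnorm N v"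
    using quad_form_le_lambda_max[of N A, OF assms] by (meson mult_right_mono order_trans sqnorm_nonneg)
next
  assume a: "\<forall>v. quad_form N A v \<le> a * sqnorm N v"
  obtain v where v: "\<exists>i\<in>{1..N}. v i \<noteq> 0" "\<forall>i\<in>{1..N}. (\<Sum>j=1..N. A i j * v j) = lambda_max N A * v i"
    using lambda_max_eigenvalue[of N A, OF assms] unfolding eigenvalues_def by blast
  have "lambda_max N A * sqnorm N v \<le> a * sqnorm N v"
    using a quad_form_eigenvector[of N A v] v by metis
  moreover have "sqnorm N v > 0" using v sqnorm_pos by blast
  ultimately show "lambda_max N A \<le> a" by simp
qed

text \<open>By density and continuity, rational vectors suffice. A sublevel set of the largest
  eigenvalue is thus a countable intersection, which is how measurability is obtained.\<close>

lemma lambda_max_le_iff_rational: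
  assumes "N \<ge> 1" "\<And>i j. A i j = A j i"
  shows "lambda_max N A \<le> a \<longleftrightarrow> (\<forall>v\<in>(\<Pi>\<^sub>E i\<in>{1..N}. \<rat>). quad_form N A v \<le> a * sqnorm N v)"
proof
  assume "lambda_max N A \<le> a"
  then show "\<forall>v\<in>(\<Pi>\<^sub>E i\<in>{1..N}. \<rat>). quad_form N A v \<le> a * sqnorm N v"
    using lambda_max_le_iff[of N A a, OF assms] by blast
next
  assume a: "\<forall>v\<in>(\<Pi>\<^sub>E i\<in>{1..N}. \<rat>). quad_form N A v \<le> a * sqnorm N v"
  have "quad_form N A v \<le> a * sqnorm N v" for v
  proof -
    have "\<exists>q. (\<forall>n. q n \<in> \<rat>) \<and> q \<longlonglongrightarrow> x" for x :: real
      using closure_sequential[of x \<rat>] Rats_closure_real by auto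
    then obtain q where q: "\<And>x n. q x n \<in> \<rat>" "\<And>x::real. q x \<longlonglongrightarrow> x" by metis
    define w where "w n = restrict (\<lambda>i. q (v i) n) {1..N}" for n
    have w: "w n \<in> (\<Pi>\<^sub>E i\<in>{1..N}. \<rat>)" for n using q by (auto simp: w_def)
    have wi: "(\<lambda>n. w n i) \<longlonglongrightarrow> v i" if "i \<in> {1..N}" for i
      using that q(2)[of "v i"] by (simp add: w_def)
    have "(\<lambda>n. quad_form N A (w n)) \<longlonglongrightarrow> quad_form N A v"
      unfolding quad_form_def by (intro tendsto_intros wi) auto
    moreover have "(\<lambda>n. a * sqnorm N (w n)) \<longlonglongrightarrow> a * sqnorm N v"
      unfolding sqnorm_def by (intro tendsto_intros wi) auto
    ultimately show ?thesis by (rule LIMSEQ_le) (use a w in blast)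
  qed
  then show "lambda_max N A \<le> a" using lambda_max_le_iff[of N A a, OF assms] by blast
qed

lemma borel_measurable_lambda_max:
  assumes N: "N \<ge> 1" and sym: "\<And>w i j. A w i j = A w j i"
    and meas: "\<And>i j. i \<in> {1..N} \<Longrightarrow> j \<in> {1..N} \<Longrightarrow> (\<lambda>w. A w i j) \<in> borel_measurable M"
  shows "(\<lambda>w. lambda_max N (A w)) \<in> borel_measurable M"
  unfolding borel_measurable_iff_le
proof
  fix a :: real
  have "{w \<in> space M. lambda_max N (A w) \<le> a}
      = {w \<in> space M. \<forall>v\<in>(\<Pi>\<^sub>E i\<in>{1..N}. \<rat>). quad_form N (A w) v \<le> a * sqnorm N v}"
    using lambda_max_le_iff_rational[OF N sym] by auto
  also have "\<dots> \<in> sets M"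
  proof (rule sets.sets_Collect_countable_All')
    show "countable ((\<Pi>\<^sub>E i\<in>{1..N}. \<rat>) :: (nat \<Rightarrow> real) set)"
      by (intro countable_PiE) (auto intro: countable_rat)
    fix v :: "nat \<Rightarrow> real"
    have [measurable]: "(\<lambda>w. quad_form N (A w) v) \<in> borel_measurable M"
      unfolding quad_form_def by (intro borel_measurable_sum borel_measurable_times meas) auto
    show "{w \<in> space M. quad_form N (A w) v \<le> a * sqnorm N v} \<in> sets M" by measurable
  qed
  finally show "{w \<in> space M. lambda_max N (A w) \<le> a} \<in> sets M" .
qed

section \<open>The tridiagonal quadratic form and its pivots\<close>

lemma beta_matrix_sym: "beta_matrix \<beta> g c i j = beta_matrix \<beta> g c j i"
  by (auto simp: beta_matrix_def)

lemma quad_form_beta_matrix: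
  "quad_form N (beta_matrix \<beta> g c) v
    = ((\<Sum>i=1..N. g i * (v i)\<^sup>2) + 2 * (\<Sum>i=1..N-1. c i * v i * v (Suc i))) / sqrt \<beta>"
proof (induction N)
  case 0
  then show ?case by (simp add: quad_form_def)
next
  case (Suc N)
  let ?A = "beta_matrix \<beta> g c"
  have col: "(\<Sum>i=1..N. ?A i (Suc N) * v i) = (if N = 0 then 0 else c N * v N / sqrt \<beta>)"
  proof (cases N)
    case (Suc M)
    have "(\<Sum>i=1..M. ?A i (Suc N) * v i) = 0"
      by (rule sum.neutral) (auto simp: beta_matrix_def Suc)
    then show ?thesis by (simp add: Suc beta_matrix_def)
  qed simp
  have "quad_form (Suc N) ?A v = quad_form N ?A v + 2 * v (Suc N) * (\<Sum>i=1..N. ?A i (Suc N) * v i) + ?A (Suc N) (Suc N) * (v (Suc N))\<^sup>2"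
  proof -
    have row: "(\<Sum>j=1..N. ?A (Suc N) j * v (Suc N) * v j) = v (Suc N) * (\<Sum>i=1..N. ?A i (Suc N) * v i)"
      unfolding sum_distrib_left
      by (intro sum.cong refl) (simp only: beta_matrix_sym[of \<beta> g c "Suc N"] mult_ac)
    have col': "(\<Sum>i=1..N. ?A i (Suc N) * v i * v (Suc N)) = v (Suc N) * (\<Sum>i=1..N. ?A i (Suc N) * v i)"
      unfolding sum_distrib_left by (intro sum.cong refl) (simp only: mult_ac)
    have "quad_form (Suc N) ?A v = quad_form N ?A v + (\<Sum>i=1..N. ?A i (Suc N) * v i * v (Suc N))
        + (\<Sum>j=1..N. ?A (Suc N) j * v (Suc N) * v j) + ?A (Suc N) (Suc N) * (v (Suc N))\<^sup>2"
      unfolding quad_form_def by (simp add: sum.distrib power2_eq_square)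
    then show ?thesis unfolding row col' by simp
  qed
  also have "?A (Suc N) (Suc N) = g (Suc N) / sqrt \<beta>" by (simp add: beta_matrix_def)
  finally show ?case unfolding col Suc
    by (cases N) (simp_all add: add_divide_distrib algebra_simps)
qed

text \<open>The pivots of the LDL factorisation of \<open>a - T\<close>, where \<open>T\<close> is the tridiagonal matrix with
  diagonal \<open>g\<close> and off-diagonal \<open>c\<close>.\<close>
fun pivot :: "real \<Rightarrow> (nat \<Rightarrow> real) \<Rightarrow> (nat \<Rightarrow> real) \<Rightarrow> nat \<Rightarrow> real" where
  "pivot a g c 0 = 0"
| "pivot a g c (Suc 0) = a - g (Suc 0)"
| "pivot a g c (Suc (Suc k)) = a - g (Suc (Suc k)) - (c (Suc k))\<^sup>2 / pivot a g c (Suc k)"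

text \<open>Squares are completed one variable at a time. The induction keeps the leftover multiple
  of the last squared coordinate, since the next square consumes it.\<close>

lemma pivots_pos_imp_quad_form_ge:
  assumes "\<And>j. j \<in> {1..Suc n} \<Longrightarrow> pivot a g c j > 0"
  shows "a * sqnorm (Suc n) v - ((\<Sum>i=1..Suc n. g i * (v i)\<^sup>2) + 2 * (\<Sum>i=1..n. c i * v i * v (Suc i)))
    \<ge> pivot a g c (Suc n) * (v (Suc n))\<^sup>2"
  using assms
proof (induction n)
  case 0
  then show ?case by (simp add: sqnorm_def algebra_simps)
next
  case (Suc n)
  define d where "d = pivot a g c (Suc n)"
  have d: "d > 0" using Suc.prems[of "Suc n"] by (simp add: d_def)
  let ?x = "v (Suc n)" and ?y = "v (Suc (Suc n))" and ?c = "c (Suc n)"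
  have "d * (?x - ?c * ?y / d)\<^sup>2 \<ge> 0" using d by simp
  also have "d * (?x - ?c * ?y / d)\<^sup>2 = d * ?x\<^sup>2 - 2 * (?c * ?x * ?y) + ?c\<^sup>2 / d * ?y\<^sup>2"
    using d by (simp add: power2_eq_square field_simps)
  finally have "d * ?x\<^sup>2 - 2 * (?c * ?x * ?y) + ?c\<^sup>2 / d * ?y\<^sup>2 \<ge> 0" .
  moreover have "a * sqnorm (Suc n) v - ((\<Sum>i=1..Suc n. g i * (v i)\<^sup>2) + 2 * (\<Sum>i=1..n. c i * v i * v (Suc i))) \<ge> d * ?x\<^sup>2"
    unfolding d_def by (rule Suc.IH) (use Suc.prems in auto)
  moreover have "pivot a g c (Suc (Suc n)) * ?y\<^sup>2 = a * ?y\<^sup>2 - g (Suc (Suc n)) * ?y\<^sup>2 - ?c\<^sup>2 / d * ?y\<^sup>2"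
    by (simp add: d_def algebra_simps)
  moreover have "a * sqnorm (Suc (Suc n)) v - ((\<Sum>i=1..Suc (Suc n). g i * (v i)\<^sup>2) + 2 * (\<Sum>i=1..Suc n. c i * v i * v (Suc i)))
      = a * sqnorm (Suc n) v - ((\<Sum>i=1..Suc n. g i * (v i)\<^sup>2) + 2 * (\<Sum>i=1..n. c i * v i * v (Suc i)))
        + a * ?y\<^sup>2 - g (Suc (Suc n)) * ?y\<^sup>2 - 2 * (?c * ?x * ?y)"
    by (simp add: sqnorm_def distrib_left)
  ultimately show ?case by linarith
qed

text \<open>Half of Sylvester's criterion. The pivots belong to the unscaled matrix, hence the
  factor \<open>sqrt \<beta>\<close> in the level.\<close>

lemma pivots_pos_imp_lambda_max_le:
  assumes b: "\<beta> > 0" and N: "N \<ge> 1"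
    and p: "\<And>j. j \<in> {1..N} \<Longrightarrow> pivot (sqrt \<beta> * l) g c j > 0"
  shows "lambda_max N (beta_matrix \<beta> g c) \<le> l"
  unfolding lambda_max_le_iff[OF N beta_matrix_sym]
proof
  fix v
  obtain n where n: "N = Suc n" using N by (cases N) auto
  have "0 \<le> pivot (sqrt \<beta> * l) g c (Suc n) * (v (Suc n))\<^sup>2" using p[of "Suc n"] n by simp
  also have "\<dots> \<le> sqrt \<beta> * l * sqnorm N v - ((\<Sum>i=1..N. g i * (v i)\<^sup>2) + 2 * (\<Sum>i=1..N-1. c i * v i * v (Suc i)))"
    using pivots_pos_imp_quad_form_ge[of n "sqrt \<beta> * l" g c v] p n by simp
  finally show "quad_form N (beta_matrix \<beta> g c) v \<le> l * sqnorm N v"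
    unfolding quad_form_beta_matrix using b by (simp add: divide_le_eq mult_ac)
qed

section \<open>Exponential moments of the Gaussian and chi laws\<close>

lemma sets_gauss2 [measurable_cong, simp]: "sets gauss2 = sets borel"
  by (simp add: gauss2_def)

lemma space_gauss2 [simp]: "space gauss2 = UNIV"
  by (simp add: gauss2_def)

lemma sets_chi_measure [measurable_cong, simp]: "sets (chi_measure t) = sets borel"
  by (simp add: chi_measure_def)

lemma space_chi_measure [simp]: "space (chi_measure t) = UNIV"
  by (simp add: chi_measure_def)

lemma prob_space_gauss2: "prob_space gauss2"
  unfolding gauss2_def by (rule prob_space_normal_density) simp

text \<open>The variance is 2, so no factor 1/2 appears in the exponent. Completing the square moves
  the mean from 0 to \<open>2 * u\<close>.\<close>

lemma nn_integral_gauss2_exp: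
  "(\<integral>\<^sup>+ x. ennreal (exp (u * x)) \<partial>gauss2) = ennreal (exp (u\<^sup>2))"
proof -
  have eq: "normal_density 0 (sqrt 2) x * exp (u * x) = exp (u\<^sup>2) * normal_density (2 * u) (sqrt 2) x" for x
  proof -
    have "- (x\<^sup>2) / 4 + u * x = u\<^sup>2 + - ((x - 2 * u)\<^sup>2) / 4"
      by (simp add: power2_eq_square field_simps)
    then have "exp (- (x\<^sup>2) / 4) * exp (u * x) = exp (u\<^sup>2) * exp (- ((x - 2 * u)\<^sup>2) / 4)"
      by (simp add: exp_add[symmetric])
    then show ?thesis by (simp add: normal_density_def field_simps)
  qed
  have "(\<integral>\<^sup>+ x. ennreal (exp (u * x)) \<partial>gauss2)
      = (\<integral>\<^sup>+ x. ennreal (normal_density 0 (sqrt 2) x) * ennreal (exp (u * x)) \<partial>lborel)"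
    unfolding gauss2_def by (subst nn_integral_density) auto
  also have "\<dots> = (\<integral>\<^sup>+ x. ennreal (exp (u\<^sup>2)) * ennreal (normal_density (2 * u) (sqrt 2) x) \<partial>lborel)"
    by (simp add: ennreal_mult[symmetric] eq)
  also have "\<dots> = ennreal (exp (u\<^sup>2)) * (\<integral>\<^sup>+ x. ennreal (normal_density (2 * u) (sqrt 2) x) \<partial>lborel)"
    by (rule nn_integral_cmult) simp
  also have "(\<integral>\<^sup>+ x. ennreal (normal_density (2 * u) (sqrt 2) x) \<partial>lborel) = 1"
    using prob_space.emeasure_space_1[OF prob_space_normal_density[of "sqrt 2" "2 * u"]]
    by (simp add: emeasure_density)
  finally show ?thesis by simp
qed

text \<open>Euler's Gamma integral under the substitution z = b x^2 / 2.\<close>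

lemma nn_integral_powr_exp_neg_square:
  fixes a b :: real
  assumes a: "a > 0" and b: "b > 0"
  shows "(\<integral>\<^sup>+ x. ennreal (x powr (a - 1) * exp (- b * x\<^sup>2 / 2)) * indicator {0<..} x \<partial>lborel)
    = ennreal (2 powr (a/2 - 1) * Gamma (a/2) * b powr (-a/2))"
proof -
  define f where "f z = z powr (a/2 - 1) / exp z" for z :: real
  define g where "g x = b * x\<^sup>2 / 2" for x :: real
  have img: "g ` {0<..} = {0<..}"
  proof
    show "{0<..} \<subseteq> g ` {0<..}"
    proof
      fix z :: real assume "z \<in> {0<..}"
      then show "z \<in> g ` {0<..}" using b
        by (intro image_eqI[of _ _ "sqrt (2 * z / b)"]) (auto simp: g_def)
    qed
  qed (use b in \<open>auto simp: g_def\<close>)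
  have der: "(g has_field_derivative b * x) (at x within S)" for x S
  proof -
    have "g = (\<lambda>x. b * x\<^sup>2 / 2)" by (simp add: g_def fun_eq_iff)
    then show ?thesis by (auto intro!: derivative_eq_intros)
  qed
  have inj: "inj_on g {0<..}" using b by (auto simp: inj_on_def g_def power2_eq_iff)
  have Gam: "(f has_integral Gamma (a/2)) {0<..}"
  proof -
    have "(f has_integral Gamma (a/2)) {0..}" unfolding f_def
      using Gamma_integral_real[of "a/2"] a by simp
    moreover have "(f has_integral Gamma (a/2)) {0..} \<longleftrightarrow> (f has_integral Gamma (a/2)) {0<..}"
      by (rule has_integral_spike_set_eq) (auto intro: negligible_subset[of "{0}"])
    ultimately show ?thesis by simp
  qed
  have "f absolutely_integrable_on {0<..}"
    by (rule nonnegative_absolutely_integrable_1) (use Gam in \<open>auto simp: f_def integrable_on_def\<close>)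
  then have "f absolutely_integrable_on g ` {0<..} \<and> integral (g ` {0<..}) f = Gamma (a/2)"
    unfolding img using integral_unique[OF Gam] by simp
  then have ci: "(\<lambda>x. \<bar>b * x\<bar> * f (g x)) absolutely_integrable_on {0<..} \<and>
      integral {0<..} (\<lambda>x. \<bar>b * x\<bar> * f (g x)) = Gamma (a/2)"
    by (subst has_absolute_integral_change_of_variables_1'[OF _ _ inj])
       (auto intro: der)
  then have hi: "((\<lambda>x. \<bar>b * x\<bar> * f (g x)) has_integral Gamma (a/2)) {0<..}"
    by (metis absolutely_integrable_on_def has_integral_integral)
  have eq: "\<bar>b * x\<bar> * f (g x) = (b powr (a/2) * 2 powr (1 - a/2)) * (x powr (a - 1) * exp (- b * x\<^sup>2 / 2))" if "x > 0" for x
  proof -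
    define B X L where "B = ln b" and "X = ln x" and "L = ln (2::real)"
    have gp: "g x > 0" using that b by (simp add: g_def)
    have lg: "ln (g x) = B + 2 * X - L"
      using that b by (simp add: g_def B_def X_def L_def ln_mult_pos ln_div ln_realpow)
    have "\<bar>b * x\<bar> * f (g x) = exp B * exp X * exp ((a/2 - 1) * (B + 2 * X - L)) * exp (- b * x\<^sup>2 / 2)"
    proof -
      have "g x powr (a/2 - 1) = exp ((a/2 - 1) * (B + 2 * X - L))"
        using gp by (simp add: powr_def lg)
      moreover have "\<bar>b * x\<bar> = exp B * exp X" using that b by (simp add: B_def X_def)
      moreover have "1 / exp (g x) = exp (- b * x\<^sup>2 / 2)" by (simp add: g_def exp_minus inverse_eq_divide)
      ultimately show ?thesis unfolding f_def by (metis times_divide_eq_right mult.assoc mult.right_neutral)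
    qed
    also have "exp B * exp X * exp ((a/2 - 1) * (B + 2 * X - L)) = exp (a/2 * B) * exp ((1 - a/2) * L) * exp ((a - 1) * X)"
      by (simp only: exp_add[symmetric]) (rule arg_cong[of _ _ exp], simp add: field_simps)
    finally show ?thesis using that b by (simp add: powr_def B_def X_def L_def)
  qed
  define c where "c = b powr (a/2) * 2 powr (1 - a/2)"
  have c: "c > 0" using b by (simp add: c_def)
  have "((\<lambda>x. c * (x powr (a - 1) * exp (- b * x\<^sup>2 / 2))) has_integral Gamma (a/2)) {0<..}"
    by (rule has_integral_eq[OF _ hi]) (simp add: eq c_def)
  from has_integral_mult_right[OF this, of "1 / c"]
  have "((\<lambda>x. x powr (a - 1) * exp (- b * x\<^sup>2 / 2)) has_integral Gamma (a/2) / c) {0<..}"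
    using c by simp
  from nn_integral_has_integral_lebesgue'[OF _ this]
  have "(\<integral>\<^sup>+ x. ennreal (x powr (a - 1) * exp (- b * x\<^sup>2 / 2)) * indicator {0<..} x \<partial>lborel) = ennreal (Gamma (a/2) / c)"
    by simp
  moreover have "Gamma (a/2) / c = 2 powr (a/2 - 1) * Gamma (a/2) * b powr (-a/2)"
  proof -
    have "1 / (b powr (a/2)) = b powr (-a/2)" by (simp add: powr_minus_divide)
    moreover have "1 / (2 powr (1 - a/2)) = 2 powr (a/2 - 1)"
      using powr_minus_divide[of 2 "1 - a/2"] by simp
    moreover have "Gamma (a/2) / c = (1 / (2 powr (1 - a/2))) * Gamma (a/2) * (1 / (b powr (a/2)))"
      by (simp add: c_def)
    ultimately show ?thesis by (simp only:)
  qed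
  ultimately show ?thesis by simp
qed

text \<open>A power weight shifts the number of degrees of freedom from \<open>t\<close> to
  \<open>t + q\<close>, and a Gaussian weight rescales the variable, so the joint moment stays
  explicit. Negative \<open>q\<close> is allowed and serves the bounds for exp (- w x).\<close>

lemma nn_integral_chi:
  assumes t: "t > 0" and q: "t + q > 0" and u: "u < 1/2"
  shows "(\<integral>\<^sup>+ x. ennreal (x powr q * exp (u * x\<^sup>2)) \<partial>chi_measure t)
    = ennreal (2 powr (q/2) * Gamma ((t + q)/2) / Gamma (t/2) * (1 - 2 * u) powr (- (t + q)/2))"
proof -
  define c where "c = 2 powr (1 - t/2) / Gamma (t/2)"
  have c: "c > 0" using t by (simp add: c_def Gamma_real_pos)
  have m: "(\<lambda>x. ennreal (chi_density t x)) \<in> borel_measurable lborel"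
    unfolding chi_density_def by measurable
  have "(\<integral>\<^sup>+ x. ennreal (x powr q * exp (u * x\<^sup>2)) \<partial>chi_measure t)
      = (\<integral>\<^sup>+ x. ennreal (chi_density t x) * ennreal (x powr q * exp (u * x\<^sup>2)) \<partial>lborel)"
    unfolding chi_measure_def by (rule nn_integral_density[OF m]) measurable
  also have "\<dots> = (\<integral>\<^sup>+ x. ennreal c * (ennreal (x powr (t + q - 1) * exp (- (1 - 2 * u) * x\<^sup>2 / 2)) * indicator {0<..} x) \<partial>lborel)"
  proof (rule nn_integral_cong)
    fix x :: real
    show "ennreal (chi_density t x) * ennreal (x powr q * exp (u * x\<^sup>2))
      = ennreal c * (ennreal (x powr (t + q - 1) * exp (- (1 - 2 * u) * x\<^sup>2 / 2)) * indicator {0<..} x)"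
    proof (cases "x > 0")
      case True
      have "chi_density t x * (x powr q * exp (u * x\<^sup>2)) = c * ((x powr (t - 1) * x powr q) * (exp (- x\<^sup>2 / 2) * exp (u * x\<^sup>2)))"
        using True by (simp add: chi_density_def c_def)
      also have "x powr (t - 1) * x powr q = x powr (t + q - 1)"
        by (simp add: powr_add[symmetric] algebra_simps)
      also have "exp (- x\<^sup>2 / 2) * exp (u * x\<^sup>2) = exp (- (1 - 2 * u) * x\<^sup>2 / 2)"
        by (simp add: exp_add[symmetric] algebra_simps)
      finally show ?thesis using True c t
        by (simp add: ennreal_mult[symmetric] chi_density_def Gamma_real_pos)
    qed (simp add: chi_density_def)
  qed
  also have "\<dots> = ennreal c * (\<integral>\<^sup>+ x. (ennreal (x powr (t + q - 1) * exp (- (1 - 2 * u) * x\<^sup>2 / 2)) * indicator {0<..} x) \<partial>lborel)"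
    by (rule nn_integral_cmult) measurable
  also have "\<dots> = ennreal c * ennreal (2 powr ((t + q)/2 - 1) * Gamma ((t + q)/2) * (1 - 2 * u) powr (-(t + q)/2))"
    using nn_integral_powr_exp_neg_square[OF q, of "1 - 2 * u"] u by simp
  also have "\<dots> = ennreal (c * (2 powr ((t + q)/2 - 1) * Gamma ((t + q)/2) * (1 - 2 * u) powr (-(t + q)/2)))"
    using c q by (intro ennreal_mult[symmetric]) (auto simp: Gamma_real_pos less_imp_le)
  also have "c * (2 powr ((t + q)/2 - 1) * Gamma ((t + q)/2) * (1 - 2 * u) powr (-(t + q)/2))
     = 2 powr (q/2) * Gamma ((t + q)/2) / Gamma (t/2) * (1 - 2 * u) powr (- (t + q)/2)"
  proof -
    have "2 powr (1 - t/2) * 2 powr ((t + q)/2 - 1) = 2 powr (q/2)"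
      by (simp add: powr_add[symmetric] add_divide_distrib)
    then show ?thesis by (simp add: c_def field_simps)
  qed
  finally show ?thesis .
qed

lemma AE_chi_measure_pos: "AE x in chi_measure t. x > 0"
proof -
  have "(\<lambda>x. ennreal (chi_density t x)) \<in> borel_measurable lborel"
    unfolding chi_density_def by measurable
  then show ?thesis unfolding chi_measure_def
    by (subst AE_density) (auto simp: chi_density_def)
qed

lemma nn_integral_chi_exp_square:
  assumes t: "t > 0" and u: "u < 1/2"
  shows "(\<integral>\<^sup>+ x. ennreal (exp (u * x\<^sup>2)) \<partial>chi_measure t) = ennreal ((1 - 2 * u) powr (- t/2))"
proof -
  \<comment> \<open>\<open>x powr 0\<close> equals 1 only for nonzero \<open>x\<close>, so the
    rewriting holds almost everywhere.\<close>
  have "(\<integral>\<^sup>+ x. ennreal (exp (u * x\<^sup>2)) \<partial>chi_measure t) = (\<integral>\<^sup>+ x. ennreal (x powr 0 * exp (u * x\<^sup>2)) \<partial>chi_measure t)"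
    by (rule nn_integral_cong_AE) (use AE_chi_measure_pos[of t] in auto)
  moreover have "Gamma (t/2) \<noteq> 0" using Gamma_real_pos[of "t/2"] t by linarith
  ultimately show ?thesis using nn_integral_chi[OF t, of 0 u] u t by (simp add: \<open>Gamma (t/2) \<noteq> 0\<close>)
qed

lemma prob_space_chi_measure: "t > 0 \<Longrightarrow> prob_space (chi_measure t)"
  using nn_integral_chi_exp_square[of t 0] by (intro prob_spaceI) simp

text \<open>By convexity of ln Gamma, the slope from \<open>a\<close> to \<open>a + h\<close> is at
  least the slope from \<open>a - 1\<close> to \<open>a\<close>, and the latter is
  \<open>ln (a - 1)\<close> by the functional equation.\<close>

lemma Gamma_add_ge:
  fixes a h :: real
  assumes a: "a > 1" and h: "h \<ge> 0"
  shows "Gamma (a + h) \<ge> (a - 1) powr h * Gamma a"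
proof (cases "h = 0")
  case False
  then have h: "h > 0" using h by simp
  let ?f = "\<lambda>x::real. ln (Gamma x)"
  have conv: "convex_on {0<..} ?f" using log_convex_Gamma_real by (simp add: o_def)
  have "Gamma a = (a - 1) * Gamma (a - 1)"
    using Gamma_plus1[of "a - 1"] nonpos_Ints_nonpos[of "a - 1"] a by auto
  then have s1: "?f a - ?f (a - 1) = ln (a - 1)"
    using a Gamma_real_pos[of "a - 1"] by (simp add: ln_mult_pos)
  have "?f a \<le> (h / (1 + h)) * ?f (a - 1) + (1 / (1 + h)) * ?f (a + h)"
  proof -
    have c: "1 - 1 / (1 + h) = h / (1 + h)" using h by (simp add: field_simps)
    have "?f ((1 - 1 / (1 + h)) *\<^sub>R (a - 1) + (1 / (1 + h)) *\<^sub>R (a + h)) \<le> (1 - 1 / (1 + h)) * ?f (a - 1) + (1 / (1 + h)) * ?f (a + h)"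
      by (rule convex_onD[OF conv]) (use a h in auto)
    moreover have "(1 - 1 / (1 + h)) *\<^sub>R (a - 1) + (1 / (1 + h)) *\<^sub>R (a + h) = a"
    proof -
      have "1 + h \<noteq> 0" using h by simp
      then have "h / (1 + h) * (a - 1) + 1 / (1 + h) * (a + h) = a * (1 + h) / (1 + h)"
        unfolding times_divide_eq_left add_divide_distrib[symmetric] by (simp add: algebra_simps)
      then show ?thesis unfolding c real_scaleR_def using \<open>1 + h \<noteq> 0\<close> by simp
    qed
    ultimately show ?thesis by (simp only: c)
  qed
  then have "(1 + h) * ?f a \<le> (1 + h) * ((h / (1 + h)) * ?f (a - 1) + (1 / (1 + h)) * ?f (a + h))"
    by (rule mult_left_mono) (use h in simp)
  also have "\<dots> = h * ?f (a - 1) + ?f (a + h)"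
    using h by (simp only: distrib_left times_divide_eq_left times_divide_eq_right) simp
  finally have "(1 + h) * ?f a \<le> h * ?f (a - 1) + ?f (a + h)" .
  then have "h * ln (a - 1) + ?f a \<le> ?f (a + h)" using s1 by (simp add: algebra_simps)
  then have "exp (h * ln (a - 1) + ?f a) \<le> exp (?f (a + h))" by simp
  then show ?thesis using a h by (simp add: exp_add powr_def Gamma_real_pos)
qed simp

text \<open>Tangent line of the logarithm at \<open>r\<close>; it turns exponential moments into power moments,
  which are explicit for the chi distribution.\<close>
lemma exp_ge_powr:
  fixes w r x :: real
  assumes "r > 0" "x > 0" "w \<ge> 0"
  shows "exp (w * r) * r powr (- w * r) * x powr (w * r) \<le> exp (w * x)"
proof -
  have "ln (x / r) \<le> x / r - 1" using assms by (intro ln_le_minus_one) simp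
  then have "w * r * ln (x / r) \<le> w * r * (x / r - 1)" using assms by (intro mult_left_mono) auto
  then have "w * r * (ln x - ln r) \<le> w * x - w * r" using assms by (simp add: ln_div algebra_simps)
  then have "exp (w * r + (- w * r * ln r + w * r * ln x)) \<le> exp (w * x)" by (simp add: algebra_simps)
  then show ?thesis using assms unfolding exp_add by (simp add: powr_def)
qed

text \<open>The tangent is taken at \<open>sqrt t\<close>, near the bulk of the law, which leads to
  the power moment of order \<open>q = w * sqrt t\<close>. The correction
  \<open>2 * w / sqrt t\<close> is the price of the shift by one in the Gamma ratio bound.\<close>

lemma nn_integral_chi_exp_ge:
  assumes t: "t \<ge> 4" and w: "w \<ge> 0"
  shows "(\<integral>\<^sup>+ x. ennreal (exp (w * x)) \<partial>chi_measure t) \<ge> ennreal (exp (w * sqrt t - 2 * w / sqrt t))"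
proof -
  define r where "r = sqrt t"
  have r: "r > 0" "r * r = t" "r\<^sup>2 = t" using t by (auto simp: r_def)
  have "ln t = 2 * ln r" using ln_realpow[of r 2] r(3) by simp
  then have tp: "t powr x = r powr (2 * x)" for x using r(1) t by (simp add: powr_def)
  define q where "q = w * r"
  have q: "q \<ge> 0" using w r by (simp add: q_def)
  define K where "K = exp q * r powr (- q)"
  have K: "K > 0" using r by (simp add: K_def)
  have "ennreal K * ennreal (2 powr (q/2) * Gamma ((t + q)/2) / Gamma (t/2))
     = ennreal K * (\<integral>\<^sup>+ x. ennreal (x powr q) \<partial>chi_measure t)"
    using nn_integral_chi[of t q 0] t q by simp
  also have "\<dots> = (\<integral>\<^sup>+ x. ennreal K * ennreal (x powr q) \<partial>chi_measure t)"
    by (rule nn_integral_cmult[symmetric]) measurable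
  also have "\<dots> \<le> (\<integral>\<^sup>+ x. ennreal (exp (w * x)) \<partial>chi_measure t)"
  proof (rule nn_integral_mono_AE)
    show "AE x in chi_measure t. ennreal K * ennreal (x powr q) \<le> ennreal (exp (w * x))"
      using AE_chi_measure_pos[of t]
    proof eventually_elim
      case (elim x)
      then show ?case using exp_ge_powr[of r x w] r w K
        by (simp add: K_def q_def ennreal_mult[symmetric])
    qed
  qed
  finally have 1: "ennreal (K * (2 powr (q/2) * Gamma ((t + q)/2) / Gamma (t/2))) \<le> (\<integral>\<^sup>+ x. ennreal (exp (w * x)) \<partial>chi_measure t)"
    using K t q by (subst ennreal_mult) (auto simp: Gamma_real_pos less_imp_le)
  have "exp (w * sqrt t - 2 * w / sqrt t) \<le> K * (2 powr (q/2) * (t/2 - 1) powr (q/2))"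
  proof -
    have l: "ln (1 - 2/t) \<ge> - 4 / t"
    proof -
      have "- (2/t) - 2 * (2/t)\<^sup>2 \<le> ln (1 - 2/t)" by (rule ln_one_minus_pos_lower_bound) (use t in auto)
      moreover have "2 * (2/t)\<^sup>2 \<le> 2/t" using t by (simp add: power2_eq_square field_simps)
      ultimately show ?thesis by linarith
    qed
    have e: "2 * w / sqrt t = (q/2) * (4 / t)" using r(1) unfolding r_def[symmetric] q_def r(2)[symmetric] by (simp add: field_simps)
    have "2 powr (q/2) * (t/2 - 1) powr (q/2) = (t - 2) powr (q/2)"
      using t by (subst powr_mult[symmetric]) auto
    also have "t - 2 = t * (1 - 2/t)" using t by (simp add: field_simps)
    also have "(t * (1 - 2/t)) powr (q/2) = t powr (q/2) * (1 - 2/t) powr (q/2)"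
      by (rule powr_mult)
    also have "t powr (q/2) = r powr q" using r(1) tp by simp
    finally have "K * (2 powr (q/2) * (t/2 - 1) powr (q/2)) = exp q * (r powr (-q) * r powr q) * (1 - 2/t) powr (q/2)"
      by (simp add: K_def)
    also have "r powr (-q) * r powr q = 1" using r by (simp add: powr_add[symmetric])
    also have "exp q * 1 * (1 - 2/t) powr (q/2) = exp (q + (q/2) * ln (1 - 2/t))"
      using t by (simp add: powr_def exp_add)
    finally have K': "K * (2 powr (q/2) * (t/2 - 1) powr (q/2)) = exp (q + (q/2) * ln (1 - 2/t))" .
    have "(q/2) * (-4/t) \<le> (q/2) * ln (1 - 2/t)" by (rule mult_left_mono[OF l]) (use q in simp)
    moreover have "w * sqrt t - 2 * w / sqrt t = q + (q/2) * (-4/t)" unfolding e by (simp add: q_def r_def)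
    ultimately show ?thesis unfolding K' by simp
  qed
  also have "\<dots> \<le> K * (2 powr (q/2) * (Gamma (t/2 + q/2) / Gamma (t/2)))"
    using Gamma_add_ge[of "t/2" "q/2"] t q K
    by (intro mult_left_mono) (auto simp: Gamma_real_pos field_simps)
  finally show ?thesis using order_trans[OF _ 1] by (simp add: ennreal_leI add_divide_distrib)
qed

text \<open>The reciprocal of the tangent inequality leads to a negative power moment. The condition
  \<open>wt\<close> keeps \<open>(q + 2) / t\<close> at most 1/2, so the Gamma ratio bound and the
  estimate of the logarithm both apply; the term \<open>w\<^sup>2\<close> is
  \<open>q\<^sup>2 / t\<close>.\<close>

lemma nn_integral_chi_exp_neg_le:
  assumes t: "t > 0" and w: "w \<ge> 0" and wt: "w * sqrt t + 2 \<le> t / 2"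
  shows "(\<integral>\<^sup>+ x. ennreal (exp (- w * x)) \<partial>chi_measure t) \<le> ennreal (exp (- w * sqrt t + w\<^sup>2 + 2 * w / sqrt t))"
proof -
  define r where "r = sqrt t"
  have r: "r > 0" "r * r = t" "r\<^sup>2 = t" using t by (auto simp: r_def)
  have "ln t = 2 * ln r" using ln_realpow[of r 2] r(3) by simp
  then have tp: "t powr x = r powr (2 * x)" for x using r(1) t by (simp add: powr_def)
  define q where "q = w * r"
  have q: "q \<ge> 0" using w r by (simp add: q_def)
  have qt: "q + 2 \<le> t / 2" using wt by (simp add: q_def r_def)
  define K where "K = exp (- q) * r powr q"
  have K: "K > 0" using r by (simp add: K_def)
  have "(\<integral>\<^sup>+ x. ennreal (exp (- w * x)) \<partial>chi_measure t) \<le> (\<integral>\<^sup>+ x. ennreal K * ennreal (x powr (- q)) \<partial>chi_measure t)"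
  proof (rule nn_integral_mono_AE)
    show "AE x in chi_measure t. ennreal (exp (- w * x)) \<le> ennreal K * ennreal (x powr (- q))"
      using AE_chi_measure_pos[of t]
    proof eventually_elim
      case (elim x)
      have "inverse (exp (w * x)) \<le> inverse (exp q * r powr (- q) * x powr q)"
        using exp_ge_powr[of r x w] r w elim by (intro le_imp_inverse_le) (auto simp: q_def)
      then show ?case using K
        by (simp add: K_def ennreal_mult[symmetric] exp_minus powr_minus)
    qed
  qed
  also have "\<dots> = ennreal K * (\<integral>\<^sup>+ x. ennreal (x powr (- q)) \<partial>chi_measure t)"
    by (rule nn_integral_cmult) measurable
  also have "\<dots> = ennreal K * ennreal (2 powr (- q/2) * Gamma ((t - q)/2) / Gamma (t/2))"
    using nn_integral_chi[of t "- q" 0] t q qt by simp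
  also have "\<dots> = ennreal (K * (2 powr (- q/2) * (Gamma ((t - q)/2) / Gamma (t/2))))"
    using K t q qt by (subst ennreal_mult[symmetric]) (auto simp: Gamma_real_pos)
  also have "\<dots> \<le> ennreal (exp (- w * sqrt t + w\<^sup>2 + 2 * w / sqrt t))"
  proof (rule ennreal_leI)
    define a where "a = (t - q)/2"
    have a: "a > 1" using qt q t by (simp add: a_def)
    have at: "t/2 = a + q/2" by (simp add: a_def field_simps)
    have "(a - 1) powr (q/2) * Gamma a \<le> Gamma (t/2)"
      unfolding at using Gamma_add_ge[OF a, of "q/2"] q by simp
    then have "Gamma a / Gamma (t/2) \<le> (a - 1) powr (- (q/2))"
      using a t by (simp add: powr_minus Gamma_real_pos field_simps)
    then have "K * (2 powr (- q/2) * (Gamma ((t - q)/2) / Gamma (t/2))) \<le> K * (2 powr (- q/2) * (a - 1) powr (- (q/2)))"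
      unfolding a_def[symmetric] using K by (intro mult_left_mono) auto
    also have "2 powr (- q/2) * (a - 1) powr (- (q/2)) = (2 * (a - 1)) powr (- (q/2))"
      using a powr_mult[of 2 "a - 1" "- (q/2)"] by simp
    also have "2 * (a - 1) = t * (1 - (q + 2)/t)" using t by (simp add: a_def field_simps)
    also have "\<dots> powr (- (q/2)) = t powr (- (q/2)) * (1 - (q + 2)/t) powr (- (q/2))"
      by (rule powr_mult)
    also have "t powr (- (q/2)) = r powr (- q)" using r(1) tp by simp
    also have "K * (r powr (- q) * (1 - (q + 2)/t) powr (- (q/2))) = exp (- q) * (r powr (-q) * r powr q) * (1 - (q + 2)/t) powr (- (q/2))"
      by (simp add: K_def)
    also have "r powr (-q) * r powr q = 1" using r by (simp add: powr_add[symmetric])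
    also have "exp (- q) * 1 * (1 - (q + 2)/t) powr (- (q/2)) = exp (- q + (q/2) * (- ln (1 - (q + 2)/t)))"
      using t qt q by (simp add: powr_def exp_add[symmetric] field_simps)
    also have "\<dots> \<le> exp (- q + (q/2) * (2 * ((q + 2)/t)))"
    proof -
      define z where "z = (q + 2)/t"
      have z: "0 \<le> z" "z \<le> 1/2" using t q qt by (auto simp: z_def field_simps)
      have "- z - 2 * z\<^sup>2 \<le> ln (1 - z)" by (rule ln_one_minus_pos_lower_bound) (use z in auto)
      moreover have "2 * z\<^sup>2 \<le> z" using z mult_right_mono[of z "1/2" z] by (simp add: power2_eq_square)
      ultimately have "- ln (1 - z) \<le> 2 * z" by linarith
      then have "(q/2) * (- ln (1 - z)) \<le> (q/2) * (2 * z)" by (rule mult_left_mono) (use q in simp)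
      then show ?thesis unfolding z_def[symmetric] by simp
    qed
    also have "- q + (q/2) * (2 * ((q + 2)/t)) = - w * sqrt t + w\<^sup>2 + 2 * w / sqrt t"
    proof -
      show ?thesis using r(1) unfolding r_def[symmetric] q_def r(2)[symmetric]
        by (simp add: power2_eq_square field_simps)
    qed
    finally show "K * (2 powr (- q/2) * (Gamma ((t - q)/2) / Gamma (t/2))) \<le> exp (- w * sqrt t + w\<^sup>2 + 2 * w / sqrt t)" .
  qed
  finally show ?thesis .
qed

lemma one_minus_powr_neg_le:
  fixes z t :: real
  assumes z: "0 \<le> z" "z \<le> 1/2" and t: "t \<ge> 0"
  shows "(1 - z) powr (- t/2) \<le> exp (t/2 * (z + 2 * z\<^sup>2))"
proof -
  have "- z - 2 * z\<^sup>2 \<le> ln (1 - z)" by (rule ln_one_minus_pos_lower_bound) (use z in auto)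
  then have "t/2 * - ln (1 - z) \<le> t/2 * (z + 2 * z\<^sup>2)" using t by (intro mult_left_mono) auto
  then show ?thesis using z by (simp add: powr_def)
qed

text \<open>The inequality x \<le> r / 2 + x^2 / (2 r) with \<open>r = sqrt t\<close>, sharp at the
  typical value of the variable, replaces the linear exponent by a quadratic one, whose moment is
  explicit.\<close>

lemma nn_integral_chi_exp_le:
  assumes t: "t > 0" and w: "w \<ge> 0" and wt: "w \<le> sqrt t / 2"
  shows "(\<integral>\<^sup>+ x. ennreal (exp (w * x)) \<partial>chi_measure t) \<le> ennreal (exp (w * sqrt t + w\<^sup>2))"
proof -
  define r where "r = sqrt t"
  have r: "r > 0" "r * r = t" "r\<^sup>2 = t" using t by (auto simp: r_def)
  have "w < sqrt t" using wt r by (simp add: r_def[symmetric])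
  have am: "w * x \<le> w * r / 2 + w / (2 * r) * x\<^sup>2" for x
  proof -
    have "0 \<le> w / (2 * r) * (x - r)\<^sup>2" using w r by simp
    also have "\<dots> = w * r / 2 + w / (2 * r) * x\<^sup>2 - w * x"
      using r by (simp add: power2_eq_square field_simps)
    finally show ?thesis by simp
  qed
  have "(\<integral>\<^sup>+ x. ennreal (exp (w * x)) \<partial>chi_measure t)
      \<le> (\<integral>\<^sup>+ x. ennreal (exp (w * r / 2)) * ennreal (exp (w / (2 * r) * x\<^sup>2)) \<partial>chi_measure t)"
    by (intro nn_integral_mono) (use am in \<open>simp add: ennreal_mult[symmetric] exp_add[symmetric]\<close>)
  also have "\<dots> = ennreal (exp (w * r / 2)) * (\<integral>\<^sup>+ x. ennreal (exp (w / (2 * r) * x\<^sup>2)) \<partial>chi_measure t)"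
    by (rule nn_integral_cmult) measurable
  also have "\<dots> = ennreal (exp (w * r / 2)) * ennreal ((1 - w / r) powr (- t/2))"
    using nn_integral_chi_exp_square[of t "w / (2 * r)"] t \<open>w < sqrt t\<close> by (simp add: field_simps r_def)
  also have "\<dots> \<le> ennreal (exp (w * r / 2)) * ennreal (exp (t/2 * (w / r + 2 * (w / r)\<^sup>2)))"
    by (intro mult_left_mono ennreal_leI one_minus_powr_neg_le) (use w wt r t in \<open>auto simp: field_simps r_def\<close>)
  also have "\<dots> = ennreal (exp (w * sqrt t + w\<^sup>2))"
  proof -
    have "t / 2 * (w / r + 2 * (w / r)\<^sup>2) = w * r / 2 + w\<^sup>2"
      using r(1) unfolding r(2)[symmetric] by (simp add: power2_eq_square field_simps)
    then have "w * r / 2 + t / 2 * (w / r + 2 * (w / r)\<^sup>2) = w * r + w\<^sup>2" by linarith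
    then show ?thesis unfolding r_def[symmetric] by (simp only: ennreal_mult[symmetric] exp_add[symmetric] exp_ge_zero)
  qed
  finally show ?thesis .
qed

section \<open>Right tail\<close>

text \<open>The entry law of a leading block of size \<open>n\<close>. The families do not depend on
  \<open>n\<close>, unlike the chi parameters of \<open>entries_law\<close>, which are tied to the
  full size; this permits induction over blocks of one fixed matrix.\<close>

definition tri_law :: "(nat \<Rightarrow> real measure) \<Rightarrow> (nat \<Rightarrow> real measure) \<Rightarrow> nat \<Rightarrow> ((nat \<Rightarrow> real) \<times> (nat \<Rightarrow> real)) measure" where
  "tri_law A B n = PiM {1..n} A \<Otimes>\<^sub>M PiM {1..n-1} B"

lemma prob_space_tri_law:
  assumes "\<And>k. prob_space (A k)" "\<And>k. prob_space (B k)"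
  shows "prob_space (tri_law A B n)"
proof -
  interpret P: prob_space "PiM {1..n} A" by (rule prob_space_PiM) (rule assms)
  interpret Q: prob_space "PiM {1..n-1} B" by (rule prob_space_PiM) (rule assms)
  interpret PQ: pair_prob_space "PiM {1..n} A" "PiM {1..n-1} B" ..
  show ?thesis unfolding tri_law_def by (rule PQ.prob_space_axioms)
qed

text \<open>One step of a supermartingale estimate: a bound on the integral over the two entries
  added by the next row, valid for every value of the old entries, is integrated over the old
  entries.\<close>

lemma nn_integral_tri_law_Suc_le:
  assumes A: "\<And>k. prob_space (A k)" and B: "\<And>k. prob_space (B k)"
    and \<Phi>: "\<Phi> \<in> borel_measurable (tri_law A B (Suc (Suc n)))"
    and \<Psi>: "\<Psi> \<in> borel_measurable (tri_law A B (Suc n))"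
    and le: "\<And>g c. (\<integral>\<^sup>+ x. \<integral>\<^sup>+ y. \<Phi> (g(Suc (Suc n) := x), c(Suc n := y)) \<partial>B (Suc n) \<partial>A (Suc (Suc n))) \<le> \<Psi> (g, c)"
  shows "integral\<^sup>N (tri_law A B (Suc (Suc n))) \<Phi> \<le> integral\<^sup>N (tri_law A B (Suc n)) \<Psi>"
proof -
  define i j I J where "i = Suc (Suc n)" and "j = Suc n" and "I = {1..Suc n}" and "J = {1..n}"
  have I: "finite I" "i \<notin> I" and J: "finite J" "j \<notin> J" by (auto simp: i_def j_def I_def J_def)
  define P where "P = PiM I A"
  define Q where "Q = PiM J B"
  define P' where "P' = PiM (insert i I) A"
  define Q' where "Q' = PiM (insert j J) B"
  have L2: "tri_law A B (Suc (Suc n)) = P' \<Otimes>\<^sub>M Q'"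
    by (simp add: tri_law_def P'_def Q'_def i_def j_def I_def J_def atLeastAtMostSuc_conv insert_commute)
  have L1: "tri_law A B (Suc n) = P \<Otimes>\<^sub>M Q"
    by (simp add: tri_law_def P_def Q_def I_def J_def)
  interpret A: product_sigma_finite A by (rule product_sigma_finite.intro) (rule prob_space_imp_sigma_finite[OF A])
  interpret B: product_sigma_finite B by (rule product_sigma_finite.intro) (rule prob_space_imp_sigma_finite[OF B])
  interpret P: prob_space P unfolding P_def by (rule prob_space_PiM) (rule A)
  interpret Q: prob_space Q unfolding Q_def by (rule prob_space_PiM) (rule B)
  interpret Q': prob_space Q' unfolding Q'_def by (rule prob_space_PiM) (rule B)
  interpret Ai: prob_space "A i" by (rule A)
  interpret AQ: pair_sigma_finite "A i" Q ..
  note \<Phi>' = \<Phi>[unfolded L2]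
  note \<Psi>' = \<Psi>[unfolded L1]
  have mi: "(\<lambda>x. g(i := x)) \<in> measurable (A i) P'" if "g \<in> space P" for g
    unfolding P'_def by (rule measurable_fun_upd[where J=I]) (use that in \<open>auto simp: P_def\<close>)
  have mj: "(\<lambda>(c, y). c(j := y)) \<in> measurable (Q \<Otimes>\<^sub>M B j) Q'"
    unfolding Q'_def Q_def by (rule measurable_add_dim)
  have "integral\<^sup>N (P' \<Otimes>\<^sub>M Q') \<Phi> = (\<integral>\<^sup>+ g. \<integral>\<^sup>+ c. \<Phi> (g, c) \<partial>Q' \<partial>P')"
    by (rule Q'.nn_integral_fst[OF \<Phi>', symmetric])
  also have "\<dots> = (\<integral>\<^sup>+ g. \<integral>\<^sup>+ x. \<integral>\<^sup>+ c. \<Phi> (g(i := x), c) \<partial>Q' \<partial>A i \<partial>P)"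
    unfolding P_def P'_def
    by (rule A.product_nn_integral_insert[OF I])
       (use Q'.borel_measurable_nn_integral_fst[OF \<Phi>'] in \<open>simp add: P'_def\<close>)
  also have "\<dots> \<le> (\<integral>\<^sup>+ g. \<integral>\<^sup>+ c. \<Psi> (g, c) \<partial>Q \<partial>P)"
  proof (rule nn_integral_mono)
    fix g assume g: "g \<in> space P"
    have m3: "(\<lambda>((x, c), y). \<Phi> (g(i := x), c(j := y))) \<in> borel_measurable ((A i \<Otimes>\<^sub>M Q) \<Otimes>\<^sub>M B j)"
    proof -
      have "(\<lambda>w. (g(i := fst (fst w)), (\<lambda>(c, y). c(j := y)) (snd (fst w), snd w))) \<in> measurable ((A i \<Otimes>\<^sub>M Q) \<Otimes>\<^sub>M B j) (P' \<Otimes>\<^sub>M Q')"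
        by (intro measurable_Pair measurable_compose[OF _ mi[OF g]] measurable_compose[OF _ mj]) measurable
      from measurable_compose[OF this \<Phi>'] show ?thesis by (simp add: case_prod_beta')
    qed
    have "(\<integral>\<^sup>+ x. \<integral>\<^sup>+ c. \<Phi> (g(i := x), c) \<partial>Q' \<partial>A i) = (\<integral>\<^sup>+ x. \<integral>\<^sup>+ c. \<integral>\<^sup>+ y. \<Phi> (g(i := x), c(j := y)) \<partial>B j \<partial>Q \<partial>A i)"
    proof (rule nn_integral_cong)
      fix x assume x: "x \<in> space (A i)"
      have "g(i := x) \<in> space P'" using measurable_space[OF mi[OF g] x] .
      then have "(\<lambda>c. \<Phi> (g(i := x), c)) \<in> borel_measurable Q'"
        by (intro measurable_compose[OF _ \<Phi>'] measurable_Pair1')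
      then show "(\<integral>\<^sup>+ c. \<Phi> (g(i := x), c) \<partial>Q') = (\<integral>\<^sup>+ c. \<integral>\<^sup>+ y. \<Phi> (g(i := x), c(j := y)) \<partial>B j \<partial>Q)"
        unfolding Q'_def Q_def by (rule B.product_nn_integral_insert[OF J])
    qed
    \<comment> \<open>Splitting off the new coordinates leaves the old off-diagonal entries between
      them; the exchange brings the two new variables innermost, as \<open>le\<close>
      requires.\<close>
    also have "\<dots> = (\<integral>\<^sup>+ c. \<integral>\<^sup>+ x. \<integral>\<^sup>+ y. \<Phi> (g(i := x), c(j := y)) \<partial>B j \<partial>A i \<partial>Q)"
    proof (rule AQ.Fubini'[symmetric])
      show "(\<lambda>(x, c). \<integral>\<^sup>+ y. \<Phi> (g(i := x), c(j := y)) \<partial>B j) \<in> borel_measurable (A i \<Otimes>\<^sub>M Q)"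
        using sigma_finite_measure.borel_measurable_nn_integral_fst[OF prob_space_imp_sigma_finite[OF B] m3] by (simp add: case_prod_beta')
    qed
    also have "\<dots> \<le> (\<integral>\<^sup>+ c. \<Psi> (g, c) \<partial>Q)"
      by (rule nn_integral_mono) (use le in \<open>simp add: i_def j_def\<close>)
    finally show "(\<integral>\<^sup>+ x. \<integral>\<^sup>+ c. \<Phi> (g(i := x), c) \<partial>Q' \<partial>A i) \<le> (\<integral>\<^sup>+ c. \<Psi> (g, c) \<partial>Q)" .
  qed
  also have "\<dots> = integral\<^sup>N (P \<Otimes>\<^sub>M Q) \<Psi>"
    by (rule Q.nn_integral_fst[OF \<Psi>'])
  finally show ?thesis unfolding L1 L2 .
qed

section \<open>The pivot chain as a function of the entries\<close>

lemma measurable_tri_law_diag: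
  assumes "\<And>k. sets (A k) = sets borel" "k \<in> {1..n}"
  shows "(\<lambda>w. fst w k) \<in> borel_measurable (tri_law A B n)"
proof -
  have "(\<lambda>w. fst w k) \<in> measurable (tri_law A B n) (A k)"
    unfolding tri_law_def by (rule measurable_compose[OF measurable_fst measurable_component_singleton]) fact
  then show ?thesis using assms(1)[of k] by (simp cong: measurable_cong_sets)
qed

lemma measurable_tri_law_offdiag:
  assumes "\<And>k. sets (B k) = sets borel" "k \<in> {1..n-1}"
  shows "(\<lambda>w. snd w k) \<in> borel_measurable (tri_law A B n)"
proof -
  have "(\<lambda>w. snd w k) \<in> measurable (tri_law A B n) (B k)"
    unfolding tri_law_def by (rule measurable_compose[OF measurable_snd measurable_component_singleton]) fact
  then show ?thesis using assms(1)[of k] by (simp cong: measurable_cong_sets)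
qed

lemma measurable_pivot:
  assumes A: "\<And>k. sets (A k) = sets borel" and B: "\<And>k. sets (B k) = sets borel"
  shows "k \<le> n \<Longrightarrow> (\<lambda>w. pivot a (fst w) (snd w) k) \<in> borel_measurable (tri_law A B n)"
proof (induction k)
  case (Suc k)
  have m1 [measurable]: "(\<lambda>w. fst w (Suc k)) \<in> borel_measurable (tri_law A B n)"
    by (rule measurable_tri_law_diag) (use A Suc.prems in auto)
  show ?case
  proof (cases k)
    case km: (Suc m)
    have [measurable]: "(\<lambda>w. snd w k) \<in> borel_measurable (tri_law A B n)"
      by (rule measurable_tri_law_offdiag) (use B km Suc.prems in auto)
    have [measurable]: "(\<lambda>w. pivot a (fst w) (snd w) k) \<in> borel_measurable (tri_law A B n)"
      using Suc.IH Suc.prems by simp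
    have "pivot a (fst w) (snd w) (Suc k) = a - fst w (Suc k) - (snd w k)\<^sup>2 / pivot a (fst w) (snd w) k" for w
      by (simp add: km)
    then show ?thesis by simp
  qed (use m1 in simp)
qed simp

lemma pivot_cong:
  assumes "\<And>i. i \<in> {1..k} \<Longrightarrow> g i = g' i" "\<And>i. i \<in> {1..<k} \<Longrightarrow> c i = c' i"
  shows "pivot a g c k = pivot a g' c' k"
  using assms by (induction a g c k rule: pivot.induct) auto

text \<open>The pivots form a Markov chain. Stopping \<open>V\<close> of the chain at the first pivot below \<open>l\<close>
  gives a supermartingale up to the errors \<open>s k\<close>.\<close>
lemma pivot_hitting_bound:
  fixes V :: "real \<Rightarrow> ennreal"
  assumes A: "\<And>k. prob_space (A k)" "\<And>k. sets (A k) = sets borel"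
    and B: "\<And>k. prob_space (B k)" "\<And>k. sets (B k) = sets borel"
    and V: "antimono V" "V \<in> borel_measurable borel"
    and step: "\<And>k d. k \<in> {1..<N} \<Longrightarrow> d > l \<Longrightarrow>
      (\<integral>\<^sup>+ x. \<integral>\<^sup>+ y. V (a - x - y\<^sup>2 / d) \<partial>B k \<partial>A (Suc k)) \<le> V d + s k"
    and N: "N \<ge> 1"
  shows "V l * emeasure (tri_law A B N) {w \<in> space (tri_law A B N). \<exists>j\<in>{1..N}. pivot a (fst w) (snd w) j \<le> l}
    \<le> (\<integral>\<^sup>+ x. V (a - x) \<partial>A 1) + (\<Sum>k=1..<N. s k)"
proof -
  \<comment> \<open>After a hit the process is frozen at \<open>V l\<close>, not at the value of
    \<open>V\<close> at the offending pivot. As \<open>V\<close> is antitone, freezing can only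
    lower the value, and the hitting event then contributes exactly \<open>V l\<close>.\<close>
  define \<Phi> where "\<Phi> k w = (if \<forall>j\<in>{1..k}. pivot a (fst w) (snd w) j > l then V (pivot a (fst w) (snd w) k) else V l)" for k w
  note mp [measurable] = measurable_pivot[of A B _ _ a, OF A(2) B(2)]
  note V(2) [measurable]
  have m\<Phi>: "\<Phi> n \<in> borel_measurable (tri_law A B n)" for n
  proof -
    have [measurable]: "Measurable.pred (tri_law A B n) (\<lambda>w. \<forall>j\<in>{1..n}. pivot a (fst w) (snd w) j > l)"
      by (rule pred_intros_finite) (auto intro!: borel_measurable_pred_less mp)
    show ?thesis unfolding \<Phi>_def by (intro measurable_If measurable_compose[OF mp V(2)]) auto
  qed
  have main: "integral\<^sup>N (tri_law A B (Suc n)) (\<Phi> (Suc n)) \<le> (\<integral>\<^sup>+ x. V (a - x) \<partial>A 1) + (\<Sum>k=1..<Suc n. s k)"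
    if "Suc n \<le> N" for n using that
  proof (induction n)
    case 0
    interpret Q: prob_space "PiM {1..0::nat} B" by (rule prob_space_PiM) (rule B(1))
    have sf: "product_sigma_finite A"
      by (rule product_sigma_finite.intro) (rule prob_space_imp_sigma_finite[OF A(1)])
    have "(\<integral>\<^sup>+ w. \<Phi> 1 w \<partial>tri_law A B 1) \<le> (\<integral>\<^sup>+ w. V (a - fst w 1) \<partial>tri_law A B 1)"
      by (rule nn_integral_mono) (auto simp: \<Phi>_def intro: antimonoD[OF V(1)])
    also have "\<dots> = (\<integral>\<^sup>+ g. \<integral>\<^sup>+ c. V (a - g 1) \<partial>PiM {1..0} B \<partial>PiM {1..1} A)"
    proof -
      have "(\<lambda>w. V (a - fst w 1)) \<in> borel_measurable (PiM {1..1} A \<Otimes>\<^sub>M PiM {1..0} B)"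
        using measurable_tri_law_diag[of A 1 1 B, OF A(2)] by (simp add: tri_law_def)
      from Q.nn_integral_fst[OF this] show ?thesis by (simp add: tri_law_def)
    qed
    also have "\<dots> = (\<integral>\<^sup>+ g. V (a - g 1) \<partial>PiM {1} A)" by (simp add: Q.emeasure_space_1[simplified])
    also have "\<dots> = (\<integral>\<^sup>+ x. V (a - x) \<partial>A 1)"
      by (rule product_sigma_finite.product_nn_integral_singleton[OF sf, of "\<lambda>x. V (a - x)"])
         (simp cong: measurable_cong_sets add: A(2))
    finally show ?case by simp
  next
    case (Suc n)
    have sN: "Suc n \<in> {1..<N}" using Suc.prems by auto
    interpret T: prob_space "tri_law A B (Suc n)" by (rule prob_space_tri_law) (rule A B)+
    have "integral\<^sup>N (tri_law A B (Suc (Suc n))) (\<Phi> (Suc (Suc n)))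
      \<le> integral\<^sup>N (tri_law A B (Suc n)) (\<lambda>w. \<Phi> (Suc n) w + s (Suc n))"
    proof (rule nn_integral_tri_law_Suc_le[OF A(1) B(1) m\<Phi>])
      show "(\<lambda>w. \<Phi> (Suc n) w + s (Suc n)) \<in> borel_measurable (tri_law A B (Suc n))"
        using m\<Phi> by measurable
      fix g c :: "nat \<Rightarrow> real"
      have piv: "pivot a (g(Suc (Suc n) := x)) (c(Suc n := y)) j = pivot a g c j" if "j \<le> Suc n" for x y j
        by (rule pivot_cong) (use that in auto)
      let ?d = "pivot a g c (Suc n)"
      let ?\<Phi>' = "\<lambda>x y. \<Phi> (Suc (Suc n)) (g(Suc (Suc n) := x), c(Suc n := y))"
      have piv': "pivot a (g(Suc (Suc n) := x)) (c(Suc n := y)) (Suc (Suc n)) = a - x - y\<^sup>2 / ?d" for x y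
        using piv[of "Suc n" x y] by simp
      show "(\<integral>\<^sup>+ x. \<integral>\<^sup>+ y. ?\<Phi>' x y \<partial>B (Suc n) \<partial>A (Suc (Suc n))) \<le> \<Phi> (Suc n) (g, c) + s (Suc n)"
      proof (cases "\<forall>j\<in>{1..Suc n}. pivot a g c j > l")
        case True
        have "(\<integral>\<^sup>+ x. \<integral>\<^sup>+ y. ?\<Phi>' x y \<partial>B (Suc n) \<partial>A (Suc (Suc n)))
          \<le> (\<integral>\<^sup>+ x. \<integral>\<^sup>+ y. V (a - x - y\<^sup>2 / ?d) \<partial>B (Suc n) \<partial>A (Suc (Suc n)))"
        proof (intro nn_integral_mono)
          fix x y
          have "V l \<le> V (a - x - y\<^sup>2 / ?d)" if ex: "\<not> (\<forall>j\<in>{1..Suc (Suc n)}. pivot a (g(Suc (Suc n) := x)) (c(Suc n := y)) j > l)"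
          proof -
            obtain j where j: "j \<in> {1..Suc (Suc n)}" "\<not> pivot a (g(Suc (Suc n) := x)) (c(Suc n := y)) j > l"
              using ex by blast
            then have jn: "j = Suc (Suc n)" using True piv[of j x y] by (cases "j \<le> Suc n") auto
            then have "a - x - y\<^sup>2 / ?d \<le> l" using j(2) unfolding jn piv' by (simp only: not_less)
            then show ?thesis by (rule antimonoD[OF V(1)])
          qed
          then show "?\<Phi>' x y \<le> V (a - x - y\<^sup>2 / ?d)"
            unfolding \<Phi>_def fst_conv snd_conv piv' by simp
        qed
        also have "\<dots> \<le> V ?d + s (Suc n)" by (rule step[OF sN]) (use True in auto)
        finally show ?thesis using True by (simp add: \<Phi>_def)
      next
        case False
        then obtain j where j: "j \<in> {1..Suc n}" "\<not> pivot a g c j > l" by blast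
        have "?\<Phi>' x y = V l" for x y
        proof -
          have "\<not> pivot a (g(Suc (Suc n) := x)) (c(Suc n := y)) j > l"
            using j piv[of j x y] by simp
          then have "\<not> (\<forall>j\<in>{1..Suc (Suc n)}. pivot a (g(Suc (Suc n) := x)) (c(Suc n := y)) j > l)"
            using j by (meson atLeastAtMost_iff le_SucI)
          then show ?thesis unfolding \<Phi>_def fst_conv snd_conv by (rule if_not_P)
        qed
        then have "(\<integral>\<^sup>+ x. \<integral>\<^sup>+ y. ?\<Phi>' x y \<partial>B (Suc n) \<partial>A (Suc (Suc n))) = V l"
          by (simp add: prob_space.emeasure_space_1[OF A(1)] prob_space.emeasure_space_1[OF B(1)])
        moreover have "\<Phi> (Suc n) (g, c) = V l"
          using False unfolding \<Phi>_def fst_conv snd_conv by (rule if_not_P)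
        ultimately show ?thesis by simp
      qed
    qed
    also have "\<dots> = integral\<^sup>N (tri_law A B (Suc n)) (\<Phi> (Suc n)) + s (Suc n)"
      by (subst nn_integral_add) (auto simp: m\<Phi> T.emeasure_space_1)
    also have "\<dots> \<le> ((\<integral>\<^sup>+ x. V (a - x) \<partial>A 1) + (\<Sum>k=1..<Suc n. s k)) + s (Suc n)"
      by (intro add_right_mono Suc.IH) (use Suc.prems in simp)
    finally show ?case by (simp add: add.assoc)
  qed
  let ?E = "{w \<in> space (tri_law A B N). \<exists>j\<in>{1..N}. pivot a (fst w) (snd w) j \<le> l}"
  have E: "?E \<in> sets (tri_law A B N)"
  proof -
    have "?E = (\<Union>j\<in>{1..N}. {w \<in> space (tri_law A B N). pivot a (fst w) (snd w) j \<le> l})" by auto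
    also have "\<dots> \<in> sets (tri_law A B N)"
      by (intro sets.finite_UN borel_measurable_le mp) auto
    finally show ?thesis .
  qed
  have "V l * emeasure (tri_law A B N) ?E = (\<integral>\<^sup>+ w. V l * indicator ?E w \<partial>tri_law A B N)"
    by (rule nn_integral_cmult_indicator[OF E, symmetric])
  also have "\<dots> \<le> integral\<^sup>N (tri_law A B N) (\<Phi> N)"
  proof (rule nn_integral_mono)
    fix w
    show "V l * indicator ?E w \<le> \<Phi> N w"
      by (cases "w \<in> ?E") (auto simp: \<Phi>_def not_less)
  qed
  also have "\<dots> \<le> (\<integral>\<^sup>+ x. V (a - x) \<partial>A 1) + (\<Sum>k=1..<N. s k)"
    using main[of "N - 1"] N by simp
  finally show ?thesis .
qed

section \<open>The discretised Riccati equation\<close>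

lemma power_le_exp:
  fixes y :: real
  assumes "0 \<le> y" "n > 0"
  shows "y ^ n \<le> real n ^ n * exp y"
proof -
  have "(y / n) ^ n \<le> exp (y / n) ^ n"
  proof (rule power_mono)
    show "y / n \<le> exp (y / n)" using exp_ge_add_one_self[of "y / n"] by linarith
  qed (use assms in simp)
  also have "exp (y / n) ^ n = exp y" using assms by (simp add: exp_of_nat_mult[symmetric])
  finally show ?thesis using assms by (simp add: power_divide field_simps)
qed

lemma mult_sqrt_le_one:
  fixes \<epsilon> x :: real
  assumes "\<epsilon>\<^sup>2 * x \<le> 1" "x \<ge> 4"
  shows "\<epsilon> * sqrt x \<le> 1"
proof -
  have "(\<epsilon> * sqrt x)\<^sup>2 \<le> 1\<^sup>2" using assms by (simp add: power_mult_distrib)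
  then show ?thesis by (rule power2_le_imp_le) simp
qed

text \<open>In the variables \<open>d = R (1 + \<epsilon> p)\<close> and \<open>\<tau> = k \<epsilon>\<close> the pivot recursion is a discretisation of
  the Riccati equation \<open>p' = x + \<tau> - p\<^sup>2\<close> plus noise. For \<open>p\<^sup>2 \<le> \<tau> + x/4\<close> the drift beats the
  noise, for larger \<open>p\<close> the value \<open>exp (- \<theta> p)\<close> is negligible.\<close>
lemma riccati_step:
  fixes \<epsilon> \<theta> x \<tau> p :: real
  assumes e: "0 < \<epsilon>" "\<epsilon> \<le> 1" and th: "\<theta> \<ge> 1" and x: "x \<ge> 4" and ex: "\<epsilon>\<^sup>2 * x \<le> 1"
    and tau: "0 \<le> \<tau>" "\<tau> \<le> 1 / \<epsilon>\<^sup>2" and p: "p > - sqrt x / 2"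
  shows "exp (- \<theta> * (p / (1 + \<epsilon> * p) + x * \<epsilon> / 2 + \<tau> * \<epsilon> / (1 + \<epsilon> * p)))
    \<le> exp (- \<theta> * p) + 12 ^ 6 * \<epsilon> / (1 + \<tau>)\<^sup>2"
proof -
  define D where "D = 1 + \<epsilon> * p"
  note sx = mult_sqrt_le_one[OF ex x]
  have "\<epsilon> * p > \<epsilon> * (- sqrt x / 2)" using p e by (intro mult_strict_left_mono) auto
  then have D: "D > 1/2" using sx by (simp add: D_def)
  show ?thesis unfolding D_def[symmetric]
  proof (cases "p\<^sup>2 \<le> \<tau> + x / 4")
    case True
    have pd: "p - p / D = \<epsilon> * p\<^sup>2 / D"
    proof -
      have "p - p / D = p * (D - 1) / D" using D by (simp add: field_simps)
      then show ?thesis by (simp add: D_def power2_eq_square mult_ac)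
    qed
    \<comment> \<open>Up to the gain \<open>x * \<epsilon> / 2\<close>, one step lowers
      \<open>p\<close> by \<open>\<epsilon> * (p\<^sup>2 - \<tau>) / D\<close>. This is at most
      \<open>\<epsilon> * (x / 4) / D\<close>, and \<open>D > 1/2\<close> makes the gain at least as
      large.\<close>
    have "(p\<^sup>2 - \<tau>) / D \<le> (x / 4) / D" using True D by (intro divide_right_mono) auto
    also have "\<dots> \<le> (x / 4) / (1/2)" using D x by (intro divide_left_mono) auto
    finally have "\<epsilon> * ((p\<^sup>2 - \<tau>) / D) \<le> \<epsilon> * (x / 2)" using e by (intro mult_left_mono) auto
    then have "\<epsilon> * p\<^sup>2 / D - \<tau> * \<epsilon> / D \<le> x * \<epsilon> / 2" by (simp add: diff_divide_distrib algebra_simps)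
    then have "p \<le> p / D + x * \<epsilon> / 2 + \<tau> * \<epsilon> / D" using pd by linarith
    then have "\<theta> * p \<le> \<theta> * (p / D + x * \<epsilon> / 2 + \<tau> * \<epsilon> / D)" using th by (intro mult_left_mono) auto
    then have "exp (- \<theta> * (p / D + x * \<epsilon> / 2 + \<tau> * \<epsilon> / D)) \<le> exp (- \<theta> * p)" by simp
    moreover have "0 \<le> 12 ^ 6 * \<epsilon> / (1 + \<tau>)\<^sup>2" using e by simp
    ultimately show "exp (- \<theta> * (p / D + x * \<epsilon> / 2 + \<tau> * \<epsilon> / D)) \<le> exp (- \<theta> * p) + 12 ^ 6 * \<epsilon> / (1 + \<tau>)\<^sup>2"
      by linarith
  next
    case False
    then have p2: "1 + \<tau> \<le> p\<^sup>2" using x by simp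
    \<comment> \<open>Above the level \<open>- sqrt x / 2\<close>, a nonpositive \<open>p\<close>
      has square at most \<open>x / 4\<close> and belongs to the previous case.\<close>
    have p0: "p > 0"
    proof (rule ccontr)
      assume "\<not> p > 0"
      then have "\<bar>p\<bar> \<le> sqrt x / 2" using p by simp
      then have "p\<^sup>2 \<le> (sqrt x / 2)\<^sup>2" by (metis abs_ge_zero power2_abs power_mono)
      then show False using False tau x by (simp add: power_divide)
    qed
    have D1: "D \<ge> 1" using p0 e by (simp add: D_def)
    have E: "exp (- \<theta> * (p / D + x * \<epsilon> / 2 + \<tau> * \<epsilon> / D)) \<le> exp (- \<theta> * (p / D))"
    proof -
      have "0 \<le> \<theta> * (x * \<epsilon> / 2 + \<tau> * \<epsilon> / D)" using th x e tau D1 by (intro mult_nonneg_nonneg add_nonneg_nonneg) auto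
      then show ?thesis by (simp add: distrib_left)
    qed
    have "exp (- \<theta> * (p / D)) \<le> exp (- \<theta> * p) + 12 ^ 6 * \<epsilon> / (1 + \<tau>)\<^sup>2"
    proof (cases "\<epsilon> * p \<le> 1")
      case True
      then have D2: "D \<le> 2" by (simp add: D_def)
      define y z where "y = \<theta> * (p / D)" and "z = \<theta> * p"
      \<comment> \<open>The tangent line of the exponential shows that the possible increase is
        proportional to \<open>z - y\<close>, a quantity with a factor
        \<open>\<epsilon>\<close>.\<close>
      have "exp (- y) * (1 + (y - z)) \<le> exp (- y) * exp (y - z)"
        by (intro mult_left_mono exp_ge_add_one_self) simp
      also have "\<dots> = exp (- z)" by (simp add: exp_add[symmetric])
      finally have "exp (- y) - exp (- z) \<le> (z - y) * exp (- y)" by (simp add: algebra_simps)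
      also have "z - y = \<theta> * \<epsilon> * p\<^sup>2 / D"
      proof -
        have "z - y = \<theta> * (p * (D - 1)) / D" using D by (simp add: z_def y_def field_simps)
        then show ?thesis by (simp add: D_def power2_eq_square mult_ac)
      qed
      also have "\<theta> * \<epsilon> * p\<^sup>2 / D * exp (- y) \<le> \<theta> * \<epsilon> * p\<^sup>2 * exp (- (z / 2))"
      proof (rule mult_mono)
        show "\<theta> * \<epsilon> * p\<^sup>2 / D \<le> \<theta> * \<epsilon> * p\<^sup>2"
          using D1 th e divide_left_mono[of 1 D "\<theta> * \<epsilon> * p\<^sup>2"] by simp
        have "z / 2 \<le> z / D" using D1 D2 th p0 by (intro divide_left_mono) (auto simp: z_def)
        then show "exp (- y) \<le> exp (- (z / 2))" by (simp add: y_def z_def)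
      qed (use th e in auto)
      also have "\<dots> \<le> 12 ^ 6 * \<epsilon> / (1 + \<tau>)\<^sup>2"
      proof -
        \<comment> \<open>As \<open>\<theta> \<ge> 1\<close>, everything is dominated by the sixth
          power of \<open>z = \<theta> * p\<close>, which half of the exponential decay absorbs;
          12^6 arises as 2^6 * 6^6.\<close>
        have "(1 + \<tau>)\<^sup>2 \<le> (p\<^sup>2)\<^sup>2" using p2 tau by (intro power_mono) auto
        then have "\<theta> * p\<^sup>2 * (1 + \<tau>)\<^sup>2 \<le> \<theta> * p\<^sup>2 * (p\<^sup>2)\<^sup>2" using th by (intro mult_left_mono) auto
        also have "\<dots> = \<theta> * p ^ 6" by (simp flip: power_mult power_add add: mult.assoc)
        also have "\<dots> \<le> \<theta> ^ 6 * p ^ 6"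
          using th p0 self_le_power[of \<theta> 6] by (intro mult_right_mono) auto
        also have "\<dots> = 2 ^ 6 * (z / 2) ^ 6" by (simp add: z_def power_divide power_mult_distrib)
        also have "\<dots> \<le> 2 ^ 6 * (6 ^ 6 * exp (z / 2))"
          using power_le_exp[of "z / 2" 6] th p0 by (intro mult_left_mono) (auto simp: z_def)
        also have "\<dots> = 12 ^ 6 * exp (z / 2)" by simp
        finally have "\<theta> * p\<^sup>2 * (1 + \<tau>)\<^sup>2 \<le> 12 ^ 6 * exp (z / 2)" .
        then have "\<theta> * p\<^sup>2 * (1 + \<tau>)\<^sup>2 * exp (- (z/2)) \<le> 12 ^ 6 * exp (z / 2) * exp (- (z/2))"
          by (intro mult_right_mono) auto
        also have "\<dots> = 12 ^ 6" by (simp add: exp_add[symmetric] mult.assoc)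
        finally have "\<epsilon> * (\<theta> * p\<^sup>2 * (1 + \<tau>)\<^sup>2 * exp (- (z/2))) \<le> \<epsilon> * 12 ^ 6" using e by (intro mult_left_mono) auto
        then show ?thesis using tau by (simp add: pos_le_divide_eq mult_ac)
      qed
      finally show ?thesis by (simp add: y_def z_def)
    next
      case False
      have "1 / (2 * \<epsilon>) \<le> p / D" using False e D1 p0 by (simp add: D_def field_simps)
      also have "\<dots> \<le> \<theta> * (p / D)" using th p0 D1 mult_right_mono[of 1 \<theta> "p / D"] by simp
      finally have "exp (- \<theta> * (p / D)) \<le> exp (- (1 / (2 * \<epsilon>)))" by simp
      also have "\<dots> \<le> 12 ^ 6 * \<epsilon> / (1 + \<tau>)\<^sup>2"
      proof -
        have e2: "1 \<le> 1 / \<epsilon>\<^sup>2" using e by (simp add: power_le_one)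
        \<comment> \<open>The bound \<open>\<tau> \<le> 1 / \<epsilon>\<^sup>2\<close> turns the
          weight into at most four inverse powers of \<open>\<epsilon>\<close>. The exponential
          absorbs five, leaving the factor \<open>\<epsilon>\<close> needed for summation over the
          steps.\<close>
        have "(1 + \<tau>)\<^sup>2 \<le> (2 * (1 / \<epsilon>\<^sup>2))\<^sup>2" using e2 tau by (intro power_mono) linarith+
        also have "\<dots> = 4 * \<epsilon> * (1 / \<epsilon>) ^ 5" using e by (simp add: power_divide field_simps flip: power_mult power_Suc)
        also have "\<dots> = 4 * \<epsilon> * (2 ^ 5 * (1 / (2 * \<epsilon>)) ^ 5)" by (simp add: power_divide power_mult_distrib)
        also have "\<dots> \<le> 4 * \<epsilon> * (2 ^ 5 * (5 ^ 5 * exp (1 / (2 * \<epsilon>))))"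
          using e power_le_exp[of "1 / (2 * \<epsilon>)" 5] by (intro mult_left_mono) auto
        also have "\<dots> \<le> 12 ^ 6 * \<epsilon> * exp (1 / (2 * \<epsilon>))" using e by simp
        finally have "(1 + \<tau>)\<^sup>2 * exp (- (1 / (2 * \<epsilon>))) \<le> 12 ^ 6 * \<epsilon> * exp (1 / (2 * \<epsilon>)) * exp (- (1 / (2 * \<epsilon>)))"
          by (intro mult_right_mono) auto
        also have "\<dots> = 12 ^ 6 * \<epsilon>" by (simp add: exp_add[symmetric] mult.assoc)
        finally show ?thesis using tau by (simp add: pos_le_divide_eq mult.commute)
      qed
      also have "\<dots> \<le> exp (- \<theta> * p) + 12 ^ 6 * \<epsilon> / (1 + \<tau>)\<^sup>2" by simp
      finally show ?thesis .
    qed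
    then show "exp (- \<theta> * (p / D + x * \<epsilon> / 2 + \<tau> * \<epsilon> / D)) \<le> exp (- \<theta> * p) + 12 ^ 6 * \<epsilon> / (1 + \<tau>)\<^sup>2"
      using E by linarith
  qed
qed

text \<open>A Riemann sum with mesh \<open>\<epsilon>\<close> for the integral of 1 / (1 + \<tau>)^2
  over the half-line, compared with a telescoping sum. The bound is uniform in the mesh, so the
  errors of all steps stay bounded as the matrix grows.\<close>

lemma sum_inverse_square_le:
  fixes \<epsilon> :: real
  assumes "\<epsilon> > 0"
  shows "(\<Sum>k=1..<n. \<epsilon> / (1 + real k * \<epsilon>)\<^sup>2) \<le> 1"
proof -
  have "(\<Sum>k=1..<Suc n. \<epsilon> / (1 + real k * \<epsilon>)\<^sup>2) \<le> 1 - 1 / (1 + real n * \<epsilon>)" for n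
  proof (induction n)
    case (Suc n)
    have pos: "1 + real n * \<epsilon> > 0" "1 + real (Suc n) * \<epsilon> > 0" using assms by (auto intro: add_pos_nonneg)
    have "\<epsilon> / (1 + real (Suc n) * \<epsilon>)\<^sup>2 \<le> \<epsilon> / ((1 + real n * \<epsilon>) * (1 + real (Suc n) * \<epsilon>))"
      unfolding power2_eq_square using assms pos
      by (intro divide_left_mono mult_right_mono mult_pos_pos) auto
    also have "\<dots> = 1 / (1 + real n * \<epsilon>) - 1 / (1 + real (Suc n) * \<epsilon>)"
      using pos by (simp add: divide_simps) (simp add: algebra_simps)
    finally show ?case using Suc.IH by simp
  qed simp
  from this[of "n - 1"] have "n \<ge> 1 \<Longrightarrow> ?thesis"
    using assms by (simp add: order_trans[OF _ diff_le_eq[THEN iffD2]])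
  then show ?thesis by (cases n) auto
qed


text \<open>Here \<open>\<epsilon> = N powr (-1/3)\<close> and \<open>R = sqrt (\<beta> N)\<close>, so that \<open>R (2 + x \<epsilon>\<^sup>2)\<close> is \<open>sqrt \<beta>\<close> times the
  level \<open>2 sqrt N + x N powr (-1/6)\<close>.\<close>
lemma pivot_step_bound:
  fixes \<beta> \<epsilon> R x \<theta> :: real and N k :: nat
  defines "V \<equiv> \<lambda>d. ennreal (exp (- \<theta> * ((d / R - 1) / \<epsilon>)))"
  assumes b: "\<beta> > 0" and e: "0 < \<epsilon>" "\<epsilon> \<le> 1" and Ne: "real N * \<epsilon> ^ 3 = 1" and R: "R > 0" "R\<^sup>2 * \<epsilon> ^ 3 = \<beta>"
    and th: "\<theta> = \<beta> * x / 34" "\<theta> \<ge> 1" and x: "x \<ge> 4" and ex: "\<epsilon>\<^sup>2 * x \<le> 1"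
    and k: "k \<in> {1..<N}" and d: "d > R * (1 - \<epsilon> * sqrt x / 2)"
  shows "(\<integral>\<^sup>+ g. \<integral>\<^sup>+ y. V (R * (2 + x * \<epsilon>\<^sup>2) - g - y\<^sup>2 / d) \<partial>chi_measure (real (N - k) * \<beta>) \<partial>gauss2)
    \<le> V d + ennreal (12 ^ 6 * (\<epsilon> / (1 + real k * \<epsilon>)\<^sup>2))"
proof -
  define p where "p = (d / R - 1) / \<epsilon>"
  define D where "D = 1 + \<epsilon> * p"
  have dD: "d = R * D" using R e by (simp add: D_def p_def)
  note sx = mult_sqrt_le_one[OF ex x]
  have "D > 1 - \<epsilon> * sqrt x / 2" using d R unfolding dD by simp
  then have D: "D > 1/2" and "\<epsilon> * (- sqrt x / 2) < \<epsilon> * p" using sx by (auto simp: D_def)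
  then have p: "p > - sqrt x / 2" using mult_less_cancel_left_pos[OF e(1)] by blast
  define t where "t = real (N - k) * \<beta>"
  have t: "t > 0" using k b by (simp add: t_def)
  \<comment> \<open>The coefficient of the squared chi variable in the exponent of \<open>V\<close>.
    Its exponential moment needs \<open>2 * u < 1\<close>; the bound \<open>2 * u \<le> 1/2\<close>
    below also allows the expansion of the logarithm.\<close>
  define u where "u = \<theta> / (R * \<epsilon> * d)"
  have u_eq: "u = \<theta> * \<epsilon>\<^sup>2 / (\<beta> * D)"
  proof -
    have "R * \<epsilon> * d * \<epsilon>\<^sup>2 = \<beta> * D" unfolding dD R(2)[symmetric] by (simp add: power2_eq_square power3_eq_cube)
    then show ?thesis using e R D b unfolding u_def dD by (simp add: divide_eq_eq eq_divide_eq) (metis mult.commute mult.left_commute)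
  qed
  have u0: "u \<ge> 0" using e b th D by (simp add: u_eq)
  have u1: "2 * u \<le> 1/2"
  proof -
    have "u \<le> \<theta> * \<epsilon>\<^sup>2 / (\<beta> * (1/2))" unfolding u_eq using e b th D
      by (intro divide_left_mono mult_left_mono mult_pos_pos mult_nonneg_nonneg) auto
    also have "\<dots> = x * \<epsilon>\<^sup>2 / 17" using b by (simp add: th(1))
    also have "\<dots> \<le> 1/4" using ex by (simp add: mult.commute)
    finally show ?thesis by simp
  qed
  define c where "c = - \<theta> * (1 / \<epsilon> + x * \<epsilon>)"
  have Veq: "V (R * (2 + x * \<epsilon>\<^sup>2) - g - y\<^sup>2 / d) = ennreal (exp c) * (ennreal (exp (\<theta> / (R * \<epsilon>) * g)) * ennreal (exp (u * y\<^sup>2)))" for g y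
  proof -
    have "- \<theta> * (((R * (2 + x * \<epsilon>\<^sup>2) - g - y\<^sup>2 / d) / R - 1) / \<epsilon>) = c + (\<theta> / (R * \<epsilon>) * g + u * y\<^sup>2)"
      using R(1) e D unfolding c_def u_def dD by (simp add: field_simps power2_eq_square)
    then show ?thesis unfolding V_def by (simp only: exp_add ennreal_mult exp_ge_zero mult_nonneg_nonneg)
  qed
  have "(\<integral>\<^sup>+ g. \<integral>\<^sup>+ y. V (R * (2 + x * \<epsilon>\<^sup>2) - g - y\<^sup>2 / d) \<partial>chi_measure t \<partial>gauss2)
    = ennreal (exp c) * (ennreal (exp ((\<theta> / (R * \<epsilon>))\<^sup>2)) * ennreal ((1 - 2 * u) powr (- t/2)))"
    unfolding Veq using nn_integral_gauss2_exp[of "\<theta> / (R * \<epsilon>)"] nn_integral_chi_exp_square[OF t, of u] u1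
    by (simp add: nn_integral_cmult nn_integral_multc)
  also have "\<dots> \<le> ennreal (exp c) * (ennreal (exp (\<theta>\<^sup>2 * \<epsilon> / \<beta>)) * ennreal (exp (t/2 * (2 * u + 2 * (2 * u)\<^sup>2))))"
  proof -
    have "(\<theta> / (R * \<epsilon>))\<^sup>2 = \<theta>\<^sup>2 * \<epsilon> / \<beta>" unfolding R(2)[symmetric] using e R(1)
      by (simp add: power_divide field_simps power2_eq_square power3_eq_cube)
    moreover have "(1 - 2 * u) powr (- t/2) \<le> exp (t/2 * (2 * u + 2 * (2 * u)\<^sup>2))"
      by (rule one_minus_powr_neg_le) (use u0 u1 t in auto)
    ultimately show ?thesis by (simp only: mult_left_mono ennreal_leI zero_le)
  qed
  also have "\<dots> = ennreal (exp (c + \<theta>\<^sup>2 * \<epsilon> / \<beta> + t * u + 4 * t * u\<^sup>2))"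
  proof -
    have "c + \<theta>\<^sup>2 * \<epsilon> / \<beta> + t * u + 4 * t * u\<^sup>2 = c + (\<theta>\<^sup>2 * \<epsilon> / \<beta> + (t/2 * (2 * u + 2 * (2 * u)\<^sup>2)))"
      by (simp add: power2_eq_square algebra_simps)
    then show ?thesis by (simp only: exp_add ennreal_mult exp_ge_zero mult_nonneg_nonneg)
  qed
  also have "\<dots> \<le> ennreal (exp (- \<theta> * p) + 12 ^ 6 * \<epsilon> / (1 + real k * \<epsilon>)\<^sup>2)"
  proof (rule ennreal_leI)
    have N2: "real N * \<epsilon>\<^sup>2 = 1 / \<epsilon>"
      using Ne e by (simp add: power3_eq_cube power2_eq_square field_simps)
    have tu: "t * u = \<theta> * (1 / (\<epsilon> * D)) - \<theta> * (real k * \<epsilon> * \<epsilon> / D)"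
    proof -
      have "real (N - k) = real N - real k" using k by (simp add: of_nat_diff)
      then have "t * u = (\<beta> * ((real N - real k) * \<epsilon>\<^sup>2 * \<theta>)) / (\<beta> * D)"
        unfolding t_def u_eq by (simp add: mult_ac)
      also have "\<dots> = (real N - real k) * \<epsilon>\<^sup>2 * \<theta> / D"
        using b by (intro mult_divide_mult_cancel_left) simp
      finally have "t * u = (real N * \<epsilon>\<^sup>2 - real k * \<epsilon>\<^sup>2) * \<theta> / D"
        by (simp add: algebra_simps)
      then show ?thesis unfolding N2 using e D by (simp add: field_simps power2_eq_square)
    qed
    have tu2: "t * u\<^sup>2 \<le> 4 * \<theta>\<^sup>2 * \<epsilon> / \<beta>"
    proof -
      have "t * u\<^sup>2 \<le> (real N * \<beta>) * (\<theta> * \<epsilon>\<^sup>2 / (\<beta> * (1/2)))\<^sup>2"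
      proof (intro mult_mono power_mono)
        show "t \<le> real N * \<beta>" using b by (simp add: t_def)
        show "u \<le> \<theta> * \<epsilon>\<^sup>2 / (\<beta> * (1/2))" unfolding u_eq using e b th D
          by (intro divide_left_mono mult_left_mono mult_pos_pos mult_nonneg_nonneg) auto
      qed (use u0 b t in auto)
      also have "\<dots> = 4 * \<theta>\<^sup>2 * (real N * \<epsilon>\<^sup>2) * \<epsilon>\<^sup>2 / \<beta>" using b by (simp add: power2_eq_square field_simps)
      also have "\<dots> = 4 * \<theta>\<^sup>2 * \<epsilon> / \<beta>" unfolding N2 using e by (simp add: power2_eq_square)
      finally show ?thesis .
    qed
    \<comment> \<open>Origin of 34 in \<open>\<theta>\<close>: the Gaussian noise costs one unit of
      \<open>\<theta>\<^sup>2 * \<epsilon> / \<beta>\<close> and the second-order chi term at most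
      16, and these 17 units use up exactly half of the drift
      \<open>\<theta> * x * \<epsilon>\<close>. The other half remains for
      \<open>riccati_step\<close>.\<close>
    have q: "17 * (\<theta>\<^sup>2 * \<epsilon> / \<beta>) = \<theta> * (x * \<epsilon> / 2)" using b by (simp add: th(1) power2_eq_square)
    have "p / D = 1 / \<epsilon> - 1 / (\<epsilon> * D)"
      using e D by (simp add: field_simps) (simp add: D_def algebra_simps)
    then have pD: "\<theta> * (p / D) = \<theta> * (1 / \<epsilon>) - \<theta> * (1 / (\<epsilon> * D))" by (simp only: right_diff_distrib)
    have cc: "c = - (\<theta> * (1 / \<epsilon>)) - 2 * (\<theta> * (x * \<epsilon> / 2))" by (simp add: c_def distrib_left)
    have lin: "C + Q + T + 4 * U \<le> E" if "E = - P - X - W" "U \<le> 4 * Q" "C = - a - 2 * X" "T = A - W" "P = a - A" "17 * Q = X"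
      for C Q T U E P X W a A :: real using that by linarith
    have rhs: "- \<theta> * (p / D + x * \<epsilon> / 2 + real k * \<epsilon> * \<epsilon> / D)
        = - (\<theta> * (p / D)) - \<theta> * (x * \<epsilon> / 2) - \<theta> * (real k * \<epsilon> * \<epsilon> / D)"
      by (simp add: distrib_left)
    have tu3: "t * u\<^sup>2 \<le> 4 * (\<theta>\<^sup>2 * \<epsilon> / \<beta>)" using tu2 by (simp add: mult_ac)
    have "c + \<theta>\<^sup>2 * \<epsilon> / \<beta> + t * u + 4 * t * u\<^sup>2 \<le> - \<theta> * (p / D + x * \<epsilon> / 2 + real k * \<epsilon> * \<epsilon> / D)"
      unfolding mult.assoc[of 4 t] by (rule lin[OF rhs tu3 cc tu pD q])
    then have "exp (c + \<theta>\<^sup>2 * \<epsilon> / \<beta> + t * u + 4 * t * u\<^sup>2) \<le> exp (- \<theta> * (p / D + x * \<epsilon> / 2 + real k * \<epsilon> * \<epsilon> / D))"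
      by simp
    also have "\<dots> \<le> exp (- \<theta> * p) + 12 ^ 6 * \<epsilon> / (1 + real k * \<epsilon>)\<^sup>2"
      unfolding D_def
    proof (rule riccati_step[OF e th(2) x ex _ _ p])
      have "real k * \<epsilon> \<le> real N * \<epsilon>" using k e by (intro mult_right_mono) auto
      also have "\<dots> = 1 / \<epsilon>\<^sup>2" using Ne e by (simp add: power3_eq_cube power2_eq_square field_simps)
      finally show "real k * \<epsilon> \<le> 1 / \<epsilon>\<^sup>2" .
    qed (use e in simp)
    finally show "exp (c + \<theta>\<^sup>2 * \<epsilon> / \<beta> + t * u + 4 * t * u\<^sup>2) \<le> exp (- \<theta> * p) + 12 ^ 6 * \<epsilon> / (1 + real k * \<epsilon>)\<^sup>2" .
  qed
  also have "\<dots> = V d + ennreal (12 ^ 6 * (\<epsilon> / (1 + real k * \<epsilon>)\<^sup>2))"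
    using e by (subst ennreal_plus) (auto simp: V_def p_def)
  finally show ?thesis unfolding t_def .
qed

text \<open>The parameter 1 outside the range is a dummy that makes every member a probability
  measure, as the lemmas on \<open>tri_law\<close> demand of whole families.\<close>

definition chi_family :: "real \<Rightarrow> nat \<Rightarrow> nat \<Rightarrow> real measure" where
  "chi_family \<beta> N k = chi_measure (if k < N then real (N - k) * \<beta> else 1)"

lemma entries_law_eq_tri_law:
  "entries_law \<beta> N = tri_law (\<lambda>_. gauss2) (chi_family \<beta> N) N"
proof -
  have "PiM {1..N-1} (\<lambda>k. chi_measure (real (N - k) * \<beta>)) = PiM {1..N-1} (chi_family \<beta> N)"
    by (rule PiM_cong) (auto simp: chi_family_def)
  then show ?thesis by (simp add: entries_law_def tri_law_def)
qed

lemma prob_space_chi_family: "\<beta> > 0 \<Longrightarrow> prob_space (chi_family \<beta> N k)"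
  unfolding chi_family_def by (rule prob_space_chi_measure) auto

lemma sets_chi_family [measurable_cong, simp]: "sets (chi_family \<beta> N k) = sets borel"
  by (simp add: chi_family_def)

lemma prob_space_entries_law: "\<beta> > 0 \<Longrightarrow> prob_space (entries_law \<beta> N)"
  unfolding entries_law_eq_tri_law
  by (rule prob_space_tri_law) (auto intro: prob_space_gauss2 prob_space_chi_family)

text \<open>\<open>V\<close> starts with mean at most 1 and gains at most 12^6 from the step errors,
  whereas at the hitting level it is at least \<open>V l\<close>. The two bounds on \<open>x\<close>
  from below give the conditions of the step estimate, and \<open>x \<le> real N powr (2/3)\<close>
  says that \<open>\<epsilon>\<^sup>2 * x \<le> 1\<close>.\<close>

lemma entries_law_right_tail:
  fixes \<beta> x :: real and N :: nat
  assumes b: "\<beta> > 0" and x: "x \<ge> 4" "\<beta> * x \<ge> 34" and N: "N \<ge> 1" "x \<le> real N powr (2/3)"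
  shows "emeasure (entries_law \<beta> N) {w \<in> space (entries_law \<beta> N).
      lambda_max N (beta_matrix \<beta> (fst w) (snd w)) > 2 * sqrt N + x * real N powr (-1/6)}
    \<le> ennreal ((1 + 12 ^ 6) * exp (- (\<beta> / 68) * x * sqrt x))"
proof -
  define \<epsilon> R \<theta> where "\<epsilon> = real N powr (-1/3)" and "R = sqrt (\<beta> * N)" and "\<theta> = \<beta> * x / 34"
  \<comment> \<open>This is the pivot with \<open>p = - sqrt x / 2\<close>, below the stable
    equilibrium of the Riccati drift. There \<open>V\<close> equals exp (\<theta> sqrt x / 2), which
    explains 68 as twice 34.\<close>
  define l where "l = R * (1 - \<epsilon> * sqrt x / 2)"
  define a where "a = R * (2 + x * \<epsilon>\<^sup>2)"
  define V where "V d = ennreal (exp (- \<theta> * ((d / R - 1) / \<epsilon>)))" for d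
  have N0: "real N > 0" using N by simp
  have e0: "0 < \<epsilon>" using N by (simp add: \<epsilon>_def)
  have e1: "\<epsilon> \<le> 1" unfolding \<epsilon>_def using N powr_mono[of "-1/3" 0 "real N"] by simp
  have e3: "\<epsilon> ^ 3 = 1 / real N"
  proof -
    have "\<epsilon> ^ 3 = \<epsilon> powr 3" using e0 by simp
    also have "\<dots> = real N powr (-1)" unfolding \<epsilon>_def powr_powr by simp
    finally show ?thesis using N0 by (simp add: powr_minus_divide)
  qed
  have Ne: "real N * \<epsilon> ^ 3 = 1" using N by (simp add: e3)
  have R: "R > 0" "R\<^sup>2 = \<beta> * N" using b N by (auto simp: R_def)
  have R3: "R\<^sup>2 * \<epsilon> ^ 3 = \<beta>" using N by (simp add: R e3)
  have th: "\<theta> = \<beta> * x / 34" "\<theta> \<ge> 1" using x by (auto simp: \<theta>_def)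
  have e2: "\<epsilon>\<^sup>2 = real N powr (-2/3)"
  proof -
    have "\<epsilon>\<^sup>2 = \<epsilon> powr 2" using e0 by simp
    then show ?thesis unfolding \<epsilon>_def powr_powr by simp
  qed
  have ex: "\<epsilon>\<^sup>2 * x \<le> 1"
  proof -
    have "\<epsilon>\<^sup>2 * x \<le> \<epsilon>\<^sup>2 * real N powr (2/3)" using N by (intro mult_left_mono) auto
    also have "\<dots> = 1" unfolding e2 using N0 by (simp add: powr_add[symmetric])
    finally show ?thesis .
  qed
  let ?L = "tri_law (\<lambda>_. gauss2) (chi_family \<beta> N) N"
  let ?E = "{w \<in> space ?L. \<exists>j\<in>{1..N}. pivot a (fst w) (snd w) j \<le> l}"
  \<comment> \<open>An eigenvalue above the tested level forces some nonpositive pivot. Since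
    \<open>l\<close> is positive, such a pivot lies below \<open>l\<close>.\<close>
  have lp: "l > 0"
  proof -
    have "\<epsilon> * sqrt x \<le> 1" by (rule mult_sqrt_le_one[OF ex x(1)])
    then show ?thesis using R by (simp add: l_def)
  qed
  have "V l * emeasure ?L ?E \<le> (\<integral>\<^sup>+ g. V (a - g) \<partial>gauss2) + (\<Sum>k=1..<N. ennreal (12 ^ 6 * (\<epsilon> / (1 + real k * \<epsilon>)\<^sup>2)))"
  proof (rule pivot_hitting_bound)
    fix k d assume k: "k \<in> {1..<N}" and d: "l < d"
    show "(\<integral>\<^sup>+ x. \<integral>\<^sup>+ y. V (a - x - y\<^sup>2 / d) \<partial>chi_family \<beta> N k \<partial>gauss2) \<le> V d + ennreal (12 ^ 6 * (\<epsilon> / (1 + real k * \<epsilon>)\<^sup>2))"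
      using pivot_step_bound[OF b e0 e1 Ne R(1) R3 th x(1) ex k, of d] d k
      by (simp add: V_def a_def l_def chi_family_def)
  next
    show "antimono V" unfolding V_def
      using e0 R th by (intro antimonoI ennreal_leI) (auto intro!: mult_left_mono divide_right_mono)
    show "V \<in> borel_measurable borel" unfolding V_def by measurable
  qed (use N b in \<open>auto intro: prob_space_gauss2 prob_space_chi_family\<close>)
  also have "\<dots> \<le> 1 + ennreal (12 ^ 6)"
  proof (rule add_mono)
    have "V (a - g) = ennreal (exp (- \<theta> * (1 / \<epsilon> + x * \<epsilon>))) * ennreal (exp (\<theta> / (R * \<epsilon>) * g))" for g
    proof -
      have "- \<theta> * (((a - g) / R - 1) / \<epsilon>) = - \<theta> * (1 / \<epsilon> + x * \<epsilon>) + \<theta> / (R * \<epsilon>) * g"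
        using R(1) e0 unfolding a_def by (simp add: field_simps power2_eq_square)
      then show ?thesis unfolding V_def by (simp only: exp_add ennreal_mult exp_ge_zero)
    qed
    then have "(\<integral>\<^sup>+ g. V (a - g) \<partial>gauss2) = ennreal (exp (- \<theta> * (1 / \<epsilon> + x * \<epsilon>))) * ennreal (exp ((\<theta> / (R * \<epsilon>))\<^sup>2))"
      using nn_integral_gauss2_exp[of "\<theta> / (R * \<epsilon>)"] by (simp add: nn_integral_cmult)
    also have "\<dots> = ennreal (exp (- \<theta> * (1 / \<epsilon> + x * \<epsilon>) + (\<theta> / (R * \<epsilon>))\<^sup>2))"
      by (simp only: exp_add ennreal_mult exp_ge_zero)
    also have "\<dots> \<le> 1"
    proof -
      have "(\<theta> / (R * \<epsilon>))\<^sup>2 = \<theta>\<^sup>2 * \<epsilon> / \<beta>" unfolding R3[symmetric] using e0 R(1)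
        by (simp add: power_divide field_simps power2_eq_square power3_eq_cube)
      also have "\<dots> = \<theta> * (x * \<epsilon>) / 34" using b by (simp add: th(1) power2_eq_square)
      also have "\<dots> \<le> \<theta> * (1 / \<epsilon> + x * \<epsilon>)"
      proof -
        have "0 \<le> \<theta> * (x * \<epsilon>)" "0 \<le> \<theta> * (1 / \<epsilon>)" using th x e0 by auto
        then show ?thesis unfolding distrib_left by linarith
      qed
      finally show ?thesis by simp
    qed
    finally show "(\<integral>\<^sup>+ g. V (a - g) \<partial>gauss2) \<le> 1" .
    have "(\<Sum>k=1..<N. ennreal (12 ^ 6 * (\<epsilon> / (1 + real k * \<epsilon>)\<^sup>2))) = ennreal (12 ^ 6 * (\<Sum>k=1..<N. \<epsilon> / (1 + real k * \<epsilon>)\<^sup>2))"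
      using e0 unfolding sum_distrib_left by (intro sum_ennreal) auto
    also have "\<dots> \<le> ennreal (12 ^ 6 * 1)"
      using sum_inverse_square_le[OF e0, of N] by (intro ennreal_leI mult_left_mono) auto
    finally show "(\<Sum>k=1..<N. ennreal (12 ^ 6 * (\<epsilon> / (1 + real k * \<epsilon>)\<^sup>2))) \<le> ennreal (12 ^ 6)" by simp
  qed
  also have "\<dots> = ennreal (1 + 12 ^ 6)" by (subst ennreal_plus) auto
  finally have 1: "V l * emeasure ?L ?E \<le> ennreal (1 + 12 ^ 6)" .
  have Vl: "V l = ennreal (exp (\<beta> / 68 * x * sqrt x))"
    using R e0 by (simp add: V_def l_def \<theta>_def field_simps)
  have 2: "emeasure ?L ?E \<le> ennreal ((1 + 12 ^ 6) * exp (- (\<beta> / 68) * x * sqrt x))"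
  proof -
    have "emeasure ?L ?E = ennreal (exp (- (\<beta> / 68) * x * sqrt x)) * (V l * emeasure ?L ?E)"
      unfolding Vl mult.assoc[symmetric] by (simp add: ennreal_mult[symmetric] exp_add[symmetric])
    also have "\<dots> \<le> ennreal (exp (- (\<beta> / 68) * x * sqrt x)) * ennreal (1 + 12 ^ 6)"
      by (rule mult_left_mono[OF 1]) simp
    also have "\<dots> = ennreal ((1 + 12 ^ 6) * exp (- (\<beta> / 68) * x * sqrt x))"
      by (subst ennreal_mult[symmetric]) (auto simp: mult.commute)
    finally show ?thesis .
  qed
  have a_eq: "a = sqrt \<beta> * (2 * sqrt N + x * real N powr (-1/6))"
  proof -
    have "sqrt N * \<epsilon>\<^sup>2 = real N powr (-1/6)"
      unfolding e2 using N0 by (simp add: powr_half_sqrt[symmetric] powr_add[symmetric])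
    then show ?thesis unfolding a_def R_def by (simp add: real_sqrt_mult algebra_simps)
  qed
  have sub: "{w \<in> space ?L. lambda_max N (beta_matrix \<beta> (fst w) (snd w)) > 2 * sqrt N + x * real N powr (-1/6)} \<subseteq> ?E"
  proof
    fix w assume "w \<in> {w \<in> space ?L. lambda_max N (beta_matrix \<beta> (fst w) (snd w)) > 2 * sqrt N + x * real N powr (-1/6)}"
    then have w: "w \<in> space ?L" and "lambda_max N (beta_matrix \<beta> (fst w) (snd w)) > 2 * sqrt N + x * real N powr (-1/6)"
      by auto
    then have "\<not> (\<forall>j\<in>{1..N}. pivot a (fst w) (snd w) j > 0)"
      using pivots_pos_imp_lambda_max_le[OF b N(1), of "2 * sqrt N + x * real N powr (-1/6)" "fst w" "snd w"]
      unfolding a_eq by (meson not_le)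
    then show "w \<in> ?E" using lp w by (force simp: not_less)
  qed
  have "?E \<in> sets ?L"
  proof -
    have "?E = (\<Union>j\<in>{1..N}. {w \<in> space ?L. pivot a (fst w) (snd w) j \<le> l})" by auto
    also have "\<dots> \<in> sets ?L"
      by (intro sets.finite_UN borel_measurable_le measurable_pivot) auto
    finally show ?thesis .
  qed
  from order_trans[OF emeasure_mono[OF sub this] 2] show ?thesis
    unfolding entries_law_eq_tri_law .
qed

section \<open>Tent-shaped trial vector\<close>

text \<open>The form is linear in the independent entries, so its exponential moment factorises.
  Fourth powers of \<open>v\<close> appear since a diagonal entry carries the coefficient
  \<open>r * (v k)\<^sup>2\<close> and its moment squares it.\<close>

lemma nn_integral_tri_law_exp:
  assumes B: "\<And>k. prob_space (B k)" "\<And>k. sets (B k) = sets borel"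
  shows "(\<integral>\<^sup>+ w. ennreal (exp (r * ((\<Sum>k=1..N. fst w k * (v k)\<^sup>2) + 2 * (\<Sum>k=1..N-1. snd w k * v k * v (Suc k)))))
      \<partial>tri_law (\<lambda>_. gauss2) B N)
    = ennreal (exp (r\<^sup>2 * (\<Sum>k=1..N. v k ^ 4))) * (\<Prod>k=1..N-1. \<integral>\<^sup>+ y. ennreal (exp (2 * r * v k * v (Suc k) * y)) \<partial>B k)"
proof -
  let ?P = "PiM {1..N} (\<lambda>_. gauss2)" and ?Q = "PiM {1..N-1} B"
  interpret A: product_sigma_finite "\<lambda>_::nat. gauss2"
    by (rule product_sigma_finite.intro) (rule prob_space_imp_sigma_finite[OF prob_space_gauss2])
  interpret B: product_sigma_finite B
    by (rule product_sigma_finite.intro) (rule prob_space_imp_sigma_finite[OF B(1)])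
  interpret Q: prob_space ?Q by (rule prob_space_PiM) (rule B)
  let ?f = "\<lambda>g. ennreal (exp (r * (\<Sum>k=1..N. g k * (v k)\<^sup>2)))"
  let ?h = "\<lambda>c. ennreal (exp (r * (2 * (\<Sum>k=1..N-1. c k * v k * v (Suc k)))))"
  have mf: "?f \<in> borel_measurable ?P"
  proof -
    have c: "(\<lambda>g. g k) \<in> borel_measurable ?P" if "k \<in> {1..N}" for k
      using measurable_component_singleton[OF that, of "\<lambda>_. gauss2"] by (simp cong: measurable_cong_sets)
    have "(\<lambda>g. \<Sum>k=1..N. g k * (v k)\<^sup>2) \<in> borel_measurable ?P"
      by (intro borel_measurable_sum borel_measurable_times c) auto
    then show ?thesis by measurable
  qed
  have mh: "?h \<in> borel_measurable ?Q"
  proof -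
    have c: "(\<lambda>g. g k) \<in> borel_measurable ?Q" if "k \<in> {1..N-1}" for k
      using measurable_component_singleton[OF that, of B] B(2)[of k] by (simp cong: measurable_cong_sets)
    have "(\<lambda>c. \<Sum>k=1..N-1. c k * v k * v (Suc k)) \<in> borel_measurable ?Q"
      by (intro borel_measurable_sum borel_measurable_times c) auto
    then show ?thesis by measurable
  qed
  have "(\<integral>\<^sup>+ w. ennreal (exp (r * ((\<Sum>k=1..N. fst w k * (v k)\<^sup>2) + 2 * (\<Sum>k=1..N-1. snd w k * v k * v (Suc k)))))
      \<partial>tri_law (\<lambda>_. gauss2) B N) = (\<integral>\<^sup>+ w. ?f (fst w) * ?h (snd w) \<partial>(?P \<Otimes>\<^sub>M ?Q))"
    unfolding tri_law_def by (simp add: distrib_left exp_add ennreal_mult)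
  also have "\<dots> = (\<integral>\<^sup>+ g. \<integral>\<^sup>+ c. ?f g * ?h c \<partial>?Q \<partial>?P)"
  proof -
    have "(\<lambda>w. ?f (fst w) * ?h (snd w)) \<in> borel_measurable (?P \<Otimes>\<^sub>M ?Q)"
      by (intro borel_measurable_times_ennreal measurable_compose[OF measurable_fst mf] measurable_compose[OF measurable_snd mh])
    from Q.nn_integral_fst[OF this, symmetric] show ?thesis by (simp only: fst_conv snd_conv)
  qed
  also have "\<dots> = (\<integral>\<^sup>+ g. ?f g \<partial>?P) * (\<integral>\<^sup>+ c. ?h c \<partial>?Q)"
    using mf mh by (simp add: nn_integral_cmult nn_integral_multc)
  also have "(\<integral>\<^sup>+ g. ?f g \<partial>?P) = (\<integral>\<^sup>+ g. (\<Prod>k=1..N. ennreal (exp (r * (v k)\<^sup>2 * g k))) \<partial>?P)"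
    by (simp add: sum_distrib_left exp_sum prod_ennreal mult_ac)
  also have "\<dots> = (\<Prod>k=1..N. \<integral>\<^sup>+ x. ennreal (exp (r * (v k)\<^sup>2 * x)) \<partial>gauss2)"
    by (rule A.product_nn_integral_prod) auto
  also have "\<dots> = ennreal (exp (r\<^sup>2 * (\<Sum>k=1..N. v k ^ 4)))"
    by (simp add: nn_integral_gauss2_exp sum_distrib_left exp_sum prod_ennreal power_mult_distrib flip: power_mult)
  also have "(\<integral>\<^sup>+ c. ?h c \<partial>?Q) = (\<integral>\<^sup>+ c. (\<Prod>k=1..N-1. ennreal (exp (2 * r * v k * v (Suc k) * c k))) \<partial>?Q)"
    by (simp add: sum_distrib_left exp_sum prod_ennreal mult_ac)
  also have "\<dots> = (\<Prod>k=1..N-1. \<integral>\<^sup>+ y. ennreal (exp (2 * r * v k * v (Suc k) * y)) \<partial>B k)"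
    by (rule B.product_nn_integral_prod) (use B(2) in \<open>auto cong: measurable_cong_sets\<close>)
  finally show ?thesis .
qed

text \<open>The tent rises with slope 1 to height \<open>m\<close> at \<open>k = m\<close> and falls
  back to 0 at \<open>2 * m\<close>; truncated subtraction on naturals makes it vanish from there
  on.\<close>

definition hat :: "nat \<Rightarrow> nat \<Rightarrow> real" where
  "hat m k = real (min k (2 * m - k))"

lemma hat_nonneg [simp]: "hat m k \<ge> 0" by (simp add: hat_def)
lemma hat_le: "hat m k \<le> real m"
proof -
  have "min k (2 * m - k) \<le> m" by (simp add: min_def) arith
  then show ?thesis by (simp add: hat_def)
qed

lemma hat_eq_0: "2 * m \<le> k \<Longrightarrow> hat m k = 0" by (simp add: hat_def)
lemma hat_0 [simp]: "hat m 0 = 0" by (simp add: hat_def)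

lemma hat_diff: "(hat m (Suc k) - hat m k)\<^sup>2 \<le> (if k < 2 * m then 1 else 0)"
proof (cases "k < 2 * m")
  case True
  have "\<bar>hat m (Suc k) - hat m k\<bar> \<le> 1"
    using True by (auto simp: hat_def min_def of_nat_diff abs_le_iff)
  then show ?thesis using True by (simp add: abs_square_le_1)
qed (simp add: hat_eq_0)

lemma sum_squares_ge: "real m ^ 3 / 3 \<le> (\<Sum>k=1..m. (real k)\<^sup>2)"
proof (induction m)
  case (Suc m)
  have "real (Suc m) ^ 3 / 3 \<le> real m ^ 3 / 3 + (real (Suc m))\<^sup>2"
    by (simp add: power2_eq_square power3_eq_cube algebra_simps)
  then show ?case using Suc by simp
qed simp

context
  fixes m N :: nat
  assumes mN: "2 * m \<le> N"
begin

lemma hat_sqnorm_ge: "real m ^ 3 / 3 \<le> sqnorm N (hat m)"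
proof -
  have "(\<Sum>k=1..m. (real k)\<^sup>2) = (\<Sum>k=1..m. (hat m k)\<^sup>2)"
    by (rule sum.cong) (auto simp: hat_def min_def)
  also have "\<dots> \<le> sqnorm N (hat m)"
    unfolding sqnorm_def by (rule sum_mono2) (use mN in auto)
  finally show ?thesis using sum_squares_ge[of m] by linarith
qed

lemma hat_sum4_le: "(\<Sum>k=1..N. hat m k ^ 4) \<le> (real m)\<^sup>2 * sqnorm N (hat m)"
proof -
  have "hat m k ^ 4 \<le> (real m)\<^sup>2 * (hat m k)\<^sup>2" for k
  proof -
    have "(hat m k)\<^sup>2 * (hat m k)\<^sup>2 \<le> (real m)\<^sup>2 * (hat m k)\<^sup>2"
      by (intro mult_right_mono power_mono hat_le) auto
    then show ?thesis by (simp flip: power_add)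
  qed
  then show ?thesis unfolding sqnorm_def sum_distrib_left by (intro sum_mono)
qed

text \<open>Cauchy-Schwarz against the constant 1 on a support of at most \<open>2 * m\<close>
  points.\<close>

lemma hat_sum4_ge: "(sqnorm N (hat m))\<^sup>2 \<le> 2 * real m * (\<Sum>k=1..N. hat m k ^ 4)"
proof -
  have restr: "(\<Sum>k=1..N. f (hat m k)) = (\<Sum>k=1..2*m. f (hat m k))" if "f 0 = 0" for f :: "real \<Rightarrow> real"
    by (rule sum.mono_neutral_right) (use mN that in \<open>auto simp: hat_eq_0\<close>)
  have "sqnorm N (hat m) = (\<Sum>k=1..2*m. 1 * (hat m k)\<^sup>2)"
    unfolding sqnorm_def using restr[of "\<lambda>x. x\<^sup>2"] by simp
  then have "(sqnorm N (hat m))\<^sup>2 \<le> (\<Sum>k=1..2*m. 1\<^sup>2) * (\<Sum>k=1..2*m. ((hat m k)\<^sup>2)\<^sup>2)"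
    using Cauchy_Schwarz_ineq_sum[of "\<lambda>_. 1" "\<lambda>k. (hat m k)\<^sup>2" "{1..2*m}"] by simp
  also have "\<dots> = 2 * real m * (\<Sum>k=1..N. hat m k ^ 4)"
    using restr[of "\<lambda>x. x ^ 4"] by (simp flip: power_mult)
  finally show ?thesis .
qed

text \<open>Twice the sum of neighbouring products is twice the squared norm minus the discrete
  Dirichlet energy; boundary terms vanish with the tent, and slopes of size at most 1 bound the
  energy by \<open>2 * m\<close>.\<close>

lemma hat_products:
  shows "sqnorm N (hat m) - real m \<le> (\<Sum>k=1..N-1. hat m k * hat m (Suc k))"
    and "(\<Sum>k=1..N-1. hat m k * hat m (Suc k)) \<le> sqnorm N (hat m)"
proof -
  let ?v = "hat m" and ?P = "\<Sum>k=1..N-1. hat m k * hat m (Suc k)"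
  have z: "?v N = 0" using mN by (rule hat_eq_0)
  have S1: "(\<Sum>k<N. (?v (Suc k))\<^sup>2) = sqnorm N ?v"
    unfolding sqnorm_def using sum.atLeast1_atMost_eq[of "\<lambda>k. (?v k)\<^sup>2" N] by simp
  have S0: "(\<Sum>k<N. (?v k)\<^sup>2) = sqnorm N ?v"
  proof -
    have "(\<Sum>k<Suc N. (?v k)\<^sup>2) = (?v 0)\<^sup>2 + (\<Sum>k<N. (?v (Suc k))\<^sup>2)" by (rule sum.lessThan_Suc_shift)
    then show ?thesis using z S1 by simp
  qed
  have PP: "(\<Sum>k<N. ?v k * ?v (Suc k)) = ?P"
  proof (rule sum.mono_neutral_right)
    show "{1..N-1} \<subseteq> {..<N}" using mN by auto
    show "\<forall>i\<in>{..<N} - {1..N-1}. ?v i * ?v (Suc i) = 0"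
    proof
      fix i assume "i \<in> {..<N} - {1..N-1}"
      then have "i = 0" by auto
      then show "?v i * ?v (Suc i) = 0" by simp
    qed
  qed simp
  have "(\<Sum>k<N. (?v (Suc k) - ?v k)\<^sup>2) = (\<Sum>k<N. (?v (Suc k))\<^sup>2) + (\<Sum>k<N. (?v k)\<^sup>2) - 2 * (\<Sum>k<N. ?v k * ?v (Suc k))"
    by (simp add: power2_diff sum.distrib sum_subtractf sum_distrib_left mult_ac)
  then have eq: "(\<Sum>k<N. (?v (Suc k) - ?v k)\<^sup>2) = 2 * sqnorm N ?v - 2 * ?P" unfolding S1 S0 PP by simp
  have "(\<Sum>k<N. (?v (Suc k) - ?v k)\<^sup>2) \<le> (\<Sum>k<N. if k < 2 * m then 1 else 0)"
    by (intro sum_mono hat_diff)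
  also have "\<dots> = (\<Sum>k<2*m. 1)"
    by (rule sum.mono_neutral_cong_right) (use mN in auto)
  finally show "sqnorm N ?v - real m \<le> ?P" using eq by simp
  have "0 \<le> (\<Sum>k<N. (?v (Suc k) - ?v k)\<^sup>2)" by (simp add: sum_nonneg)
  then show "?P \<le> sqnorm N ?v" using eq by simp
qed

end


text \<open>Below, \<open>Q\<close> bounds the fluctuations and \<open>\<Delta>\<close> the bias of the rescaled Rayleigh quotient \<open>Z\<close>
  of the tent of half-width \<open>m\<close>. For \<open>m\<close> comparable to \<open>a L\<close> both stay bounded in \<open>N\<close>.\<close>
locale trial =
  fixes \<beta> s :: real and m N :: nat
  assumes b: "\<beta> > 0" and s: "s \<ge> 0" and m: "m \<ge> 1" and mN: "4 * m \<le> N" and Nb: "32 \<le> \<beta> * N"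
    and small: "6 * s * real N powr (1/6) / (sqrt \<beta> * m) \<le> 1"
begin

definition "S = sqnorm N (hat m)"
definition "L = real N powr (1/3)"
text \<open>The factor of the unscaled random quadratic form in \<open>s * Z \<omega>\<close>;
  accordingly \<open>w k\<close> multiplies the off-diagonal entry number \<open>k\<close>.\<close>

definition "r = s * real N powr (1/6) / (sqrt \<beta> * S)"
definition "w k = 2 * r * hat m k * hat m (Suc k)"
definition "t k = real (N - k) * \<beta>"
text \<open>The constant splits as 3 + 12: fourth powers of the tent from the Gaussian diagonal, and
  squares of \<open>w\<close> from the chi entries.\<close>

definition "Q = 15 * s\<^sup>2 * L / (\<beta> * m)"
text \<open>In this order: the decrease of the chi parameters along the tent, the correction
  \<open>2 * w / sqrt t\<close> of the chi moments, and the Dirichlet energy of the tent.\<close>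

definition "\<Delta> = 4 * s * m / L + 6 * s / (\<beta> * L) + 6 * s * L\<^sup>2 / (real m)\<^sup>2"

definition Z :: "(nat \<Rightarrow> real) \<times> (nat \<Rightarrow> real) \<Rightarrow> real" where
  "Z \<omega> = real N powr (1/6) * (quad_form N (beta_matrix \<beta> (fst \<omega>) (snd \<omega>)) (hat m) / S - 2 * sqrt N)"

lemma N1: "N \<ge> 1" and N0: "real N > 0" using m mN by auto

lemma S_ge: "real m ^ 3 / 3 \<le> S"
  unfolding S_def by (rule hat_sqnorm_ge) (use mN in simp)

lemma S_pos: "S > 0"
  using S_ge m by (smt (verit, best) divide_pos_pos of_nat_0_less_iff zero_less_power less_le_trans zero_less_one)

lemma Z_le: "Z \<omega> \<le> real N powr (1/6) * (lambda_max N (beta_matrix \<beta> (fst \<omega>) (snd \<omega>)) - 2 * sqrt N)"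
proof -
  have "quad_form N (beta_matrix \<beta> (fst \<omega>) (snd \<omega>)) (hat m) / S \<le> lambda_max N (beta_matrix \<beta> (fst \<omega>) (snd \<omega>))"
    using quad_form_le_lambda_max[of N "beta_matrix \<beta> (fst \<omega>) (snd \<omega>)" "hat m", OF N1 beta_matrix_sym] S_pos
    by (simp add: divide_le_eq S_def)
  then show ?thesis unfolding Z_def by (intro mult_left_mono diff_right_mono) auto
qed

lemma r_nonneg: "r \<ge> 0" using s b S_pos by (simp add: r_def)
lemma w_nonneg: "w k \<ge> 0" using r_nonneg by (simp add: w_def)

lemma pow_L: "real N powr (1/6) * real N powr (1/6) = L" "L * L * L = real N" "L > 0"
  "real N powr (1/6) * sqrt N = L\<^sup>2"
proof -
  show "real N powr (1/6) * real N powr (1/6) = L" unfolding L_def by (simp add: powr_add[symmetric])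
  show "L * L * L = real N" using N0 unfolding L_def by (simp add: powr_add[symmetric])
  show "L > 0" using N0 by (simp add: L_def)
  show "real N powr (1/6) * sqrt N = L\<^sup>2" using N0
    by (simp add: L_def powr_half_sqrt[symmetric] powr_add[symmetric] power2_eq_square)
qed

lemma rS: "sqrt \<beta> * r * S = s * real N powr (1/6)"
  using S_pos b by (simp add: r_def)

lemma r2S: "r\<^sup>2 * S\<^sup>2 = s\<^sup>2 * L / \<beta>"
proof -
  have "(sqrt \<beta> * r * S)\<^sup>2 = (s * real N powr (1/6))\<^sup>2" by (simp only: rS)
  then have "\<beta> * (r\<^sup>2 * S\<^sup>2) = s\<^sup>2 * (real N powr (1/6) * real N powr (1/6))"
    using b by (simp add: power_mult_distrib power2_eq_square[of "_ powr _"] mult_ac)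
  then show ?thesis unfolding pow_L using b by (simp add: field_simps)
qed

lemma r2mS: "r\<^sup>2 * ((real m)\<^sup>2 * S) \<le> 3 * s\<^sup>2 * L / (\<beta> * m)"
proof -
  have "(real m)\<^sup>2 * S \<le> (3 / real m) * S\<^sup>2"
  proof -
    have "(real m)\<^sup>2 \<le> (3 / real m) * S" using S_ge m by (simp add: field_simps power2_eq_square power3_eq_cube)
    then show ?thesis using S_pos mult_right_mono[of "(real m)\<^sup>2" "3 / real m * S" S] by (simp add: power2_eq_square mult_ac)
  qed
  then have "r\<^sup>2 * ((real m)\<^sup>2 * S) \<le> r\<^sup>2 * ((3 / real m) * S\<^sup>2)" by (rule mult_left_mono) simp
  also have "\<dots> = (3 / real m) * (r\<^sup>2 * S\<^sup>2)" by simp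
  also have "\<dots> = 3 * s\<^sup>2 * L / (\<beta> * m)" unfolding r2S by (simp add: mult_ac)
  finally show ?thesis .
qed

lemma sum4_le: "r\<^sup>2 * (\<Sum>k=1..N. hat m k ^ 4) \<le> 3 * s\<^sup>2 * L / (\<beta> * m)"
proof -
  have "r\<^sup>2 * (\<Sum>k=1..N. hat m k ^ 4) \<le> r\<^sup>2 * ((real m)\<^sup>2 * S)"
    unfolding S_def using mN by (intro mult_left_mono hat_sum4_le) auto
  then show ?thesis using r2mS by linarith
qed

lemma sum4_ge: "s\<^sup>2 * L / (2 * \<beta> * m) \<le> r\<^sup>2 * (\<Sum>k=1..N. hat m k ^ 4)"
proof -
  have "r\<^sup>2 * S\<^sup>2 \<le> r\<^sup>2 * (2 * real m * (\<Sum>k=1..N. hat m k ^ 4))"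
    unfolding S_def using mN by (intro mult_left_mono hat_sum4_ge) auto
  then have "s\<^sup>2 * L / \<beta> \<le> r\<^sup>2 * (2 * real m * (\<Sum>k=1..N. hat m k ^ 4))" unfolding r2S .
  then have "s\<^sup>2 * L / \<beta> / (2 * real m) \<le> r\<^sup>2 * (2 * real m * (\<Sum>k=1..N. hat m k ^ 4)) / (2 * real m)"
    by (rule divide_right_mono) simp
  also have "\<dots> = r\<^sup>2 * (\<Sum>k=1..N. hat m k ^ 4)" using m by simp
  also have "s\<^sup>2 * L / \<beta> / (2 * real m) = s\<^sup>2 * L / (2 * \<beta> * m)" by (simp add: mult_ac)
  finally show ?thesis .
qed

lemma hat_mult_le: "hat m k * hat m (Suc k) \<le> (real m)\<^sup>2"
  unfolding power2_eq_square by (intro mult_mono hat_le) auto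

lemma w_le_square: "w k \<le> 2 * r * (real m)\<^sup>2"
  using mult_left_mono[OF hat_mult_le[of k], of "2 * r"] r_nonneg by (simp add: w_def mult_ac)

text \<open>The cubic lower bound on \<open>S\<close> gives
  \<open>w k \<le> 6 * (r * S) / real m\<close>, and the locale assumption \<open>small\<close> says
  exactly that this is at most 1.\<close>

lemma w_le: "w k \<le> 1"
proof -
  have "w k \<le> 2 * r * (real m)\<^sup>2" by (rule w_le_square)
  also have "\<dots> \<le> 2 * r * (3 / real m * S)"
    using S_ge m r_nonneg by (intro mult_left_mono) (auto simp: field_simps power2_eq_square power3_eq_cube)
  also have "\<dots> = 6 * (r * S) / real m" by simp
  also have "r * S = s * real N powr (1/6) / sqrt \<beta>" using S_pos by (simp add: r_def)
  finally have "w k \<le> 6 * (s * real N powr (1/6) / sqrt \<beta>) / real m" .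
  also have "\<dots> \<le> 1" using small by (simp add: mult_ac)
  finally show ?thesis .
qed

lemma sum_w: "2 * r * (S - m) \<le> (\<Sum>k=1..N-1. w k)" "(\<Sum>k=1..N-1. w k) \<le> 2 * r * S"
proof -
  have eq: "(\<Sum>k=1..N-1. w k) = 2 * r * (\<Sum>k=1..N-1. hat m k * hat m (Suc k))"
    by (simp add: w_def sum_distrib_left mult_ac)
  have "2 * m \<le> N" using mN by simp
  note hp = hat_products[OF this]
  show "2 * r * (S - m) \<le> (\<Sum>k=1..N-1. w k)" "(\<Sum>k=1..N-1. w k) \<le> 2 * r * S"
    unfolding eq S_def by (intro mult_left_mono hp; use r_nonneg in simp)+
qed

lemma sum_w2: "(\<Sum>k=1..N-1. (w k)\<^sup>2) \<le> 12 * s\<^sup>2 * L / (\<beta> * m)"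
proof -
  have "(\<Sum>k=1..N-1. (w k)\<^sup>2) \<le> (\<Sum>k=1..N-1. (2 * r * (real m)\<^sup>2) * w k)"
  proof (rule sum_mono)
    fix k
    show "(w k)\<^sup>2 \<le> (2 * r * (real m)\<^sup>2) * w k"
      unfolding power2_eq_square[of "w k"] by (intro mult_right_mono w_nonneg w_le_square)
  qed
  also have "\<dots> = (2 * r * (real m)\<^sup>2) * (\<Sum>k=1..N-1. w k)" by (simp add: sum_distrib_left)
  also have "\<dots> \<le> (2 * r * (real m)\<^sup>2) * (2 * r * S)" using r_nonneg by (intro mult_left_mono sum_w) auto
  also have "\<dots> = 4 * (r\<^sup>2 * ((real m)\<^sup>2 * S))" by (simp add: power2_eq_square)
  also have "\<dots> \<le> 4 * (3 * s\<^sup>2 * L / (\<beta> * m))" by (intro mult_left_mono r2mS) simp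
  finally show ?thesis by simp
qed

lemma sum4_w2: "r\<^sup>2 * (\<Sum>k=1..N. hat m k ^ 4) + (\<Sum>k=1..N-1. (w k)\<^sup>2) \<le> Q"
  using sum4_le sum_w2 by (simp add: Q_def)

lemma sum_w_sqrt_le: "(\<Sum>k=1..N-1. w k * sqrt (t k)) \<le> 2 * s * L\<^sup>2"
proof -
  have "(\<Sum>k=1..N-1. w k * sqrt (t k)) \<le> (\<Sum>k=1..N-1. w k * sqrt (\<beta> * N))"
    by (intro sum_mono mult_left_mono w_nonneg) (use b in \<open>auto simp: t_def mult_ac\<close>)
  also have "\<dots> = sqrt (\<beta> * N) * (\<Sum>k=1..N-1. w k)" by (simp add: sum_distrib_left mult_ac)
  also have "\<dots> \<le> sqrt (\<beta> * N) * (2 * r * S)" using b by (intro mult_left_mono sum_w) auto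
  also have "\<dots> = 2 * sqrt N * (sqrt \<beta> * r * S)" by (simp add: real_sqrt_mult)
  also have "\<dots> = 2 * s * (real N powr (1/6) * sqrt N)" unfolding rS by simp
  also have "\<dots> = 2 * s * L\<^sup>2" unfolding pow_L by simp
  finally show ?thesis .
qed

lemma w_eq_0: "2 * m \<le> Suc k \<Longrightarrow> w k = 0"
  by (simp add: w_def hat_eq_0)

text \<open>The leading term \<open>2 * s * L\<^sup>2\<close> is the centring of \<open>Z\<close>.
  The relative loss \<open>e\<close> comes from replacing \<open>sqrt (t k) - 2 / sqrt (t k)\<close>
  by \<open>sqrt (\<beta> * N)\<close> on the support, and \<open>m / S\<close> is the relative loss
  of neighbouring products against squares.\<close>

lemma sum_w_sqrt_ge: "2 * s * L\<^sup>2 - \<Delta> \<le> (\<Sum>k=1..N-1. w k * sqrt (t k) - 2 * w k / sqrt (t k))"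
proof -
  define e where "e = 2 * m / real N + 3 / (\<beta> * N)"
  have e: "0 \<le> e" "e \<le> 1"
  proof -
    have "2 * m / real N \<le> 1/2" using mN m by (simp add: divide_le_eq)
    moreover have "3 / (\<beta> * N) \<le> 3 / 32" using Nb by (intro divide_left_mono) auto
    ultimately show "e \<le> 1" by (simp add: e_def)
  qed (use b in \<open>simp add: e_def\<close>)
  have key: "sqrt (\<beta> * N) * (1 - e) \<le> sqrt (t k) - 2 / sqrt (t k)" if k: "Suc k < 2 * m" for k
  proof -
    have "real k \<le> 2 * m" using k by simp
    have kN: "2 * k \<le> N" using k mN by simp
    have tk: "t k = \<beta> * N * (1 - k / N)" using kN N0 by (simp add: t_def of_nat_diff field_simps)
    have z: "0 \<le> k / real N" "k / real N \<le> 1" using kN N0 by auto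
    have "1 - k / N \<le> sqrt (1 - k / N)"
      using z by (intro real_le_rsqrt) (simp add: power2_eq_square mult_left_le)
    also have "1 - 2 * m / N \<le> 1 - k / N" using \<open>real k \<le> 2 * m\<close> N0 by (simp add: divide_right_mono)
    finally have "sqrt (\<beta> * N) * (1 - 2 * m / N) \<le> sqrt (\<beta> * N) * sqrt (1 - k / N)"
      using b by (intro mult_left_mono) auto
    then have 1: "sqrt (\<beta> * N) * (1 - 2 * m / N) \<le> sqrt (t k)" unfolding tk real_sqrt_mult .
    have "\<beta> * N / 2 \<le> t k"
    proof -
      have "\<beta> * N * (1/2) \<le> t k" unfolding tk using kN N0 b
        by (intro mult_left_mono) (auto simp: field_simps)
      then show ?thesis by simp
    qed
    \<comment> \<open>The rational 2/3 stands in for the square root of 1/2, since 4/9 < 1/2; it is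
      what produces the 3 in \<open>e\<close>.\<close>
    then have "(2/3) * sqrt (\<beta> * N) \<le> sqrt (t k)"
    proof (intro real_le_rsqrt)
      have "((2/3) * sqrt (\<beta> * N))\<^sup>2 = 4/9 * (\<beta> * N)"
        using b by (simp add: power_mult_distrib power_divide)
      then show "((2/3) * sqrt (\<beta> * N))\<^sup>2 \<le> t k"
        using \<open>\<beta> * N / 2 \<le> t k\<close> mult_nonneg_nonneg[of \<beta> "real N"] b by linarith
    qed
    moreover have sN: "sqrt (\<beta> * N) > 0" using b N0 by simp
    moreover have "t k > 0" using \<open>\<beta> * N / 2 \<le> t k\<close> mult_pos_pos[OF b N0] by linarith
    ultimately have "2 / sqrt (t k) \<le> 2 / ((2/3) * sqrt (\<beta> * N))"
      by (intro divide_left_mono mult_pos_pos) auto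
    also have "\<dots> = sqrt (\<beta> * N) * (3 / (\<beta> * N))"
      using sN b N0 by (simp add: field_simps)
    finally show ?thesis using 1 unfolding e_def by (simp add: algebra_simps)
  qed
  have "2 * s * L\<^sup>2 - \<Delta> \<le> sqrt (\<beta> * N) * (1 - e) * (2 * r * (S - m))"
  proof -
    have mS: "real m / S \<le> 3 / (real m)\<^sup>2"
      using S_ge S_pos m by (simp add: field_simps power2_eq_square power3_eq_cube)
    have "sqrt (\<beta> * N) * (1 - e) * (2 * r * (S - m)) = 2 * (1 - e) * (sqrt N * (sqrt \<beta> * r * S)) * (1 - m / S)"
      using S_pos by (simp add: real_sqrt_mult field_simps)
    also have "\<dots> = 2 * s * (real N powr (1/6) * sqrt N) * ((1 - e) * (1 - m / S))" unfolding rS by simp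
    also have "\<dots> = 2 * s * L\<^sup>2 * ((1 - e) * (1 - m / S))" unfolding pow_L by simp
    finally have eq: "sqrt (\<beta> * N) * (1 - e) * (2 * r * (S - m)) = 2 * s * L\<^sup>2 * ((1 - e) * (1 - m / S))" .
    have "(1 - e) * (1 - m / S) = 1 - e - m / S + e * (m / S)"
      by (simp only: left_diff_distrib right_diff_distrib mult_1 mult_1_right)
    moreover have "e * (m / S) \<ge> 0" using e S_pos by simp
    ultimately have "1 - e - 3 / (real m)\<^sup>2 \<le> (1 - e) * (1 - m / S)" using mS by linarith
    then have "2 * s * L\<^sup>2 * (1 - e - 3 / (real m)\<^sup>2) \<le> 2 * s * L\<^sup>2 * ((1 - e) * (1 - m / S))"
      using s by (intro mult_left_mono) auto
    moreover have "2 * s * L\<^sup>2 * (1 - e - 3 / (real m)\<^sup>2) = 2 * s * L\<^sup>2 - \<Delta>"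
      unfolding e_def \<Delta>_def pow_L(2)[symmetric] using pow_L(3) b m by (simp add: field_simps power2_eq_square)
    ultimately show ?thesis unfolding eq by linarith
  qed
  also have "\<dots> \<le> sqrt (\<beta> * N) * (1 - e) * (\<Sum>k=1..N-1. w k)"
    using e b by (intro mult_left_mono sum_w) auto
  also have "\<dots> = (\<Sum>k=1..N-1. w k * (sqrt (\<beta> * N) * (1 - e)))"
    by (simp add: sum_distrib_left sum_distrib_right mult_ac)
  also have "\<dots> \<le> (\<Sum>k=1..N-1. w k * (sqrt (t k) - 2 / sqrt (t k)))"
  proof (rule sum_mono)
    fix k
    show "w k * (sqrt (\<beta> * N) * (1 - e)) \<le> w k * (sqrt (t k) - 2 / sqrt (t k))"
      by (cases "Suc k < 2 * m") (auto intro!: mult_left_mono key w_nonneg simp: w_eq_0)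
  qed
  finally show ?thesis by (simp add: algebra_simps)
qed

text \<open>The tent lives in the first half of the indices, where at least half of the maximal
  parameter \<open>\<beta> * N\<close> is left. Outside its support \<open>w\<close> vanishes and
  the chi factors are trivial.\<close>

lemma t_ge: "Suc k < 2 * m \<Longrightarrow> 16 \<le> t k"
proof -
  assume k: "Suc k < 2 * m"
  then have "real N / 2 \<le> real (N - k)" using mN by (simp add: of_nat_diff)
  then have "real N / 2 * \<beta> \<le> t k" unfolding t_def using b by (intro mult_right_mono) auto
  then show ?thesis using Nb by (simp add: mult.commute)
qed

lemma measurable_form [measurable]:
  "(\<lambda>\<omega>. \<Sum>k=1..N. fst \<omega> k * (hat m k)\<^sup>2) \<in> borel_measurable (tri_law (\<lambda>_. gauss2) (chi_family \<beta> N) N)"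
  "(\<lambda>\<omega>. \<Sum>k=1..N-1. snd \<omega> k * hat m k * hat m (Suc k)) \<in> borel_measurable (tri_law (\<lambda>_. gauss2) (chi_family \<beta> N) N)"
  by (intro borel_measurable_sum borel_measurable_times measurable_tri_law_diag measurable_tri_law_offdiag; simp)+

text \<open>A sign \<open>\<sigma>\<close> covers both directions at once; it disappears from the
  Gaussian part, which is quadratic in it.\<close>

lemma Z_exp_moment:
  assumes \<sigma>: "\<sigma> = 1 \<or> \<sigma> = -1"
  shows "(\<integral>\<^sup>+ \<omega>. ennreal (exp (\<sigma> * s * Z \<omega>)) \<partial>entries_law \<beta> N)
    = ennreal (exp (- \<sigma> * (2 * s * L\<^sup>2) + r\<^sup>2 * (\<Sum>k=1..N. hat m k ^ 4)))
      * (\<Prod>k=1..N-1. \<integral>\<^sup>+ y. ennreal (exp (\<sigma> * w k * y)) \<partial>chi_family \<beta> N k)"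
proof -
  have "\<sigma> * s * Z \<omega> = - \<sigma> * (2 * s * L\<^sup>2) + (\<sigma> * r) * ((\<Sum>k=1..N. fst \<omega> k * (hat m k)\<^sup>2)
      + 2 * (\<Sum>k=1..N-1. snd \<omega> k * hat m k * hat m (Suc k)))" (is "_ = _ + _ * ?q") for \<omega>
  proof -
    have "\<sigma> * s * Z \<omega> = \<sigma> * (s * real N powr (1/6)) * (?q / (sqrt \<beta> * S)) - \<sigma> * (2 * s * (real N powr (1/6) * sqrt N))"
      unfolding Z_def quad_form_beta_matrix by (simp add: algebra_simps)
    also have "\<dots> = (\<sigma> * r) * ?q - \<sigma> * (2 * s * L\<^sup>2)" unfolding pow_L r_def by simp
    finally show ?thesis by simp
  qed
  then have "(\<integral>\<^sup>+ \<omega>. ennreal (exp (\<sigma> * s * Z \<omega>)) \<partial>entries_law \<beta> N)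
    = (\<integral>\<^sup>+ \<omega>. ennreal (exp (- \<sigma> * (2 * s * L\<^sup>2))) * ennreal (exp ((\<sigma> * r) * ((\<Sum>k=1..N. fst \<omega> k * (hat m k)\<^sup>2)
      + 2 * (\<Sum>k=1..N-1. snd \<omega> k * hat m k * hat m (Suc k))))) \<partial>tri_law (\<lambda>_. gauss2) (chi_family \<beta> N) N)"
    unfolding entries_law_eq_tri_law by (simp only: exp_add ennreal_mult exp_ge_zero)
  also have "\<dots> = ennreal (exp (- \<sigma> * (2 * s * L\<^sup>2))) * (\<integral>\<^sup>+ \<omega>. ennreal (exp ((\<sigma> * r) * ((\<Sum>k=1..N. fst \<omega> k * (hat m k)\<^sup>2)
      + 2 * (\<Sum>k=1..N-1. snd \<omega> k * hat m k * hat m (Suc k))))) \<partial>tri_law (\<lambda>_. gauss2) (chi_family \<beta> N) N)"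
  proof (rule nn_integral_cmult)
    show "(\<lambda>\<omega>. ennreal (exp ((\<sigma> * r) * ((\<Sum>k=1..N. fst \<omega> k * (hat m k)\<^sup>2)
      + 2 * (\<Sum>k=1..N-1. snd \<omega> k * hat m k * hat m (Suc k)))))) \<in> borel_measurable (tri_law (\<lambda>_. gauss2) (chi_family \<beta> N) N)"
      by measurable
  qed
  also have "\<dots> = ennreal (exp (- \<sigma> * (2 * s * L\<^sup>2))) * (ennreal (exp ((\<sigma> * r)\<^sup>2 * (\<Sum>k=1..N. hat m k ^ 4)))
      * (\<Prod>k=1..N-1. \<integral>\<^sup>+ y. ennreal (exp (2 * (\<sigma> * r) * hat m k * hat m (Suc k) * y)) \<partial>chi_family \<beta> N k))"
    using prob_space_chi_family[OF b] by (subst nn_integral_tri_law_exp) auto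
  also have "(\<sigma> * r)\<^sup>2 = r\<^sup>2" using \<sigma> by auto
  also have "(\<lambda>k y. 2 * (\<sigma> * r) * hat m k * hat m (Suc k) * y) = (\<lambda>k y. \<sigma> * w k * y)"
    by (simp add: w_def fun_eq_iff)
  finally show ?thesis by (simp only: exp_add ennreal_mult exp_ge_zero mult.assoc)
qed

lemma chi_family_eq: "k \<in> {1..N-1} \<Longrightarrow> chi_family \<beta> N k = chi_measure (t k)"
  by (auto simp: chi_family_def t_def)

lemma t_pos: "k \<in> {1..N-1} \<Longrightarrow> t k > 0"
  using b by (auto simp: t_def)

lemma Z_exp_le: "(\<integral>\<^sup>+ \<omega>. ennreal (exp (s * Z \<omega>)) \<partial>entries_law \<beta> N) \<le> ennreal (exp Q)"
proof -
  have "(\<Prod>k=1..N-1. \<integral>\<^sup>+ y. ennreal (exp (w k * y)) \<partial>chi_family \<beta> N k)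
      \<le> (\<Prod>k=1..N-1. ennreal (exp (w k * sqrt (t k) + (w k)\<^sup>2)))"
  proof (rule prod_mono_ennreal)
    fix k assume k: "k \<in> {1..N-1}"
    interpret prob_space "chi_measure (t k)" by (rule prob_space_chi_measure[OF t_pos[OF k]])
    show "(\<integral>\<^sup>+ y. ennreal (exp (w k * y)) \<partial>chi_family \<beta> N k) \<le> ennreal (exp (w k * sqrt (t k) + (w k)\<^sup>2))"
    proof (cases "Suc k < 2 * m")
      case True
      have "2 \<le> sqrt (t k)" using t_ge[OF True] by (intro real_le_rsqrt) simp
      then show ?thesis unfolding chi_family_eq[OF k]
        using w_le[of k] by (intro nn_integral_chi_exp_le t_pos[OF k] w_nonneg) simp
    next
      case False
      then show ?thesis unfolding chi_family_eq[OF k] using emeasure_space_1 by (simp add: w_eq_0)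
    qed
  qed
  also have "\<dots> = ennreal (exp ((\<Sum>k=1..N-1. w k * sqrt (t k)) + (\<Sum>k=1..N-1. (w k)\<^sup>2)))"
    by (simp add: prod_ennreal exp_sum sum.distrib[symmetric])
  finally have "(\<integral>\<^sup>+ \<omega>. ennreal (exp (s * Z \<omega>)) \<partial>entries_law \<beta> N)
     \<le> ennreal (exp (- (2 * s * L\<^sup>2) + r\<^sup>2 * (\<Sum>k=1..N. hat m k ^ 4)))
       * ennreal (exp ((\<Sum>k=1..N-1. w k * sqrt (t k)) + (\<Sum>k=1..N-1. (w k)\<^sup>2)))"
    using Z_exp_moment[of 1] by (simp add: mult_left_mono)
  also have "\<dots> \<le> ennreal (exp Q)"
    using sum_w_sqrt_le sum4_w2 by (simp add: ennreal_mult[symmetric] exp_add[symmetric])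
  finally show ?thesis .
qed

text \<open>The quadratic gain is supplied by the Gaussian diagonal. The chi entries are used only
  through a lower bound of first order in \<open>w\<close>, which cancels the centring up to
  \<open>\<Delta>\<close>.\<close>

lemma Z_exp_ge: "ennreal (exp (s\<^sup>2 * L / (2 * \<beta> * m) - \<Delta>)) \<le> (\<integral>\<^sup>+ \<omega>. ennreal (exp (s * Z \<omega>)) \<partial>entries_law \<beta> N)"
proof -
  have "ennreal (exp (s\<^sup>2 * L / (2 * \<beta> * m) - \<Delta>))
     \<le> ennreal (exp (- (2 * s * L\<^sup>2) + r\<^sup>2 * (\<Sum>k=1..N. hat m k ^ 4)))
       * ennreal (exp (\<Sum>k=1..N-1. w k * sqrt (t k) - 2 * w k / sqrt (t k)))"
    using sum_w_sqrt_ge sum4_ge by (simp add: ennreal_mult[symmetric] exp_add[symmetric])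
  also have "\<dots> \<le> ennreal (exp (- (2 * s * L\<^sup>2) + r\<^sup>2 * (\<Sum>k=1..N. hat m k ^ 4)))
       * (\<Prod>k=1..N-1. \<integral>\<^sup>+ y. ennreal (exp (w k * y)) \<partial>chi_family \<beta> N k)"
  proof (rule mult_left_mono)
    have "ennreal (exp (\<Sum>k=1..N-1. w k * sqrt (t k) - 2 * w k / sqrt (t k)))
      = (\<Prod>k=1..N-1. ennreal (exp (w k * sqrt (t k) - 2 * w k / sqrt (t k))))"
      by (simp add: prod_ennreal exp_sum)
    also have "\<dots> \<le> (\<Prod>k=1..N-1. \<integral>\<^sup>+ y. ennreal (exp (w k * y)) \<partial>chi_family \<beta> N k)"
    proof (rule prod_mono_ennreal)
      fix k assume k: "k \<in> {1..N-1}"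
      interpret prob_space "chi_measure (t k)" by (rule prob_space_chi_measure[OF t_pos[OF k]])
      show "ennreal (exp (w k * sqrt (t k) - 2 * w k / sqrt (t k))) \<le> (\<integral>\<^sup>+ y. ennreal (exp (w k * y)) \<partial>chi_family \<beta> N k)"
      proof (cases "Suc k < 2 * m")
        case True
        then show ?thesis unfolding chi_family_eq[OF k]
          using t_ge[OF True] by (intro nn_integral_chi_exp_ge w_nonneg) simp
      next
        case False
        then show ?thesis unfolding chi_family_eq[OF k] using emeasure_space_1 by (simp add: w_eq_0)
      qed
    qed
    finally show "ennreal (exp (\<Sum>k=1..N-1. w k * sqrt (t k) - 2 * w k / sqrt (t k)))
      \<le> (\<Prod>k=1..N-1. \<integral>\<^sup>+ y. ennreal (exp (w k * y)) \<partial>chi_family \<beta> N k)" .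
  qed simp
  also have "\<dots> = (\<integral>\<^sup>+ \<omega>. ennreal (exp (s * Z \<omega>)) \<partial>entries_law \<beta> N)"
    using Z_exp_moment[of 1] by simp
  finally show ?thesis .
qed

lemma Z_exp_neg_le: "(\<integral>\<^sup>+ \<omega>. ennreal (exp (- s * Z \<omega>)) \<partial>entries_law \<beta> N) \<le> ennreal (exp (Q + \<Delta>))"
proof -
  have "(\<Prod>k=1..N-1. \<integral>\<^sup>+ y. ennreal (exp (- w k * y)) \<partial>chi_family \<beta> N k)
      \<le> (\<Prod>k=1..N-1. ennreal (exp (- w k * sqrt (t k) + (w k)\<^sup>2 + 2 * w k / sqrt (t k))))"
  proof (rule prod_mono_ennreal)
    fix k assume k: "k \<in> {1..N-1}"
    interpret prob_space "chi_measure (t k)" by (rule prob_space_chi_measure[OF t_pos[OF k]])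
    show "(\<integral>\<^sup>+ y. ennreal (exp (- w k * y)) \<partial>chi_family \<beta> N k) \<le> ennreal (exp (- w k * sqrt (t k) + (w k)\<^sup>2 + 2 * w k / sqrt (t k)))"
    proof (cases "Suc k < 2 * m")
      case True
      \<comment> \<open>From \<open>t k \<ge> 16\<close> follows \<open>q \<ge> 4\<close>, hence q +
        2 \<le> q^2 / 2. With \<open>w k \<le> 1\<close> this is the side condition of the negative
        chi moment.\<close>
      define q where "q = sqrt (t k)"
      have q4: "4 \<le> q" unfolding q_def using t_ge[OF True] by (intro real_le_rsqrt) simp
      have "w k * q \<le> 1 * q" using w_le[of k] q4 by (intro mult_right_mono) auto
      moreover have "4 * q \<le> q * q" using q4 by (intro mult_right_mono) auto
      moreover have "q * q = t k" using t_pos[OF k] by (simp add: q_def)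
      ultimately have "w k * q + 2 \<le> t k / 2" using q4 by linarith
      then show ?thesis unfolding chi_family_eq[OF k]
        by (intro nn_integral_chi_exp_neg_le t_pos[OF k] w_nonneg) (simp add: q_def)
    next
      case False
      then show ?thesis unfolding chi_family_eq[OF k] using emeasure_space_1 by (simp add: w_eq_0)
    qed
  qed
  also have "\<dots> = ennreal (exp ((\<Sum>k=1..N-1. (w k)\<^sup>2) - (\<Sum>k=1..N-1. w k * sqrt (t k) - 2 * w k / sqrt (t k))))"
  proof -
    have "(\<Sum>k=1..N-1. - w k * sqrt (t k) + (w k)\<^sup>2 + 2 * w k / sqrt (t k))
      = (\<Sum>k=1..N-1. (w k)\<^sup>2) - (\<Sum>k=1..N-1. w k * sqrt (t k) - 2 * w k / sqrt (t k))"
      unfolding sum_subtractf[symmetric] by (rule sum.cong) auto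
    then show ?thesis by (simp only: prod_ennreal exp_ge_zero exp_sum[symmetric] finite_atLeastAtMost)
  qed
  finally have "(\<integral>\<^sup>+ \<omega>. ennreal (exp (- s * Z \<omega>)) \<partial>entries_law \<beta> N)
     \<le> ennreal (exp (2 * s * L\<^sup>2 + r\<^sup>2 * (\<Sum>k=1..N. hat m k ^ 4)))
       * ennreal (exp ((\<Sum>k=1..N-1. (w k)\<^sup>2) - (\<Sum>k=1..N-1. w k * sqrt (t k) - 2 * w k / sqrt (t k))))"
    using Z_exp_moment[of "-1"] by (simp add: mult_left_mono)
  also have "\<dots> \<le> ennreal (exp (Q + \<Delta>))"
    using sum_w_sqrt_ge sum4_w2 by (simp add: ennreal_mult[symmetric] exp_add[symmetric])
  finally show ?thesis .
qed

end

section \<open>Passage to the limit\<close>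

definition edge_stat :: "real \<Rightarrow> nat \<Rightarrow> (nat \<Rightarrow> real) \<times> (nat \<Rightarrow> real) \<Rightarrow> real" where
  "edge_stat \<beta> N \<omega> = real N powr (1/6) * (lambda_max N (beta_matrix \<beta> (fst \<omega>) (snd \<omega>)) - 2 * sqrt N)"

lemma measurable_edge_stat:
  assumes N: "N \<ge> 1"
  shows "edge_stat \<beta> N \<in> borel_measurable (entries_law \<beta> N)"
proof -
  let ?M = "tri_law (\<lambda>_. gauss2) (chi_family \<beta> N) N"
  have "(\<lambda>\<omega>. lambda_max N (beta_matrix \<beta> (fst \<omega>) (snd \<omega>))) \<in> borel_measurable ?M"
  proof (rule borel_measurable_lambda_max[OF N beta_matrix_sym])
    fix i j assume ij: "i \<in> {1..N}" "j \<in> {1..N}"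
    have g: "(\<lambda>\<omega>. fst \<omega> k) \<in> borel_measurable ?M" if "k \<in> {1..N}" for k
      by (rule measurable_tri_law_diag) (use that in auto)
    have c: "(\<lambda>\<omega>. snd \<omega> k) \<in> borel_measurable ?M" if "k \<in> {1..N-1}" for k
      by (rule measurable_tri_law_offdiag) (use that in auto)
    consider "i = j" | "i \<noteq> j" "j = i + 1" | "i \<noteq> j" "j \<noteq> i + 1" "i = j + 1" | "i \<noteq> j" "j \<noteq> i + 1" "i \<noteq> j + 1" by blast
    then show "(\<lambda>\<omega>. beta_matrix \<beta> (fst \<omega>) (snd \<omega>) i j) \<in> borel_measurable ?M"
    proof cases
      case 1 then show ?thesis using g[of i] ij by (simp add: beta_matrix_def)
    next
      case 2 then show ?thesis using c[of i] ij by (simp add: beta_matrix_def)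
    next
      case 3 then show ?thesis using c[of j] ij by (simp add: beta_matrix_def)
    next
      case 4 then show ?thesis by (simp add: beta_matrix_def)
    qed
  qed
  then have "(\<lambda>\<omega>. real N powr (1/6) * (lambda_max N (beta_matrix \<beta> (fst \<omega>) (snd \<omega>)) - 2 * sqrt N)) \<in> borel_measurable ?M"
    by measurable
  then show ?thesis unfolding edge_stat_def[abs_def] entries_law_eq_tri_law .
qed

lemma TW_approx_law_eq: "TW_approx_law \<beta> N = distr (entries_law \<beta> N) borel (edge_stat \<beta> N)"
  unfolding TW_approx_law_def edge_stat_def[abs_def] by (simp add: case_prod_beta')

lemma real_distribution_TW_approx_law:
  assumes "\<beta> > 0" "N \<ge> 1"
  shows "real_distribution (TW_approx_law \<beta> N)"
proof -
  interpret prob_space "entries_law \<beta> N" by (rule prob_space_entries_law[OF assms(1)])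
  show ?thesis unfolding TW_approx_law_eq
    by (rule real_distribution_distr) (use measurable_edge_stat[OF assms(2)] in simp)
qed

lemma nn_integral_TW_approx_law:
  assumes "\<beta> > 0" "N \<ge> 1" "f \<in> borel_measurable borel"
  shows "integral\<^sup>N (TW_approx_law \<beta> N) f = (\<integral>\<^sup>+ \<omega>. f (edge_stat \<beta> N \<omega>) \<partial>entries_law \<beta> N)"
  unfolding TW_approx_law_eq
  by (rule nn_integral_distr) (use measurable_edge_stat[OF assms(2)] assms(3) in auto)

lemma TW_approx_law_right_tail:
  fixes \<beta> x :: real and N :: nat
  assumes b: "\<beta> > 0" and x: "x \<ge> 4" "\<beta> * x \<ge> 34" and N: "N \<ge> 1" "x \<le> real N powr (2/3)"
  shows "emeasure (TW_approx_law \<beta> N) {x<..} \<le> ennreal ((1 + 12 ^ 6) * exp (- (\<beta> / 68) * x * sqrt x))"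
proof -
  have "emeasure (TW_approx_law \<beta> N) {x<..} = emeasure (entries_law \<beta> N) {\<omega> \<in> space (entries_law \<beta> N). x < edge_stat \<beta> N \<omega>}"
    unfolding TW_approx_law_eq using measurable_edge_stat[OF N(1), of \<beta>]
    by (subst emeasure_distr) (auto intro!: arg_cong[of _ _ "emeasure _"])
  also have "{\<omega> \<in> space (entries_law \<beta> N). x < edge_stat \<beta> N \<omega>}
    = {\<omega> \<in> space (entries_law \<beta> N). lambda_max N (beta_matrix \<beta> (fst \<omega>) (snd \<omega>)) > 2 * sqrt N + x * real N powr (-1/6)}"
  proof -
    have pw: "x * real N powr (-1/6) = x / real N powr (1/6)" by (simp add: powr_minus_divide)
    have p0: "real N powr (1/6) > 0" using N by simp
    have "x < edge_stat \<beta> N \<omega> \<longleftrightarrow> lambda_max N (beta_matrix \<beta> (fst \<omega>) (snd \<omega>)) > 2 * sqrt N + x * real N powr (-1/6)" for \<omega>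
      unfolding edge_stat_def pw using p0 by (simp add: field_simps)
    then show ?thesis by simp
  qed
  finally show ?thesis using entries_law_right_tail[OF assms] by simp
qed

text \<open>One width serves both \<open>s\<close> and \<open>2 * s\<close>, because the truncation
  argument compares a first and a second exponential moment of the same statistic. Doubling
  \<open>s\<close> turns 15 into 60; the summand 1 absorbs \<open>6 * s / (\<beta> * L)\<close>,
  which tends to 0.\<close>

lemma trial_eventually:
  fixes \<beta> s a :: real
  assumes b: "\<beta> > 0" and s: "s \<ge> 0" and a: "a > 0"
  shows "\<forall>\<^sub>F N in sequentially. \<exists>m. trial \<beta> s m N \<and> trial \<beta> (2 * s) m N
    \<and> trial.Q \<beta> s m N \<le> 15 * s\<^sup>2 / (\<beta> * a) \<and> trial.Q \<beta> (2 * s) m N \<le> 60 * s\<^sup>2 / (\<beta> * a)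
    \<and> trial.\<Delta> \<beta> s m N \<le> 8 * s * a + 6 * s / a\<^sup>2 + 1
    \<and> s\<^sup>2 / (4 * \<beta> * a) \<le> s\<^sup>2 * trial.L N / (2 * \<beta> * m)"
proof -
  let ?L = "\<lambda>N. real N powr (1/3)"
  have Linf: "filterlim ?L at_top sequentially" by real_asymp
  have ev: "\<forall>\<^sub>F N in sequentially. ?L N \<ge> c" for c
    using Linf by (simp add: filterlim_at_top)
  \<comment> \<open>In order, the thresholds ensure: rounding \<open>a * L\<close> up at most
    doubles it; the tent fits into \<open>4 * m \<le> N\<close>; powers of \<open>L\<close>
    increase; \<open>32 \<le> \<beta> * N\<close>; the assumption \<open>small\<close> holds for
    \<open>2 * s\<close>; the middle term of \<open>\<Delta>\<close> is at most 1.\<close>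
  have "\<forall>\<^sub>F N in sequentially. ?L N \<ge> 1 / a \<and> ?L N \<ge> 8 * a \<and> ?L N \<ge> 1 \<and> ?L N \<ge> 32 / \<beta>
      \<and> ?L N \<ge> (12 * s / (sqrt \<beta> * a))\<^sup>2 \<and> ?L N \<ge> 6 * s / \<beta>"
    by (intro eventually_conj ev)
  then show ?thesis
  proof eventually_elim
    case (elim N)
    define L where "L = ?L N"
    have L: "L \<ge> 1 / a" "L \<ge> 8 * a" "L \<ge> 1" "L \<ge> 32 / \<beta>" "L \<ge> (12 * s / (sqrt \<beta> * a))\<^sup>2" "L \<ge> 6 * s / \<beta>"
      using elim by (auto simp: L_def)
    have L0: "L > 0" using L by simp
    have N0: "real N > 0" using L by (cases "N = 0") (auto simp: L_def)
    have LN: "L * L * L = real N" using N0 unfolding L_def by (simp add: powr_add[symmetric])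
    define m where "m = nat \<lceil>a * L\<rceil>"
    have aL: "a * L \<ge> 1" using L a by (simp add: divide_le_eq mult.commute)
    have m1: "a * L \<le> real m" "real m \<le> 2 * (a * L)"
    proof -
      have "0 \<le> \<lceil>a * L\<rceil>" using aL by linarith
      then have "real m = of_int \<lceil>a * L\<rceil>" by (simp add: m_def)
      then show "a * L \<le> real m" "real m \<le> 2 * (a * L)" using aL by linarith+
    qed
    have m0: "real m > 0" using m1 aL by linarith
    have mge: "m \<ge> 1" using m0 by simp
    have mN: "4 * m \<le> N"
    proof -
      have "4 * real m \<le> 8 * a * L"  using m1 by linarith
      also have "\<dots> \<le> L * L" using L L0 by (intro mult_right_mono) auto
      also have "\<dots> \<le> L * L * L" using L mult_left_mono[of 1 L "L * L"] by simp
      finally show ?thesis unfolding LN by simp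
    qed
    have bN: "32 \<le> \<beta> * N"
    proof -
      have "32 \<le> \<beta> * L" using L b by (simp add: divide_le_eq mult.commute)
      also have "\<dots> \<le> \<beta> * (L * L * L)" using L b mult_mono[of 1 L 1 L] by (intro mult_left_mono) (auto simp: mult_le_cancel_left1 mult.assoc)
      finally show ?thesis unfolding LN .
    qed
    have p6: "real N powr (1/6) = sqrt L"
      unfolding L_def by (simp add: powr_half_sqrt[symmetric] powr_powr)
    have small: "6 * (2 * s) * real N powr (1/6) / (sqrt \<beta> * m) \<le> 1"
    proof -
      define q where "q = 12 * s / (sqrt \<beta> * a)"
      have q0: "q \<ge> 0" using s b a by (simp add: q_def)
      have "q \<le> sqrt L" using L(5) q0 by (intro real_le_rsqrt) (simp add: q_def)
      then have "q * sqrt L \<le> sqrt L * sqrt L" by (intro mult_right_mono) (use L0 in auto)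
      then have qL: "q * sqrt L \<le> L" using L0 by simp
      have "12 * s * sqrt L = (sqrt \<beta> * a) * (q * sqrt L)" using b a by (simp add: q_def)
      also have "\<dots> \<le> (sqrt \<beta> * a) * L" using qL b a by (intro mult_left_mono) auto
      also have "\<dots> = sqrt \<beta> * (a * L)" by simp
      also have "\<dots> \<le> sqrt \<beta> * m" using m1 b by (intro mult_left_mono) auto
      finally show ?thesis unfolding p6 using m0 b by (simp add: divide_le_eq)
    qed
    have T2: "trial \<beta> (2 * s) m N"
      by standard (use b s mge mN bN small in auto)
    have small': "6 * s * real N powr (1/6) / (sqrt \<beta> * m) \<le> 1"
    proof -
      have "6 * s * real N powr (1/6) / (sqrt \<beta> * m) \<le> 6 * (2 * s) * real N powr (1/6) / (sqrt \<beta> * m)"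
        using s b by (intro divide_right_mono mult_right_mono) auto
      then show ?thesis using small by linarith
    qed
    have T1: "trial \<beta> s m N"
      by standard (use b s mge mN bN small' in auto)
    interpret T1: trial \<beta> s m N by (rule T1)
    interpret T2: trial \<beta> "2 * s" m N by (rule T2)
    have TL: "trial.L N = L" by (simp add: T1.L_def L_def)
    have Lm: "L / m \<le> 1 / a" using m1 a m0 by (simp add: field_simps)
    have mL: "m / L \<le> 2 * a" using m1 L0 by (simp add: field_simps)
    have Qm: "c * L / (\<beta> * m) \<le> c / (\<beta> * a)" if "c \<ge> 0" for c
    proof -
      have "c / \<beta> * (L / m) \<le> c / \<beta> * (1 / a)" using Lm that b by (intro mult_left_mono) auto
      then show ?thesis by simp
    qed
    have "T1.Q \<le> 15 * s\<^sup>2 / (\<beta> * a)" unfolding T1.Q_def TL using Qm[of "15 * s\<^sup>2"] by simp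
    moreover have "T2.Q \<le> 60 * s\<^sup>2 / (\<beta> * a)" unfolding T2.Q_def TL using Qm[of "60 * s\<^sup>2"] by simp
    moreover have "T1.\<Delta> \<le> 8 * s * a + 6 * s / a\<^sup>2 + 1"
    proof -
      have "4 * s * (m / L) \<le> 4 * s * (2 * a)" using mL s by (intro mult_left_mono) auto
      moreover have "6 * s * (L / m)\<^sup>2 \<le> 6 * s * (1 / a)\<^sup>2" using Lm s L0 by (intro mult_left_mono power_mono) auto
      moreover have "6 * s / (\<beta> * L) \<le> 1" using L(6) b L0 by (simp add: divide_le_eq mult.commute)
      ultimately show ?thesis unfolding T1.\<Delta>_def TL by (simp add: power_divide)
    qed
    moreover have "s\<^sup>2 / (4 * \<beta> * a) \<le> s\<^sup>2 * L / (2 * \<beta> * m)"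
    proof -
      have "1 / (2 * a) \<le> L / m" using m1 a m0 by (simp add: field_simps)
      then have "s\<^sup>2 / (2 * \<beta>) * (1 / (2 * a)) \<le> s\<^sup>2 / (2 * \<beta>) * (L / m)" using b by (intro mult_left_mono) auto
      then show ?thesis by simp
    qed
    ultimately show ?case using T1 T2 unfolding TL by blast
  qed
qed

text \<open>The trial quotient is below the largest eigenvalue, so exp (- s x) is largest for the
  trial statistic. Width parameter \<open>a = 1\<close> is enough, with 14 = 8 + 6.\<close>

lemma TW_approx_law_neg_exp_moment:
  assumes b: "\<beta> > 0" and s: "s \<ge> 0"
  shows "\<forall>\<^sub>F N in sequentially. (\<integral>\<^sup>+ x. ennreal (exp (- s * x)) \<partial>TW_approx_law \<beta> N) \<le> ennreal (exp (15 * s\<^sup>2 / \<beta> + 14 * s + 1))"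
  using trial_eventually[OF b s zero_less_one] eventually_ge_at_top[of 1]
proof eventually_elim
  case (elim N)
  then obtain m where T: "trial \<beta> s m N" "trial.Q \<beta> s m N \<le> 15 * s\<^sup>2 / \<beta>" "trial.\<Delta> \<beta> s m N \<le> 8 * s + 6 * s + 1"
    by auto
  interpret trial \<beta> s m N by (rule T)
  have "(\<integral>\<^sup>+ x. ennreal (exp (- s * x)) \<partial>TW_approx_law \<beta> N) = (\<integral>\<^sup>+ \<omega>. ennreal (exp (- s * edge_stat \<beta> N \<omega>)) \<partial>entries_law \<beta> N)"
    using elim by (intro nn_integral_TW_approx_law b) auto
  also have "\<dots> \<le> (\<integral>\<^sup>+ \<omega>. ennreal (exp (- s * Z \<omega>)) \<partial>entries_law \<beta> N)"
    using Z_le s by (intro nn_integral_mono ennreal_leI) (auto simp: edge_stat_def intro!: mult_left_mono)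
  also have "\<dots> \<le> ennreal (exp (Q + \<Delta>))" by (rule Z_exp_neg_le)
  also have "\<dots> \<le> ennreal (exp (15 * s\<^sup>2 / \<beta> + 14 * s + 1))"
    using T by (intro ennreal_leI) simp
  finally show ?case by simp
qed

lemma Z_measurable:
  assumes "trial \<beta> s m N"
  shows "trial.Z \<beta> m N \<in> borel_measurable (entries_law \<beta> N)"
proof -
  interpret trial \<beta> s m N by fact
  show ?thesis unfolding Z_def[abs_def] quad_form_beta_matrix entries_law_eq_tri_law by measurable
qed

text \<open>Since \<open>min u M \<ge> u - u\<^sup>2 / M\<close>, the second exponential moment of the trial statistic makes
  the truncated exponential moment bounded below, uniformly in \<open>N\<close>.\<close>
lemma TW_approx_law_exp_moment_ge:
  fixes \<beta> s a :: real
  assumes b: "\<beta> > 0" and s: "s \<ge> 0" and a: "a > 0"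
  defines "l \<equiv> exp (s\<^sup>2 / (4 * \<beta> * a) - 8 * s * a - 6 * s / a\<^sup>2 - 1)"
  defines "M \<equiv> 2 * exp (60 * s\<^sup>2 / (\<beta> * a)) / l"
  shows "\<forall>\<^sub>F N in sequentially. ennreal (l / 2) \<le> (\<integral>\<^sup>+ x. ennreal (min (exp (s * x)) M) \<partial>TW_approx_law \<beta> N)"
  using trial_eventually[OF b s a] eventually_ge_at_top[of 1]
proof eventually_elim
  case (elim N)
  then obtain m where T: "trial \<beta> s m N" "trial \<beta> (2 * s) m N" "trial.Q \<beta> (2 * s) m N \<le> 60 * s\<^sup>2 / (\<beta> * a)"
    "trial.\<Delta> \<beta> s m N \<le> 8 * s * a + 6 * s / a\<^sup>2 + 1" "s\<^sup>2 / (4 * \<beta> * a) \<le> s\<^sup>2 * trial.L N / (2 * \<beta> * m)"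
    by auto
  interpret trial \<beta> s m N by (rule T)
  interpret T2: trial \<beta> "2 * s" m N by (rule T)
  have l0: "l > 0" by (simp add: l_def)
  have M0: "M > 0" using l0 by (simp add: M_def)
  have [measurable]: "Z \<in> borel_measurable (entries_law \<beta> N)" by (rule Z_measurable[OF T(1)])
  have "ennreal l \<le> (\<integral>\<^sup>+ \<omega>. ennreal (exp (s * Z \<omega>)) \<partial>entries_law \<beta> N)"
  proof -
    have "ennreal l \<le> ennreal (exp (s\<^sup>2 * L / (2 * \<beta> * m) - \<Delta>))" unfolding l_def using T by (intro ennreal_leI) simp
    then show ?thesis using Z_exp_ge by (rule order_trans)
  qed
  also have "\<dots> \<le> (\<integral>\<^sup>+ \<omega>. ennreal (min (exp (s * Z \<omega>)) M) + ennreal (1 / M) * ennreal (exp (2 * s * Z \<omega>)) \<partial>entries_law \<beta> N)"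
  proof (rule nn_integral_mono)
    fix \<omega>
    define u where "u = exp (s * Z \<omega>)"
    have u2: "exp (2 * s * Z \<omega>) = u\<^sup>2" by (simp add: u_def power2_eq_square exp_add[symmetric])
    have u0: "u > 0" by (simp add: u_def)
    have "u \<le> min u M + 1 / M * u\<^sup>2"
    proof (cases "u \<le> M")
      case False
      then have "M * u \<le> u * u" using u0 by (intro mult_right_mono) auto
      then have "u \<le> 1 / M * u\<^sup>2" using M0 by (simp add: power2_eq_square pos_le_divide_eq mult.commute)
      then show ?thesis using M0 u0 by (simp add: min_def)
    qed (use M0 in simp)
    then show "ennreal (exp (s * Z \<omega>)) \<le> ennreal (min (exp (s * Z \<omega>)) M) + ennreal (1 / M) * ennreal (exp (2 * s * Z \<omega>))"
      unfolding u2 u_def[symmetric] using u0 M0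
      by (simp add: ennreal_mult[symmetric] ennreal_plus[symmetric] ennreal_leI del: ennreal_plus)
  qed
  also have "\<dots> = (\<integral>\<^sup>+ \<omega>. ennreal (min (exp (s * Z \<omega>)) M) \<partial>entries_law \<beta> N)
      + ennreal (1 / M) * (\<integral>\<^sup>+ \<omega>. ennreal (exp (2 * s * Z \<omega>)) \<partial>entries_law \<beta> N)"
    by (subst nn_integral_add) (auto simp: nn_integral_cmult)
  also have "\<dots> \<le> (\<integral>\<^sup>+ x. ennreal (min (exp (s * x)) M) \<partial>TW_approx_law \<beta> N) + ennreal (l / 2)"
  proof (rule add_mono)
    \<comment> \<open>Truncation is applied to \<open>Z\<close>, whose second exponential moment is
      controlled; monotonicity of the truncated exponential then passes to the largest
      eigenvalue.\<close>
    have "(\<integral>\<^sup>+ x. ennreal (min (exp (s * x)) M) \<partial>TW_approx_law \<beta> N) = (\<integral>\<^sup>+ \<omega>. ennreal (min (exp (s * edge_stat \<beta> N \<omega>)) M) \<partial>entries_law \<beta> N)"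
      using elim by (intro nn_integral_TW_approx_law b) auto
    moreover have "(\<integral>\<^sup>+ \<omega>. ennreal (min (exp (s * Z \<omega>)) M) \<partial>entries_law \<beta> N) \<le> \<dots>"
      using Z_le s by (intro nn_integral_mono ennreal_leI min.mono) (auto simp: edge_stat_def intro!: mult_left_mono)
    ultimately show "(\<integral>\<^sup>+ \<omega>. ennreal (min (exp (s * Z \<omega>)) M) \<partial>entries_law \<beta> N) \<le> (\<integral>\<^sup>+ x. ennreal (min (exp (s * x)) M) \<partial>TW_approx_law \<beta> N)"
      by simp
    have "ennreal (1 / M) * (\<integral>\<^sup>+ \<omega>. ennreal (exp (2 * s * Z \<omega>)) \<partial>entries_law \<beta> N) \<le> ennreal (1 / M) * ennreal (exp (60 * s\<^sup>2 / (\<beta> * a)))"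
    proof (rule mult_left_mono)
      have "ennreal (exp T2.Q) \<le> ennreal (exp (60 * s\<^sup>2 / (\<beta> * a)))" using T(3) by (intro ennreal_leI) simp
      then show "(\<integral>\<^sup>+ \<omega>. ennreal (exp (2 * s * Z \<omega>)) \<partial>entries_law \<beta> N) \<le> ennreal (exp (60 * s\<^sup>2 / (\<beta> * a)))"
        using T2.Z_exp_le by (rule order_trans[rotated])
    qed simp
    also have "\<dots> = ennreal (1 / M * exp (60 * s\<^sup>2 / (\<beta> * a)))" using M0 by (simp add: ennreal_mult[symmetric])
    \<comment> \<open>\<open>M\<close> is chosen so that the truncation costs exactly half of the
      lower bound \<open>l\<close>.\<close>
    also have "1 / M * exp (60 * s\<^sup>2 / (\<beta> * a)) = l / 2" by (simp add: M_def)
    finally show "ennreal (1 / M) * (\<integral>\<^sup>+ \<omega>. ennreal (exp (2 * s * Z \<omega>)) \<partial>entries_law \<beta> N) \<le> ennreal (l / 2)" .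
  qed
  finally have "ennreal (l / 2) + ennreal (l / 2) \<le> (\<integral>\<^sup>+ x. ennreal (min (exp (s * x)) M) \<partial>TW_approx_law \<beta> N) + ennreal (l / 2)"
    using l0 by (simp flip: ennreal_plus)
  then show ?case by (simp add: add.commute ennreal_add_left_cancel_le)
qed

section \<open>Transfer of moments and tails to weak limits\<close>

lemma weak_conv_nn_integral_tendsto:
  fixes f :: "real \<Rightarrow> real"
  assumes \<mu>: "\<And>n. real_distribution (\<mu> n)" and M: "real_distribution M" and w: "weak_conv_m \<mu> M"
    and cont: "\<And>x. isCont f x" and f: "\<And>x. 0 \<le> f x" "\<And>x. f x \<le> B"
  shows "(\<lambda>n. integral\<^sup>N (\<mu> n) (\<lambda>x. ennreal (f x))) \<longlonglongrightarrow> integral\<^sup>N M (\<lambda>x. ennreal (f x))"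
proof -
  have fm: "f \<in> borel_measurable borel"
    using cont by (intro borel_measurable_continuous_onI continuous_at_imp_continuous_on) auto
  have eq: "integral\<^sup>N \<nu> (\<lambda>x. ennreal (f x)) = ennreal (integral\<^sup>L \<nu> f)" if "real_distribution \<nu>" for \<nu>
  proof -
    interpret real_distribution \<nu> by fact
    have "integrable \<nu> f"
      by (rule integrable_const_bound[of _ B]) (use f fm in auto)
    then show ?thesis by (rule nn_integral_eq_integral) (use f in auto)
  qed
  have "(\<lambda>n. integral\<^sup>L (\<mu> n) f) \<longlonglongrightarrow> integral\<^sup>L M f"
    by (rule weak_conv_imp_integral_bdd_continuous_conv[OF \<mu> M w cont, of B]) (use f in auto)
  then show ?thesis unfolding eq[OF \<mu>] eq[OF M] by (rule tendsto_ennrealI)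
qed

text \<open>The truncations at integer heights are bounded and continuous, so their integrals
  converge weakly; Fatou's lemma then removes the truncation in the limit law.\<close>

lemma weak_conv_nn_integral_exp_le:
  fixes s B :: real
  assumes \<mu>: "\<And>n. real_distribution (\<mu> n)" and M: "real_distribution M" and w: "weak_conv_m \<mu> M"
    and B: "\<forall>\<^sub>F n in sequentially. (\<integral>\<^sup>+ x. ennreal (exp (s * x)) \<partial>\<mu> n) \<le> ennreal B"
  shows "(\<integral>\<^sup>+ x. ennreal (exp (s * x)) \<partial>M) \<le> ennreal B"
proof -
  interpret M: real_distribution M by fact
  let ?f = "\<lambda>k x. min (exp (s * x)) (real k)"
  have fk: "(\<integral>\<^sup>+ x. ennreal (?f k x) \<partial>M) \<le> ennreal B" for k
  proof (rule tendsto_upperbound)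
    show "(\<lambda>n. \<integral>\<^sup>+ x. ennreal (?f k x) \<partial>\<mu> n) \<longlonglongrightarrow> (\<integral>\<^sup>+ x. ennreal (?f k x) \<partial>M)"
      by (rule weak_conv_nn_integral_tendsto[OF \<mu> M w, of _ "real k"]) (auto intro!: continuous_intros)
    show "\<forall>\<^sub>F n in sequentially. (\<integral>\<^sup>+ x. ennreal (?f k x) \<partial>\<mu> n) \<le> ennreal B"
      using B
    proof eventually_elim
      case (elim n)
      have "(\<integral>\<^sup>+ x. ennreal (?f k x) \<partial>\<mu> n) \<le> (\<integral>\<^sup>+ x. ennreal (exp (s * x)) \<partial>\<mu> n)"
        by (intro nn_integral_mono ennreal_leI) auto
      then show ?case using elim by (rule order_trans)
    qed
  qed simp
  have "(\<integral>\<^sup>+ x. ennreal (exp (s * x)) \<partial>M) = (\<integral>\<^sup>+ x. liminf (\<lambda>k. ennreal (?f k x)) \<partial>M)"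
  proof (rule nn_integral_cong)
    fix x
    have "(\<lambda>k. ennreal (?f k x)) \<longlonglongrightarrow> ennreal (exp (s * x))"
    proof (rule tendsto_eventually)
      obtain n where n: "exp (s * x) \<le> real n" using real_arch_simple by blast
      show "\<forall>\<^sub>F k in sequentially. ennreal (?f k x) = ennreal (exp (s * x))"
        using eventually_ge_at_top[of n] by eventually_elim (use n in \<open>auto simp: min_def\<close>)
    qed
    then show "ennreal (exp (s * x)) = liminf (\<lambda>k. ennreal (?f k x))"
      by (rule lim_imp_Liminf[OF trivial_limit_sequentially, symmetric])
  qed
  also have "\<dots> \<le> liminf (\<lambda>k. \<integral>\<^sup>+ x. ennreal (?f k x) \<partial>M)"
    by (rule nn_integral_liminf) simp
  also have "\<dots> \<le> ennreal B"
  proof -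
    have "liminf (\<lambda>k. \<integral>\<^sup>+ x. ennreal (?f k x) \<partial>M) \<le> liminf (\<lambda>k::nat. ennreal B)"
      by (rule Liminf_mono) (use fk in simp)
    then show ?thesis by (simp add: Liminf_const)
  qed
  finally show ?thesis .
qed

text \<open>A continuous ramp lies between the two indicators, so no continuity of the limit law at
  \<open>a\<close> enters. The price is a shift of the threshold by 1.\<close>

lemma weak_conv_tail_le:
  fixes a B :: real
  assumes \<mu>: "\<And>n. real_distribution (\<mu> n)" and M: "real_distribution M" and w: "weak_conv_m \<mu> M"
    and B: "\<forall>\<^sub>F n in sequentially. emeasure (\<mu> n) {a<..} \<le> ennreal B"
  shows "emeasure M {a + 1..} \<le> ennreal B"
proof -
  interpret M: real_distribution M by fact
  let ?f = "\<lambda>x. max 0 (min 1 (x - a))"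
  have "emeasure M {a + 1..} = (\<integral>\<^sup>+ x. indicator {a + 1..} x \<partial>M)" by simp
  also have "\<dots> \<le> (\<integral>\<^sup>+ x. ennreal (?f x) \<partial>M)"
    by (rule nn_integral_mono) (auto simp: indicator_def)
  also have "\<dots> \<le> ennreal B"
  proof (rule tendsto_upperbound)
    show "(\<lambda>n. \<integral>\<^sup>+ x. ennreal (?f x) \<partial>\<mu> n) \<longlonglongrightarrow> (\<integral>\<^sup>+ x. ennreal (?f x) \<partial>M)"
      by (rule weak_conv_nn_integral_tendsto[OF \<mu> M w, of _ 1]) (auto intro!: continuous_intros)
    show "\<forall>\<^sub>F n in sequentially. (\<integral>\<^sup>+ x. ennreal (?f x) \<partial>\<mu> n) \<le> ennreal B"
      using B
    proof eventually_elim
      case (elim n)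
      interpret N: real_distribution "\<mu> n" by (rule \<mu>)
      have "(\<integral>\<^sup>+ x. ennreal (?f x) \<partial>\<mu> n) \<le> (\<integral>\<^sup>+ x. indicator {a<..} x \<partial>\<mu> n)"
        by (rule nn_integral_mono) (auto simp: indicator_def ennreal_neg)
      also have "\<dots> = emeasure (\<mu> n) {a<..}" by simp
      finally show ?case using elim by (rule order_trans)
    qed
  qed simp
  finally show ?thesis .
qed

text \<open>The half-line is cut into unit slices. Half of the decay exponent c j^(3/2) pays for s j
  by a Young-type inequality and produces the cubic growth; the other half makes the sum over slices
  geometric.\<close>

lemma exp_moment_of_tail:
  fixes c K :: real and j0 :: nat
  assumes M: "real_distribution M" and c: "c > 0" and K: "K \<ge> 0" and j0: "j0 \<ge> 1"
    and tail: "\<And>j. j \<ge> j0 \<Longrightarrow> emeasure M {real j + 1..} \<le> ennreal (K * exp (- c * j * sqrt j))"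
  shows "\<exists>C\<ge>0. \<forall>s\<ge>0. (\<integral>\<^sup>+ x. ennreal (exp (s * x)) \<partial>M) \<le> ennreal (exp (C * (1 + s) ^ 3))"
proof -
  interpret M: real_distribution M by fact
  define \<rho> where "\<rho> = exp (- c / 2)"
  have \<rho>: "0 < \<rho>" "\<rho> < 1" using c by (auto simp: \<rho>_def)
  define G where "G = 1 / (1 - \<rho>)"
  have G: "G > 0" using \<rho> by (simp add: G_def)
  define C where "C = ln (1 + K * G) + (real j0 + 3) + 4 / c\<^sup>2"
  have KG: "ln (1 + K * G) \<ge> 0" using K G by (intro ln_ge_zero) simp
  have C: "C \<ge> 0" unfolding C_def using KG by simp
  have main: "(\<integral>\<^sup>+ x. ennreal (exp (s * x)) \<partial>M) \<le> ennreal (exp (C * (1 + s) ^ 3))" if s: "s \<ge> 0" for s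
  proof -
    \<comment> \<open>The summand \<open>2 * s\<close> comes from bounding x by j + 2 on a slice,
      the cubic summand from the Young-type inequality.\<close>
    define D where "D = 2 * s + 4 * s ^ 3 / c\<^sup>2"
    define h where "h j x = ennreal (exp (s * (real j + 2))) * indicator {real j + 1..} x" for j :: nat and x :: real
    have hm [measurable]: "h j \<in> borel_measurable M" for j
      unfolding h_def by measurable
    have pt: "ennreal (exp (s * x)) \<le> ennreal (exp (s * (real j0 + 1))) + (\<Sum>j. h (j + j0) x)" for x
    proof (cases "x \<le> real j0 + 1")
      case True
      then have "exp (s * x) \<le> exp (s * (real j0 + 1))" using s by (simp add: mult_left_mono)
      then show ?thesis by (intro add_increasing2 ennreal_leI) auto
    next
      case False
      \<comment> \<open>The index is chosen so that j + 1 \<le> x \<le> j + 2, matching the shifted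
        threshold in the tail hypothesis.\<close>
      define j where "j = nat \<lfloor>x\<rfloor> - 1"
      have fl: "\<lfloor>x\<rfloor> \<ge> int j0 + 1" using False by linarith
      have rj: "real j = of_int \<lfloor>x\<rfloor> - 1" using fl by (simp add: j_def of_nat_diff nat_le_iff)
      have j: "real j + 1 \<le> x" "x \<le> real j + 2" "j \<ge> j0" using rj fl by (auto simp: j_def) linarith+
      have "ennreal (exp (s * x)) \<le> ennreal (exp (s * (real j + 2)))"
        using j s by (intro ennreal_leI) (simp add: mult_left_mono)
      also have "\<dots> = h (j - j0 + j0) x" using j by (simp add: h_def)
      also have "\<dots> = (\<Sum>i\<in>{j - j0}. h (i + j0) x)" by simp
      also have "\<dots> \<le> (\<Sum>i. h (i + j0) x)" by (rule sum_le_suminf) auto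
      finally show ?thesis by (rule add_increasing[rotated]) simp
    qed
    have "(\<integral>\<^sup>+ x. ennreal (exp (s * x)) \<partial>M) \<le> (\<integral>\<^sup>+ x. ennreal (exp (s * (real j0 + 1))) + (\<Sum>j. h (j + j0) x) \<partial>M)"
      by (intro nn_integral_mono pt)
    also have "\<dots> = ennreal (exp (s * (real j0 + 1))) + (\<Sum>j. integral\<^sup>N M (h (j + j0)))"
      by (simp add: nn_integral_add nn_integral_suminf hm M.emeasure_space_1[simplified])
    also have "\<dots> \<le> ennreal (exp (s * (real j0 + 1))) + (\<Sum>j. ennreal (K * exp D * \<rho> ^ (j + j0)))"
    proof (intro add_left_mono suminf_le summableI)
      fix i
      define j where "j = i + j0"
      have jj: "j \<ge> j0" "j \<ge> 1" using j0 by (auto simp: j_def)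
      have "integral\<^sup>N M (h j) = ennreal (exp (s * (real j + 2))) * emeasure M {real j + 1..}"
        unfolding h_def by (subst nn_integral_cmult_indicator) auto
      also have "\<dots> \<le> ennreal (exp (s * (real j + 2))) * ennreal (K * exp (- c * j * sqrt j))"
        by (intro mult_left_mono tail jj) simp
      also have "\<dots> = ennreal (K * exp (s * (real j + 2) - c * j * sqrt j))"
        using K by (simp add: ennreal_mult[symmetric] exp_add[symmetric] exp_diff exp_minus field_simps)
      also have "\<dots> \<le> ennreal (K * (exp D * \<rho> ^ j))"
      proof (intro ennreal_leI mult_left_mono K)
        \<comment> \<open>Either \<open>sqrt j\<close> is large enough for the decay to dominate, or
          \<open>j\<close> is below (2 s / c)^2 and the product is at most cubic in
          \<open>s\<close>.\<close>
        have "s * j \<le> c / 2 * (j * sqrt j) + 4 * s ^ 3 / c\<^sup>2"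
        proof (cases "2 * s / c \<le> sqrt j")
          case True
          then have "s \<le> c / 2 * sqrt j" using c by (simp add: field_simps)
          then have "s * j \<le> c / 2 * sqrt j * j" by (intro mult_right_mono) auto
          moreover have "0 \<le> 4 * s ^ 3 / c\<^sup>2" using s by simp
          ultimately show ?thesis by (simp add: mult_ac)
        next
          case False
          then have "(sqrt j)\<^sup>2 \<le> (2 * s / c)\<^sup>2" by (intro power_mono) auto
          then have "s * j \<le> s * (2 * s / c)\<^sup>2" using s by (intro mult_left_mono) auto
          also have "\<dots> = 4 * s ^ 3 / c\<^sup>2" by (simp add: power_divide power2_eq_square power3_eq_cube)
          finally show ?thesis using c by (simp add: add_increasing)
        qed
        moreover have "c / 2 * j \<le> c / 2 * (j * sqrt j)"
          using jj c mult_left_mono[of 1 "sqrt j" "real j"] by (intro mult_left_mono) auto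
        ultimately have "s * (real j + 2) - c * j * sqrt j \<le> D - c / 2 * j"
          unfolding D_def by (simp add: algebra_simps)
        then have "exp (s * (real j + 2) - c * j * sqrt j) \<le> exp (D - c / 2 * j)" by simp
        also have "\<dots> = exp D * \<rho> ^ j"
          by (simp add: \<rho>_def exp_of_nat_mult[symmetric] exp_add[symmetric] mult_ac)
        finally show "exp (s * (real j + 2) - c * j * sqrt j) \<le> exp D * \<rho> ^ j" .
      qed
      finally show "integral\<^sup>N M (h (i + j0)) \<le> ennreal (K * exp D * \<rho> ^ (i + j0))"
        unfolding j_def by (simp add: mult.assoc)
    qed
    also have "(\<Sum>j. ennreal (K * exp D * \<rho> ^ (j + j0))) = ennreal (K * exp D * \<rho> ^ j0 * G)"
    proof -
      have "(\<lambda>j. (K * exp D * \<rho> ^ j0) * \<rho> ^ j) sums ((K * exp D * \<rho> ^ j0) * G)"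
        unfolding G_def using \<rho> by (intro sums_mult geometric_sums) simp
      then have "(\<lambda>j. K * exp D * \<rho> ^ (j + j0)) sums (K * exp D * \<rho> ^ j0 * G)"
        by (simp add: power_add mult_ac)
      then show ?thesis using K \<rho> by (intro suminf_ennreal_eq) auto
    qed
    also have "ennreal (exp (s * (real j0 + 1))) + \<dots> \<le> ennreal (exp (C * (1 + s) ^ 3))"
    proof -
      define X where "X = s * (real j0 + 1)"
      have X: "X \<ge> 0" "D \<ge> 0" using s by (auto simp: X_def D_def)
      have "K * exp D * \<rho> ^ j0 * G \<le> K * exp D * 1 * G"
        using K \<rho> G by (intro mult_right_mono mult_left_mono power_le_one) auto
      also have "\<dots> = K * G * exp D" by simp
      also have "\<dots> \<le> K * G * exp (X + D)" using K G X by (intro mult_left_mono) auto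
      finally have "exp X + K * exp D * \<rho> ^ j0 * G \<le> exp (X + D) + K * G * exp (X + D)"
        using X by (intro add_mono) auto
      then have "exp (s * (real j0 + 1)) + K * exp D * \<rho> ^ j0 * G \<le> (1 + K * G) * exp (s * (real j0 + 1) + D)"
        unfolding X_def by (simp only: distrib_right mult_1)
      also have "\<dots> = exp (ln (1 + K * G) + (s * (real j0 + 1) + D))"
        using K G by (simp add: exp_add add_pos_nonneg)
      also have "\<dots> \<le> exp (C * (1 + s) ^ 3)"
      proof -
        have q: "1 \<le> (1 + s) ^ 3" "s \<le> (1 + s) ^ 3" "s ^ 3 \<le> (1 + s) ^ 3"
        proof -
          show "1 \<le> (1 + s) ^ 3" using s by (intro one_le_power) simp
          have "1 + s \<le> (1 + s) ^ 3" using s by (intro self_le_power) auto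
          then show "s \<le> (1 + s) ^ 3" by simp
          show "s ^ 3 \<le> (1 + s) ^ 3" using s by (intro power_mono) auto
        qed
        have "ln (1 + K * G) * 1 \<le> ln (1 + K * G) * (1 + s) ^ 3" by (rule mult_left_mono[OF q(1) KG])
        moreover have "(real j0 + 3) * s \<le> (real j0 + 3) * (1 + s) ^ 3" by (rule mult_left_mono[OF q(2)]) simp
        moreover have "4 / c\<^sup>2 * s ^ 3 \<le> 4 / c\<^sup>2 * (1 + s) ^ 3" by (rule mult_left_mono[OF q(3)]) simp
        ultimately show ?thesis unfolding C_def D_def by (simp add: algebra_simps)
      qed
      finally show ?thesis using K G \<rho>
        by (simp add: ennreal_plus[symmetric] ennreal_leI del: ennreal_plus)
    qed
    finally show ?thesis .
  qed
  show ?thesis using C main by blast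
qed

section \<open>Cubic growth against infinite divisibility\<close>

theorem theorem1:
  fixes \<beta> :: real and TW :: "real measure"
  assumes "\<beta> > 0"
    and "real_distribution TW"
    and "weak_conv_m (\<lambda>n. TW_approx_law \<beta> (Suc n)) TW"
  shows "\<not> infinitely_divisible TW"
proof
  assume id: "infinitely_divisible TW"
  note b = assms(1) and w = assms(3)
  interpret T: real_distribution TW by fact
  let ?\<mu> = "\<lambda>n. TW_approx_law \<beta> (Suc n)"
  have \<mu>: "real_distribution (?\<mu> n)" for n by (rule real_distribution_TW_approx_law[OF b]) simp
  note T = assms(2)
  have Suc_ev: "\<forall>\<^sub>F n in sequentially. P (Suc n)" if "\<forall>\<^sub>F n in sequentially. P n" for P
    using that by (simp add: eventually_sequentially_Suc)
  have left: "(\<integral>\<^sup>+ x. ennreal (exp (- s * x)) \<partial>TW) \<le> ennreal (exp (15 * s\<^sup>2 / \<beta> + 14 * s + 1))" if "s \<ge> 0" for s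
    by (rule weak_conv_nn_integral_exp_le[OF \<mu> T w])
       (rule Suc_ev[OF TW_approx_law_neg_exp_moment[OF b that]])
  \<comment> \<open>From this index on, both lower bounds on \<open>x\<close> in the right tail
    estimate hold, 4 and 34 / \<beta>.\<close>
  define j0 where "j0 = nat \<lceil>4 + 34 / \<beta>\<rceil>"
  have j0: "real j0 \<ge> 4 + 34 / \<beta>" unfolding j0_def by linarith
  have "34 / \<beta> > 0" using b by simp
  then have "real j0 > 0" using j0 by linarith
  then have j01: "j0 \<ge> 1" by simp
  have tail: "emeasure TW {real j + 1..} \<le> ennreal ((1 + 12 ^ 6) * exp (- (\<beta> / 68) * j * sqrt j))" if j: "j \<ge> j0" for j
  proof (rule weak_conv_tail_le[OF \<mu> T w])
    have jr: "real j \<ge> 4 + 34 / \<beta>" using j0 j by linarith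
    have j4: "real j \<ge> 4" using jr \<open>34 / \<beta> > 0\<close> by linarith
    have jb: "\<beta> * real j \<ge> 34"
    proof -
      have "\<beta> * (34 / \<beta>) \<le> \<beta> * real j" using jr b by (intro mult_left_mono) auto
      then show ?thesis using b by simp
    qed
    have "filterlim (\<lambda>n::nat. real n powr (2/3)) at_top sequentially" by real_asymp
    then have "\<forall>\<^sub>F n in sequentially. real j \<le> real n powr (2/3)" by (simp add: filterlim_at_top)
    then have "\<forall>\<^sub>F n in sequentially. real j \<le> real (Suc n) powr (2/3)" by (rule Suc_ev)
    then show "\<forall>\<^sub>F n in sequentially. emeasure (?\<mu> n) {real j<..} \<le> ennreal ((1 + 12 ^ 6) * exp (- (\<beta> / 68) * j * sqrt j))"
      by eventually_elim (rule TW_approx_law_right_tail[OF b j4 jb], auto)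
  qed
  obtain C where C: "C \<ge> 0" "\<And>s. s \<ge> 0 \<Longrightarrow> (\<integral>\<^sup>+ x. ennreal (exp (s * x)) \<partial>TW) \<le> ennreal (exp (C * (1 + s) ^ 3))"
    using exp_moment_of_tail[OF T _ _ j01 tail] b
    by (metis add_nonneg_nonneg divide_pos_pos zero_less_numeral zero_le_numeral zero_le_one zero_le_power)
  define C' where "C' = C + 15 / \<beta> + 15"
  have C'0: "C' \<ge> 0" "C \<le> C'" using C(1) b by (auto simp: C'_def)
  have bound: "(\<integral>\<^sup>+ x. ennreal (exp (s * x)) \<partial>TW) \<le> ennreal (exp (C' * (1 + \<bar>s\<bar>) ^ 3))" for s
  proof (cases "s \<ge> 0")
    case True
    have "C * (1 + s) ^ 3 \<le> C' * (1 + \<bar>s\<bar>) ^ 3"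
      using True C'0 by (intro mult_mono) auto
    then show ?thesis using C(2)[OF True] by (meson ennreal_leI exp_le_cancel_iff order_trans)
  next
    case False
    define r where "r = - s"
    have r: "r \<ge> 0" "s = - r" "\<bar>s\<bar> = r" using False by (auto simp: r_def)
    have "15 * r\<^sup>2 / \<beta> + 14 * r + 1 \<le> C' * (1 + r) ^ 3"
    proof -
      have q: "1 \<le> (1 + r) ^ 3" "r \<le> (1 + r) ^ 3" "r\<^sup>2 \<le> (1 + r) ^ 3"
      proof -
        show "1 \<le> (1 + r) ^ 3" using r by (intro one_le_power) simp
        have "1 + r \<le> (1 + r) ^ 3" using r by (intro self_le_power) auto
        then show "r \<le> (1 + r) ^ 3" by simp
        have "r\<^sup>2 \<le> (1 + r)\<^sup>2" using r by (intro power_mono) auto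
        also have "\<dots> \<le> (1 + r) ^ 3" using r by (intro power_increasing) auto
        finally show "r\<^sup>2 \<le> (1 + r) ^ 3" .
      qed
      have "15 / \<beta> * r\<^sup>2 \<le> 15 / \<beta> * (1 + r) ^ 3" using q(3) b by (intro mult_left_mono) auto
      moreover have "0 \<le> C * (1 + r) ^ 3" using C r by simp
      ultimately show ?thesis using q(1,2) unfolding C'_def by (simp add: algebra_simps)
    qed
    then show ?thesis using left[OF r(1)] unfolding r(3) unfolding r(2)
      by (meson ennreal_leI exp_le_cancel_iff order_trans)
  qed
  have em: "exp_moments TW"
    unfolding exp_moments_def
  proof
    fix s
    show "integrable TW (\<lambda>x. exp (s * x))"
      using order.strict_trans1[OF bound[of s] ennreal_less_top] by (simp add: integrable_iff_bounded)
  qed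
  have mgf: "(\<integral>\<^sup>+ x. ennreal (exp (s * x)) \<partial>TW) = ennreal (\<integral>x. exp (s * x) \<partial>TW)" for s
    using em by (intro nn_integral_eq_integral) (auto simp: exp_moments_def)
  obtain A where A: "\<And>s. s \<ge> 0 \<Longrightarrow> (\<integral>x. exp (s * x) \<partial>TW) \<le> exp (A * (1 + s\<^sup>2))"
  proof -
    have "(\<integral>x. exp (s * x) \<partial>TW) \<le> exp (C' * (1 + \<bar>s\<bar>) ^ 3)" for s
      using bound[of s] unfolding mgf by (simp only: ennreal_le_iff exp_ge_zero)
    from infinitely_divisible_mgf_quadratic[OF T em id this] that show ?thesis by blast
  qed
  have lower: "s ^ 3 / (384 * \<beta>\<^sup>2) - 384 * \<beta> - 2 \<le> A * (1 + s\<^sup>2)" if s: "s > 0" for s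
  proof -
    \<comment> \<open>With a = \<kappa> \<beta> / s the cubic coefficient is (1 / (4 \<kappa>) - 6 /
      \<kappa>^2) / \<beta>^2. The choice 48 maximises it, with value 1 / (384 \<beta>^2), while
      \<open>8 * s * a\<close> stays constant.\<close>
    define a where "a = 48 * \<beta> / s"
    have a: "a > 0" using b s by (simp add: a_def)
    define l where "l = exp (s\<^sup>2 / (4 * \<beta> * a) - 8 * s * a - 6 * s / a\<^sup>2 - 1)"
    define M where "M = 2 * exp (60 * s\<^sup>2 / (\<beta> * a)) / l"
    have M0: "M > 0" by (simp add: M_def l_def)
    have "ennreal (l / 2) \<le> (\<integral>\<^sup>+ x. ennreal (min (exp (s * x)) M) \<partial>TW)"
    proof (rule tendsto_lowerbound)
      show "(\<lambda>n. \<integral>\<^sup>+ x. ennreal (min (exp (s * x)) M) \<partial>?\<mu> n) \<longlonglongrightarrow> (\<integral>\<^sup>+ x. ennreal (min (exp (s * x)) M) \<partial>TW)"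
        by (rule weak_conv_nn_integral_tendsto[OF \<mu> T w, of _ M]) (use M0 in \<open>auto intro!: continuous_intros\<close>)
      show "\<forall>\<^sub>F n in sequentially. ennreal (l / 2) \<le> (\<integral>\<^sup>+ x. ennreal (min (exp (s * x)) M) \<partial>?\<mu> n)"
        unfolding M_def l_def
        by (rule Suc_ev[OF TW_approx_law_exp_moment_ge[OF b less_imp_le[OF s] a]])
    qed simp
    also have "\<dots> \<le> (\<integral>\<^sup>+ x. ennreal (exp (s * x)) \<partial>TW)"
      by (intro nn_integral_mono ennreal_leI) auto
    finally have "l / 2 \<le> (\<integral>x. exp (s * x) \<partial>TW)" unfolding mgf by simp
    then have "l / 2 \<le> exp (A * (1 + s\<^sup>2))" using A[OF less_imp_le[OF s]] by (rule order_trans)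
    \<comment> \<open>The factor 1/2 left by truncation is traded for one more unit in the exponent,
      so that only exponents are compared.\<close>
    moreover have "l * exp (- 1) \<le> l / 2"
    proof -
      have "2 \<le> exp (1::real)" using exp_ge_add_one_self[of 1] by simp
      then have "exp (- 1) \<le> 1 / (2::real)" by (simp add: exp_minus field_simps)
      then have "l * exp (- 1) \<le> l * (1 / 2)" by (rule mult_left_mono) (simp add: l_def)
      then show ?thesis by simp
    qed
    ultimately have "l * exp (- 1) \<le> exp (A * (1 + s\<^sup>2))" by linarith
    then have "s\<^sup>2 / (4 * \<beta> * a) - 8 * s * a - 6 * s / a\<^sup>2 - 1 + - 1 \<le> A * (1 + s\<^sup>2)"
      unfolding l_def exp_add[symmetric] by simp
    moreover have "s\<^sup>2 / (4 * \<beta> * a) = 2 * (s ^ 3 / (384 * \<beta>\<^sup>2))" "8 * s * a = 384 * \<beta>"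
      "6 * s / a\<^sup>2 = s ^ 3 / (384 * \<beta>\<^sup>2)"
      using b s by (simp_all add: a_def power2_eq_square power3_eq_cube)
    ultimately show ?thesis by linarith
  qed
  define c B where "c = 1 / (384 * \<beta>\<^sup>2)" and "B = 384 * \<beta> + 2"
  have c: "c > 0" and B: "B \<ge> 0" using b by (auto simp: c_def B_def)
  \<comment> \<open>Large enough that \<open>c * s\<close> exceeds
    \<open>2 * \<bar>A\<bar> + B + 1\<close>. After multiplication by \<open>s\<^sup>2\<close> the
    cubic term outgrows both the quadratic bound and the constant \<open>B\<close>.\<close>
  define s where "s = 1 + (2 * \<bar>A\<bar> + B + 1) / c"
  have s1: "s \<ge> 1" using c B by (simp add: s_def)
  have "c * s = c + (2 * \<bar>A\<bar> + B + 1)" unfolding s_def distrib_left using c by simp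
  then have "2 * \<bar>A\<bar> + B + 1 \<le> c * s" using c by linarith
  then have 1: "(2 * \<bar>A\<bar> + B + 1) * s\<^sup>2 \<le> c * s * s\<^sup>2" by (intro mult_right_mono) auto
  have 2: "c * s * s\<^sup>2 = s ^ 3 / (384 * \<beta>\<^sup>2)" by (simp add: c_def power2_eq_square power3_eq_cube)
  have 3: "s ^ 3 / (384 * \<beta>\<^sup>2) - B \<le> A * (1 + s\<^sup>2)" using lower[of s] s1 by (simp add: B_def)
  have 4: "A * (1 + s\<^sup>2) \<le> \<bar>A\<bar> * (2 * s\<^sup>2)"
  proof (rule mult_mono)
    have "1 \<le> s\<^sup>2" by (rule one_le_power[OF s1])
    then show "1 + s\<^sup>2 \<le> 2 * s\<^sup>2" by linarith
  qed auto
  have 5: "B + 1 \<le> (B + 1) * s\<^sup>2"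
    using mult_left_mono[OF one_le_power[OF s1, of 2], of "B + 1"] B by simp
  have 6: "(2 * \<bar>A\<bar> + B + 1) * s\<^sup>2 = \<bar>A\<bar> * (2 * s\<^sup>2) + (B + 1) * s\<^sup>2"
    by (simp add: algebra_simps)
  have lin: False if "p \<le> q" "q = v" "v - B \<le> w" "w \<le> x" "B + 1 \<le> y" "p = x + y" for p q v w x y
    using that by linarith
  show False by (rule lin[OF 1 2 3 4 5 6])
qed

end
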